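(* For every dimension $n$ there exists a constant $C$, depending only on $n$, such that the following holds. Let $1\leq q\leq\frac n{n-1}$, $\alpha=n-q(n-1)$, let $f\in W^{1,1}_{\mathrm{loc}}(\mathbb R^n)$ and let $\mu$ be a Radon measure on $\mathbb R^n$ with $\mu\ll\mathcal L$. Then \[ \biggl(\int_Q|f-f_Q|^q\,d\mu\biggr)^{\frac1q}\leq C\int_Q|\nabla f|\,\bigl(\mathrm M^{\mathrm d}_{\alpha,Q}\mu\bigr)^{\frac1q}\,dx \] for every cube $Q\subset\mathbb R^n$. Alternatively, $\mu$ may be an arbitrary Radon measure (not necessarily absolutely continuous), and then the same inequality holds for every continuous function $f\in W^{1,1}(\mathbb R^n)$.
   Context: $\mathcal L$ is Lebesgue measure on $\mathbb R^n$; $\mu\ll\mathcal L$ means that $\mathcal L(A)=0$ implies $\mu(A)=0$. A cube is a closed axis-parallel cube in $\mathbb R^n$, with side length $\mathrm l(Q)$. $f_Q=\frac1{\mathcal L(Q)}\int_Q f\,dx$. For a cube $Q$, $\mathcal D_k(Q)$ ($k\in\mathbb N_0$) is the collection of the $2^{kn}$ (closed) dyadic subcubes of $Q$ of side length $2^{-k}\mathrm l(Q)$ with pairwise disjoint interiors obtained by repeatedly bisecting the sides of $Q$, and $\mathcal D(Q)=\bigcup_{k\ge0}\mathcal D_k(Q)$. The local dyadic fractional maximal function is \[ \mathrm M^{\mathrm d}_{\alpha,Q}\mu(x)=\sup_{Q'\ni x,\;Q'\in\mathcal D(Q)}\mathrm l(Q')^{\alpha}\,\frac{\mu(Q')}{\mathcal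 L(Q')} . \] *)

theory Defs
  imports "HOL-Analysis.Analysis"
begin

subsection \<open>Cubes and dyadic subcubes\<close>

definition cube :: "real ^ 'n \<Rightarrow> real \<Rightarrow> (real ^ 'n) set" where
  "cube a l = cbox a (\<chi> i. a $ i + l)"

definition is_cube :: "(real ^ 'n) set \<Rightarrow> bool" where
  "is_cube Q \<longleftrightarrow> (\<exists>a l. 0 < l \<and> Q = cube a l)"

definition side_length :: "(real ^ 'n) set \<Rightarrow> real" where
  "side_length Q = (THE l. 0 < l \<and> (\<exists>a. Q = cube a l))"

lemma cube_eq_iff:
  fixes a b :: "real ^ 'n"
  assumes "0 < l" "0 < m"
  shows "cube a l = cube b m \<longleftrightarrow> a = b \<and> l = m"
proof
  assume "cube a l = cube b m"
  moreover have "cbox a (\<chi> i. a $ i + l) \<noteq> {}"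
    using assms by (auto simp: interval_ne_empty_cart less_imp_le)
  ultimately have "a = b" "(\<chi> i. a $ i + l) = (\<chi> i. b $ i + m)"
    by (auto simp: cube_def eq_cbox)
  then show "a = b \<and> l = m" by (auto simp: vec_eq_iff)
qed simp

lemma side_length_cube: "0 < l \<Longrightarrow> side_length (cube a l) = l"
  unfolding side_length_def by (rule the_equality) (auto simp: cube_eq_iff)

text \<open>The \<open>2^n\<close> closed cubes obtained by bisecting every side of \<open>Q\<close>; the set \<open>S\<close> records
  the coordinates in which the upper half is taken.\<close>

definition bisect :: "(real ^ 'n) set \<Rightarrow> (real ^ 'n) set set" where
  "bisect Q = {cube (\<chi> i. a $ i + (if i \<in> S then l / 2 else 0)) (l / 2) | a l S.
                 0 < l \<and> Q = cube a l}"

fun dyadic_gen :: "nat \<Rightarrow> (real ^ 'n) set \<Rightarrow> (real ^ 'n) set set" where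
  "dyadic_gen 0 Q = {Q}"
| "dyadic_gen (Suc k) Q = (\<Union>Q'\<in>dyadic_gen k Q. bisect Q')"

definition dyadic :: "(real ^ 'n) set \<Rightarrow> (real ^ 'n) set set" where
  "dyadic Q = (\<Union>k. dyadic_gen k Q)"


subsection \<open>Radon measures and the local dyadic fractional maximal function\<close>

text \<open>Radon measures are taken as Borel measures. On \<open>real ^ 'n\<close>, inner regularity
  is automatic from finiteness on compact sets.\<close>

definition radon_measure :: "(real ^ 'n) measure \<Rightarrow> bool" where
  "radon_measure \<mu> \<longleftrightarrow>
     sets \<mu> = sets borel \<and>
     (\<forall>K. compact K \<longrightarrow> emeasure \<mu> K < \<infinity>) \<and>
     (\<forall>B\<in>sets borel. emeasure \<mu> B = (SUP K\<in>{K. compact K \<and> K \<subseteq> B}. emeasure \<mu> K))"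

definition dyadic_maximal ::
    "real \<Rightarrow> (real ^ 'n) set \<Rightarrow> (real ^ 'n) measure \<Rightarrow> real ^ 'n \<Rightarrow> ennreal" where
  "dyadic_maximal \<alpha> Q \<mu> x =
     (SUP Q'\<in>{Q'\<in>dyadic Q. x \<in> Q'}.
        ennreal (side_length Q' powr \<alpha>) * (emeasure \<mu> Q' / emeasure lborel Q'))"

text \<open>Real powers on \<open>[0, \<infinity>]\<close>, intended for exponents \<open>p > 0\<close>.\<close>

definition ennpowr :: "ennreal \<Rightarrow> real \<Rightarrow> ennreal" where
  "ennpowr x p = (if x = \<infinity> then \<infinity> else ennreal (enn2real x powr p))"


subsection \<open>Sobolev functions\<close>

definition partial_deriv :: "'n \<Rightarrow> (real ^ 'n \<Rightarrow> real) \<Rightarrow> real ^ 'n \<Rightarrow> real" where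
  "partial_deriv i \<phi> x = frechet_derivative \<phi> (at x) (axis i 1)"

fun C_k :: "nat \<Rightarrow> (real ^ 'n \<Rightarrow> real) \<Rightarrow> bool" where
  "C_k 0 \<phi> \<longleftrightarrow> continuous_on UNIV \<phi>"
| "C_k (Suc k) \<phi> \<longleftrightarrow> \<phi> differentiable_on UNIV \<and> (\<forall>i. C_k k (partial_deriv i \<phi>))"

definition test_function :: "(real ^ 'n \<Rightarrow> real) \<Rightarrow> bool" where
  "test_function \<phi> \<longleftrightarrow> (\<forall>k. C_k k \<phi>) \<and> compact (closure {x. \<phi> x \<noteq> 0})"

definition locally_integrable :: "(real ^ 'n \<Rightarrow> 'b::euclidean_space) \<Rightarrow> bool" where
  "locally_integrable f \<longleftrightarrow> (\<forall>K. compact K \<longrightarrow> set_integrable lebesgue K f)"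

definition weak_gradient :: "(real ^ 'n \<Rightarrow> real) \<Rightarrow> (real ^ 'n \<Rightarrow> real ^ 'n) \<Rightarrow> bool" where
  "weak_gradient f g \<longleftrightarrow> locally_integrable f \<and> locally_integrable g \<and>
     (\<forall>\<phi> i. test_function \<phi> \<longrightarrow>
        (LINT x|lebesgue. f x * partial_deriv i \<phi> x) = - (LINT x|lebesgue. g x $ i * \<phi> x))"

definition W11_loc :: "(real ^ 'n \<Rightarrow> real) set" where
  "W11_loc = {f. \<exists>g. weak_gradient f g}"

definition W11 :: "(real ^ 'n \<Rightarrow> real) set" where
  "W11 = {f. integrable lebesgue f \<and> (\<exists>g. weak_gradient f g \<and> integrable lebesgue g)}"

definition average :: "(real ^ 'n) set \<Rightarrow> (real ^ 'n \<Rightarrow> real) \<Rightarrow> real" where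
  "average Q f = (LINT x:Q|lebesgue. f x) / measure lebesgue Q"

end

(* Fix a cube Q. For a dyadic subcube R let s_R be an upper quantile of f on R, and let A_R be the
   maximum of f_Q and of the quantiles of the proper dyadic ancestors of R. Dyadic density (or
   continuity of f) gives f - f_Q <= sum_R (s_R - A_R)^+ 1_R almost everywhere with respect to mu, so
   by the triangle inequality the L^q(mu) norm of (f - f_Q)^+ is at most
   sum_R (s_R - A_R)^+ mu(R)^(1/q). Here mu(R)^(1/q) <= l(R)^(n-1) M^(1/q) on R. For R other than Q,
   f is at least s_R on a fixed fraction of R and at most A_R on half of R, so that a Poincare
   inequality localised to levels gives
   (s_R - A_R)^+ l(R)^(n-1) <= C * integral of |grad f| over R Int {A_R < f < s_R}.
   The intervals (A_R, s_R) are disjoint along every branch of the dyadic tree, hence these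
   integrals add up without overlap; the same argument for -f bounds (f - f_Q)^-.

   The localised Poincare inequality needs neither the chain rule nor the coarea formula: for
   almost every x, f is absolutely continuous along the segment from x to x + h, and crossing from
   below A to above s costs at least s - A in the part of the segment where A < f < s. *)

theory Submission
  imports Defs
begin

section \<open>Test functions\<close>

text \<open>Telescoping the averages of f over nested dyadic cubes would pay for the whole gradient
  in every generation, so that one point is charged infinitely often. A jump of the running maximum
  is charged only inside its own band of levels; this needs both sides of the band to have
  substantial measure in the cube, which quantiles guarantee and averages do not. Only Q has no
  parent to control the side below the band; its jump is paid by the ordinary Poincare inequality,
  and a point is charged at most twice in all. The exponent \<alpha> is the one for which
  l(R)^\<alpha> mu(R) / l(R)^n, raised to 1/q, equals mu(R)^(1/q) / l(R)^(n-1), the scaling of the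
  Poincare inequality. Apart from the choice of a Borel representative, the two alternatives for mu
  and f differ at one place: every t < f x must lie below the quantile of some dyadic cube
  containing x, for mu-almost every x in Q. The behaviour on segments is obtained for one shift h at
  a time and almost every x, by testing against translated bumps; the Poincare inequalities then
  integrate over all pairs (x, x + h).\<close>

lemma DERIV_zero_quadratic_bound:
  fixes F :: "real \<Rightarrow> real"
  assumes "\<And>s. \<bar>F s\<bar> \<le> K * (s - t)\<^sup>2"
  shows "(F has_real_derivative 0) (at t)"
proof -
  have F0: "F t = 0" using assms[of t] by simp
  have "((\<lambda>h. (F (t + h) - F t) / h) \<longlongrightarrow> 0) (at 0)"
  proof (rule Lim_null_comparison)
    show "\<forall>\<^sub>F h in at 0. norm ((F (t + h) - F t) / h) \<le> K * \<bar>h\<bar>"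
    proof (intro always_eventually allI)
      fix h :: real
      have "\<bar>F (t + h)\<bar> \<le> K * \<bar>h\<bar> * \<bar>h\<bar>"
        using assms[of "t + h"] by (simp add: power2_eq_square mult.assoc)
      then show "norm ((F (t + h) - F t) / h) \<le> K * \<bar>h\<bar>"
        using F0 by (cases "h = 0") (simp_all add: pos_divide_le_eq)
    qed
    show "((\<lambda>h. K * \<bar>h\<bar>) \<longlongrightarrow> 0) (at 0)" by (intro tendsto_mult_right_zero tendsto_rabs_zero tendsto_ident_at)
  qed
  then show ?thesis by (simp add: DERIV_def)
qed

text \<open>This family is closed under differentiation, which gives smoothness. Letting \<open>e\<close>
  tend to \<open>0\<close> with \<open>p = 1\<close> and \<open>m = 0\<close> gives the indicator of the open interval.\<close>

definition bump_fam :: "real \<Rightarrow> real \<Rightarrow> real \<Rightarrow> real poly \<Rightarrow> nat \<Rightarrow> real \<Rightarrow> real" where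
  "bump_fam a b e p m t = (if a < t \<and> t < b
     then poly p t * (1 / ((t - a) * (b - t))) ^ m * exp (- (e / ((t - a) * (b - t)))) else 0)"

lemma power_exp_le:
  fixes x :: real
  assumes "0 \<le> x"
  shows "x ^ k \<le> fact k * exp x"
proof -
  have "x ^ k /\<^sub>R fact k \<le> exp x"
    using sum_le_suminf[OF summable_exp_generic[of x], of "{k}"] assms by (simp add: exp_def)
  then show ?thesis by (simp add: field_simps)
qed

text \<open>The exponential beats every power of 1 / w, where w = (s - a) * (b - s). Spending m + 2
  powers leaves w^2, and w vanishes at least linearly in the distance to a point t outside the
  interval. The bound makes the extension by zero differentiable at t.\<close>

lemma bump_fam_quadratic_bound:
  assumes e: "0 < e" and t: "\<not> (a < t \<and> t < b)"
  shows "\<exists>K. \<forall>s. \<bar>bump_fam a b e p m s\<bar> \<le> K * (s - t)\<^sup>2"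
proof -
  obtain P where P: "\<And>s. s \<in> {a..b} \<Longrightarrow> \<bar>poly p s\<bar> \<le> P"
    using compact_imp_bounded[OF compact_continuous_image[OF continuous_on_poly[OF continuous_on_id', of "{a..b}" p] compact_Icc]]
    unfolding bounded_iff by fastforce
  define K where "K = P * (fact (m + 2) / e ^ (m + 2)) * (b - a)\<^sup>2"
  have "\<bar>bump_fam a b e p m s\<bar> \<le> K * (s - t)\<^sup>2" if s: "a < s" "s < b" for s
  proof -
    define w where "w = (s - a) * (b - s)"
    have w: "0 < w" using s by (simp add: w_def)
    have "(e / w) ^ (m + 2) \<le> fact (m + 2) * exp (e / w)"
      using e w by (intro power_exp_le) simp
    then have "e ^ (m + 2) \<le> fact (m + 2) * exp (e / w) * w ^ (m + 2)"
      using w by (simp add: power_divide pos_divide_le_eq)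
    moreover have "(1 / w) ^ m * w ^ m = 1" using w by (simp add: power_divide)
    ultimately have *: "(1 / w) ^ m * exp (- (e / w)) \<le> fact (m + 2) / e ^ (m + 2) * w\<^sup>2"
      using e w by (simp add: exp_minus power_divide power_add divide_simps) (simp add: mult_ac power2_eq_square)
    \<comment> \<open>Since t lies outside the interval, one factor of w is at most |s - t|; the
      other is at most b - a.\<close>
    have "w \<le> (b - a) * \<bar>s - t\<bar>"
    proof (cases "t \<le> a")
      case True
      then have "(s - a) * (b - s) \<le> \<bar>s - t\<bar> * (b - a)" using s by (intro mult_mono) auto
      then show ?thesis by (simp add: w_def mult.commute)
    next
      case False
      then have "(s - a) * (b - s) \<le> (b - a) * \<bar>s - t\<bar>" using s t by (intro mult_mono) auto
      then show ?thesis by (simp add: w_def)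
    qed
    then have w2: "w\<^sup>2 \<le> (b - a)\<^sup>2 * (s - t)\<^sup>2"
      using w power_mono[of w "(b - a) * \<bar>s - t\<bar>" 2] by (simp add: power_mult_distrib)
    have "\<bar>bump_fam a b e p m s\<bar> = \<bar>poly p s\<bar> * ((1 / w) ^ m * exp (- (e / w)))"
      using s w by (simp add: bump_fam_def w_def abs_mult)
    also have "\<dots> \<le> P * (fact (m + 2) / e ^ (m + 2) * w\<^sup>2)"
      using P[of s] s w by (intro mult_mono[OF _ *]) auto
    also have "\<dots> \<le> P * (fact (m + 2) / e ^ (m + 2) * ((b - a)\<^sup>2 * (s - t)\<^sup>2))"
      using w2 e P[of s] s by (intro mult_left_mono) auto
    finally show ?thesis by (simp add: K_def mult_ac)
  qed
  \<comment> \<open>The absolute value covers an empty interval, for which nothing fixes the sign of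
    \<open>P\<close>.\<close>
  then have "\<bar>bump_fam a b e p m s\<bar> \<le> \<bar>K\<bar> * (s - t)\<^sup>2" for s
    using mult_right_mono[OF abs_ge_self[of K], of "(s - t)\<^sup>2"]
    by (cases "a < s \<and> s < b") (force, auto simp: bump_fam_def)
  then show ?thesis by blast
qed

lemma bump_fam_DERIV:
  assumes e: "0 < e"
  shows "\<exists>q. \<forall>t. (bump_fam a b e p m has_real_derivative bump_fam a b e q (m + 2) t) (at t)"
proof -
  define w where "w = [:-a, 1:] * [:b, -1:]"
  define w' where "w' = [:a + b, -2:]"
  \<comment> \<open>The product rule brought over the common factor w^(-(m + 2)); hence the exponent
    rises by two.\<close>
  define q where "q = pderiv p * w\<^sup>2 - smult (of_nat m) (p * w' * w) + smult e (p * w')"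
  have "(bump_fam a b e p m has_real_derivative bump_fam a b e q (m + 2) t) (at t)" for t
  proof (cases "a < t \<and> t < b")
    case True
    define W where "W s = (s - a) * (b - s)" for s
    have W: "W t > 0" using True by (simp add: W_def)
    have pw: "poly w s = W s" for s by (simp add: w_def W_def algebra_simps)
    have dW: "(W has_real_derivative poly w' t) (at t)"
      unfolding W_def[abs_def] w'_def by (auto intro!: derivative_eq_intros simp: algebra_simps)
    define v where "v = 1 / W t"
    have v: "W t = 1 / v" "v \<noteq> 0" using W by (auto simp: v_def)
    have du: "((\<lambda>s. 1 / W s) has_real_derivative (- poly w' t * v\<^sup>2)) (at t)"
      using W by (auto intro!: derivative_eq_intros dW simp: v_def power2_eq_square)
    have dum: "((\<lambda>s. (1 / W s) ^ m) has_real_derivative (of_nat m * v ^ (m - 1) * (- poly w' t * v\<^sup>2))) (at t)"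
      using DERIV_power[OF du, of m] by (simp add: v_def mult_ac)
    have due: "((\<lambda>s. exp (- (e / W s))) has_real_derivative (exp (- (e * v)) * (e * poly w' t * v\<^sup>2))) (at t)"
      using W by (auto intro!: derivative_eq_intros dW simp: v_def power2_eq_square)
    \<comment> \<open>The factor m is kept because m - 1 truncates to 0 at m = 0.\<close>
    have mv: "of_nat m * v ^ (m - 1) * v\<^sup>2 = of_nat m * v ^ (m + 1)"
      by (cases m) (auto simp: power2_eq_square)
    have D: "((\<lambda>s. poly p s * (1 / W s) ^ m * exp (- (e / W s))) has_real_derivative
        (poly (pderiv p) t * v ^ m + (of_nat m * v ^ (m - 1) * (- poly w' t * v\<^sup>2)) * poly p t) * exp (- (e * v))
          + (exp (- (e * v)) * (e * poly w' t * v\<^sup>2)) * (poly p t * v ^ m)) (at t)"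
      using DERIV_mult[OF DERIV_mult[OF poly_DERIV[of p t] dum] due] by (simp add: v_def mult_ac)
    have "(of_nat m * v ^ (m - 1) * (- poly w' t * v\<^sup>2)) * poly p t
        = - (of_nat m * v ^ (m - 1) * v\<^sup>2) * poly w' t * poly p t" by simp
    also have "\<dots> = - of_nat m * v ^ (m + 1) * poly w' t * poly p t" by (simp only: mv) simp
    finally have eq1: "(of_nat m * v ^ (m - 1) * (- poly w' t * v\<^sup>2)) * poly p t
        = - of_nat m * v ^ (m + 1) * poly w' t * poly p t" .
    have val: "bump_fam a b e q (m + 2) t
        = (poly (pderiv p) t * v ^ m + (of_nat m * v ^ (m - 1) * (- poly w' t * v\<^sup>2)) * poly p t) * exp (- (e * v))
          + (exp (- (e * v)) * (e * poly w' t * v\<^sup>2)) * (poly p t * v ^ m)"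
    proof -
      have Wv: "W t * v = 1" using W by (simp add: v_def)
      have v2: "(W t)\<^sup>2 * v ^ (m + 2) = v ^ m" "W t * v ^ (m + 2) = v ^ (m + 1)"
        using Wv by (simp_all add: power_add power2_eq_square mult_ac) (metis mult.assoc mult.commute mult.right_neutral)+
      have "bump_fam a b e q (m + 2) t = poly q t * v ^ (m + 2) * exp (- (e * v))"
        using True by (simp add: bump_fam_def v_def W_def)
      also have "poly q t * v ^ (m + 2) = poly (pderiv p) t * ((W t)\<^sup>2 * v ^ (m + 2))
          - of_nat m * poly p t * poly w' t * (W t * v ^ (m + 2)) + e * poly p t * poly w' t * v ^ (m + 2)"
        by (simp add: q_def pw algebra_simps)
      finally show ?thesis
        unfolding eq1 v2 by (simp add: algebra_simps power_add power2_eq_square)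
    qed
    have "\<forall>\<^sub>F s in nhds t. s \<in> {a<..<b}"
      using True by (intro eventually_nhds_in_open) auto
    then have ev: "\<forall>\<^sub>F s in nhds t. bump_fam a b e p m s = poly p s * (1 / W s) ^ m * exp (- (e / W s))"
      by eventually_elim (auto simp: bump_fam_def W_def)
    show ?thesis unfolding val using D DERIV_cong_ev[OF refl ev refl] by blast
  next
    case False
    obtain K where "\<And>s. \<bar>bump_fam a b e p m s\<bar> \<le> K * (s - t)\<^sup>2"
      using bump_fam_quadratic_bound[OF e False] by blast
    then have "(bump_fam a b e p m has_real_derivative 0) (at t)"
      by (rule DERIV_zero_quadratic_bound)
    moreover have "bump_fam a b e q (m + 2) t = 0" using False by (auto simp: bump_fam_def)
    ultimately show ?thesis by simp
  qed
  then show ?thesis by blast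
qed

section \<open>Products of one-variable bumps as test functions\<close>

lemma prod_coord_has_derivative:
  fixes W W' :: "'n::finite \<Rightarrow> real \<Rightarrow> real"
  assumes "\<And>i t. (W i has_real_derivative W' i t) (at t)"
  shows "((\<lambda>x. \<Prod>i\<in>UNIV. W i (x $ i)) has_derivative
      (\<lambda>h. \<Sum>i\<in>UNIV. h $ i * (\<Prod>j\<in>UNIV. (W(i := W' i)) j (x $ j)))) (at (x :: real ^ 'n))"
proof -
  have "((\<lambda>x :: real ^ 'n. W i (x $ i)) has_derivative (\<lambda>h. W' i (x $ i) * h $ i)) (at x)" for i
    using has_derivative_compose[OF bounded_linear_imp_has_derivative[OF bounded_linear_vec_nth, of i]
        assms[unfolded has_field_derivative_def, of i "x $ i"]] by simp
  then have "((\<lambda>x. \<Prod>i\<in>UNIV. W i (x $ i)) has_derivative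
      (\<lambda>h. \<Sum>i\<in>UNIV. (W' i (x $ i) * h $ i) * (\<Prod>j\<in>UNIV - {i}. W j (x $ j)))) (at x)"
    by (intro has_derivative_prod)
  moreover have "(W' i (x $ i) * h $ i) * (\<Prod>j\<in>UNIV - {i}. W j (x $ j))
      = h $ i * (\<Prod>j\<in>UNIV. (W(i := W' i)) j (x $ j))" for i h
    by (subst prod.remove[of UNIV i]) auto
  ultimately show ?thesis by simp
qed

lemma prod_coord_partial_deriv:
  fixes W W' :: "'n::finite \<Rightarrow> real \<Rightarrow> real"
  assumes "\<And>i t. (W i has_real_derivative W' i t) (at t)"
  shows "partial_deriv i (\<lambda>x. \<Prod>i\<in>UNIV. W i (x $ i)) = (\<lambda>x. \<Prod>j\<in>UNIV. (W(i := W' i)) j (x $ j))"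
proof
  fix x :: "real ^ 'n"
  show "partial_deriv i (\<lambda>x. \<Prod>i\<in>UNIV. W i (x $ i)) x = (\<Prod>j\<in>UNIV. (W(i := W' i)) j (x $ j))"
    unfolding partial_deriv_def
    by (subst frechet_derivative_at[OF prod_coord_has_derivative[OF assms], symmetric])
      (simp add: axis_def if_distrib[of "\<lambda>u. u * _"] cong: if_cong)
qed

text \<open>Differentiating in direction i replaces the i-th factor by its derivative, which stays
  in the family \<open>S i\<close>. The class of such products is therefore closed under partial
  derivatives, and the induction on k runs over all of them at once.\<close>

lemma prod_coord_C_k:
  fixes W :: "'n::finite \<Rightarrow> real \<Rightarrow> real"
  assumes S: "\<And>i F. F \<in> S i \<Longrightarrow> \<exists>F'\<in>S i. \<forall>t. (F has_real_derivative F' t) (at t)"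
    and W: "\<And>i. W i \<in> S i"
  shows "C_k k (\<lambda>x :: real ^ 'n. \<Prod>i\<in>UNIV. W i (x $ i))"
  using W
proof (induction k arbitrary: W)
  case (0 W)
  have "continuous_on UNIV (W i)" for i
    using S[OF 0, of i] by (meson DERIV_isCont continuous_at_imp_continuous_on)
  then have "continuous_on UNIV (\<lambda>x :: real ^ 'n. W i (x $ i))" for i
    by (rule continuous_on_compose2[OF _ continuous_on_component]) (auto intro: continuous_on_id)
  then show ?case
    by (simp add: continuous_on_prod)
next
  case (Suc k W)
  have "\<forall>i. \<exists>F'. F' \<in> S i \<and> (\<forall>t. (W i has_real_derivative F' t) (at t))"
    using S[OF Suc.prems] by blast
  from choice[OF this] obtain W' where W': "\<And>i. W' i \<in> S i"
    "\<And>i t. (W i has_real_derivative W' i t) (at t)" by blast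
  have "C_k k (\<lambda>x :: real ^ 'n. \<Prod>j\<in>UNIV. (W(i := W' i)) j (x $ j))" for i
    using Suc.prems W'(1) by (intro Suc.IH) simp
  moreover have "(\<lambda>x :: real ^ 'n. \<Prod>i\<in>UNIV. W i (x $ i)) differentiable_on UNIV"
    using prod_coord_has_derivative[of W W', OF W'(2)] unfolding differentiable_on_def differentiable_def by blast
  ultimately show ?case
    by (simp add: prod_coord_partial_deriv[of W W', OF W'(2)])
qed

text \<open>The weak gradient is tested against these products: their translates have the same form,
  and they converge to indicators of open boxes as e tends to 0.\<close>

definition box_bump :: "real ^ 'n \<Rightarrow> real ^ 'n \<Rightarrow> real \<Rightarrow> real ^ 'n \<Rightarrow> real" where
  "box_bump c d e x = (\<Prod>i\<in>UNIV. bump_fam (c $ i) (d $ i) e 1 0 (x $ i))"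

lemma box_bump_zero: "x \<notin> box c d \<Longrightarrow> box_bump c d e x = 0"
  by (auto simp: box_bump_def mem_box_cart bump_fam_def)

lemma box_bump_nonneg: "0 \<le> box_bump c d e x"
  by (auto simp: box_bump_def bump_fam_def intro!: prod_nonneg)

lemma box_bump_le_1: "0 \<le> e \<Longrightarrow> box_bump c d e x \<le> 1"
  unfolding box_bump_def by (rule prod_le_1) (auto simp: bump_fam_def)

lemma box_bump_tendsto:
  "(\<lambda>k. box_bump c d (1 / Suc k) x) \<longlonglongrightarrow> indicator (box c d) x"
proof (cases "x \<in> box c d")
  case True
  have "(\<lambda>k. exp (- ((1 / Suc k) / r))) \<longlonglongrightarrow> exp (- (0 / r))" for r :: real
    unfolding divide_inverse[of _ r]
    by (intro tendsto_intros LIMSEQ_Suc[OF lim_1_over_n])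
  then have "(\<lambda>k. box_bump c d (1 / Suc k) x) \<longlonglongrightarrow> (\<Prod>i\<in>(UNIV::'a set). 1)"
    unfolding box_bump_def using True by (intro tendsto_prod) (auto simp: bump_fam_def mem_box_cart)
  then show ?thesis using True by simp
qed (simp add: box_bump_zero)

lemma box_bump_translate: "box_bump c d e (x - h) = box_bump (c + h) (d + h) e x"
  by (auto simp: box_bump_def bump_fam_def algebra_simps intro!: prod.cong)

lemma test_function_box_bump:
  assumes e: "0 < e"
  shows "test_function (box_bump c d e)"
proof -
  let ?S = "\<lambda>i. {bump_fam (c $ i) (d $ i) e p m | p m. True}"
  have "C_k k (box_bump c d e)" for k
    unfolding box_bump_def[abs_def]
  proof (rule prod_coord_C_k[where S = ?S])
    show "\<exists>F'\<in>?S i. \<forall>t. (F has_real_derivative F' t) (at t)" if "F \<in> ?S i" for i F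
      using that bump_fam_DERIV[OF e] by fast
  qed auto
  moreover have "{x. box_bump c d e x \<noteq> 0} \<subseteq> cbox c d"
    using box_bump_zero[of _ c d e] box_subset_cbox by blast
  then have "compact (closure {x. box_bump c d e x \<noteq> 0})"
    by (meson bounded_cbox bounded_subset compact_closure)
  ultimately show ?thesis by (simp add: test_function_def)
qed

section \<open>Sobolev functions along segments\<close>

lemma nn_integral_translate:
  fixes F :: "'a::euclidean_space \<Rightarrow> ennreal"
  assumes [measurable]: "F \<in> borel_measurable borel"
  shows "(\<integral>\<^sup>+x. F (x + v) \<partial>lborel) = (\<integral>\<^sup>+x. F x \<partial>lborel)"
proof -
  have "(\<integral>\<^sup>+x. F x \<partial>lborel) = (\<integral>\<^sup>+x. F x \<partial>distr lborel borel ((+) v))"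
    by (simp add: lborel_distr_plus)
  also have "\<dots> = (\<integral>\<^sup>+x. F (x + v) \<partial>lborel)"
    by (subst nn_integral_distr) (auto simp: add.commute)
  finally show ?thesis ..
qed

lemma integral_translate:
  fixes F :: "'a::euclidean_space \<Rightarrow> real"
  assumes [measurable]: "F \<in> borel_measurable borel"
  shows "(\<integral>x. F (x + v) \<partial>lborel) = (\<integral>x. F x \<partial>lborel)"
proof -
  have "(\<integral>x. F x \<partial>lborel) = (\<integral>x. F x \<partial>distr lborel borel ((+) v))"
    by (simp add: lborel_distr_plus)
  also have "\<dots> = (\<integral>x. F (x + v) \<partial>lborel)"
    by (subst integral_distr) (auto simp: add.commute)
  finally show ?thesis ..
qed

lemma has_derivative_partial_deriv:
  fixes \<phi> :: "real ^ 'n \<Rightarrow> real"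
  assumes "\<phi> differentiable at x"
  shows "(\<phi> has_derivative (\<lambda>h. \<Sum>i\<in>UNIV. h $ i * partial_deriv i \<phi> x)) (at x)"
proof -
  have D: "(\<phi> has_derivative frechet_derivative \<phi> (at x)) (at x)"
    using assms frechet_derivative_works by blast
  then interpret linear "frechet_derivative \<phi> (at x)" by (rule has_derivative_linear)
  have "frechet_derivative \<phi> (at x) h = (\<Sum>i\<in>UNIV. h $ i * partial_deriv i \<phi> x)" for h
  proof -
    have "h = (\<Sum>i\<in>UNIV. (h $ i) *\<^sub>R axis i 1)"
      using basis_expansion[of h] by (simp add: scalar_mult_eq_scaleR)
    then have "frechet_derivative \<phi> (at x) h = (\<Sum>i\<in>UNIV. frechet_derivative \<phi> (at x) ((h $ i) *\<^sub>R axis i 1))"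
      by (metis sum)
    then show ?thesis by (simp add: scale partial_deriv_def)
  qed
  then show ?thesis using D by (metis (no_types, lifting) ext)
qed

lemma partial_deriv_eq_0:
  fixes \<phi> :: "real ^ 'n \<Rightarrow> real"
  assumes "open S" "x \<in> S" "\<And>y. y \<in> S \<Longrightarrow> \<phi> y = 0"
  shows "partial_deriv i \<phi> x = 0"
proof -
  have "(\<phi> has_derivative (\<lambda>_. 0)) (at x)"
    by (rule has_derivative_transform_within_open[OF has_derivative_const[of 0] assms(1,2)])
      (simp add: assms(3))
  then show ?thesis
    unfolding partial_deriv_def by (metis frechet_derivative_at)
qed

lemma
  assumes e: "0 < e"
  shows box_bump_differentiable: "box_bump c d e differentiable at x"
    and continuous_on_box_bump: "continuous_on UNIV (box_bump c d e)"
    and continuous_on_partial_box_bump: "continuous_on UNIV (partial_deriv i (box_bump c d e))"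
proof -
  have C: "C_k k (box_bump c d e)" for k
    using test_function_box_bump[OF e, of c d] by (simp add: test_function_def)
  show "box_bump c d e differentiable at x"
    using C[of "Suc 0"] by (simp add: differentiable_on_def)
  show "continuous_on UNIV (box_bump c d e)" using C[of 0] by simp
  show "continuous_on UNIV (partial_deriv i (box_bump c d e))" using C[of "Suc 0"] by simp
qed

lemma partial_box_bump_zero: "x \<notin> cbox c d \<Longrightarrow> partial_deriv i (box_bump c d e) x = 0"
  by (rule partial_deriv_eq_0[of "- cbox c d"])
    (use box_subset_cbox[of c d] in \<open>auto intro!: box_bump_zero\<close>)

lemma partial_box_bump_bounded:
  assumes e: "0 < e"
  obtains K where "\<And>x. \<bar>partial_deriv i (box_bump c d e) x\<bar> \<le> K * indicator (cbox c d) x"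
proof -
  have "bounded (partial_deriv i (box_bump c d e) ` cbox c d)"
    using continuous_on_subset[OF continuous_on_partial_box_bump[OF e]]
    by (intro compact_imp_bounded compact_continuous_image) auto
  then obtain K where "\<And>x. x \<in> cbox c d \<Longrightarrow> \<bar>partial_deriv i (box_bump c d e) x\<bar> \<le> K"
    unfolding bounded_iff by auto
  then have "\<bar>partial_deriv i (box_bump c d e) x\<bar> \<le> K * indicator (cbox c d) x" for x
    by (cases "x \<in> cbox c d") (auto simp: partial_box_bump_zero)
  then show ?thesis by (rule that)
qed

text \<open>The fundamental theorem of calculus along s |-> x - s h. The minus sign is the one that
  arises when a shift by h is moved from f to the test function.\<close>

lemma box_bump_segment:
  assumes e: "0 < e"
  shows "(\<integral>s. (\<Sum>i\<in>UNIV. h $ i * partial_deriv i (box_bump c d e) (x - s *\<^sub>R h)) * indicator {0..1} s \<partial>lborel)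
    = box_bump c d e x - box_bump c d e (x - h)"
proof -
  let ?\<phi> = "box_bump c d e"
  have "((\<lambda>s. - ?\<phi> (x - s *\<^sub>R h)) has_real_derivative
      (\<Sum>i\<in>UNIV. h $ i * partial_deriv i ?\<phi> (x - s *\<^sub>R h))) (at s)" for s
  proof -
    have "((\<lambda>s. x - s *\<^sub>R h) has_derivative (\<lambda>t. - (t *\<^sub>R h))) (at s)"
      by (auto intro!: derivative_eq_intros)
    from has_derivative_compose[OF this has_derivative_partial_deriv[OF box_bump_differentiable[OF e, of c d]]]
    have "((\<lambda>s. ?\<phi> (x - s *\<^sub>R h)) has_derivative
        (\<lambda>t. - ((\<Sum>i\<in>UNIV. h $ i * partial_deriv i ?\<phi> (x - s *\<^sub>R h)) * t))) (at s)"
      by (simp add: sum_negf sum_distrib_left sum_distrib_right mult_ac)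
    from has_derivative_minus[OF this] show ?thesis
      unfolding has_field_derivative_def by simp
  qed
  moreover have "isCont (\<lambda>s. \<Sum>i\<in>UNIV. h $ i * partial_deriv i ?\<phi> (x - s *\<^sub>R h)) s" for s
  proof -
    have "continuous_on UNIV (\<lambda>s. \<Sum>i\<in>UNIV. h $ i * partial_deriv i ?\<phi> (x - s *\<^sub>R h))"
      by (intro continuous_intros continuous_on_compose2[OF continuous_on_partial_box_bump[OF e]]) auto
    then show ?thesis by (simp add: continuous_on_eq_continuous_at)
  qed
  ultimately show ?thesis
    by (subst integral_FTC_Icc_real[of 0 1 "\<lambda>s. - ?\<phi> (x - s *\<^sub>R h)"]) auto
qed

text \<open>Borel measurability survives composition with (x, s) |-> x + s h, as needed for Fubini's
  theorem on the product of \<open>lborel\<close> with itself.\<close>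

definition locally_integrable_borel :: "(real ^ 'n \<Rightarrow> real) \<Rightarrow> bool" where
  "locally_integrable_borel F \<longleftrightarrow> F \<in> borel_measurable borel \<and>
     (\<forall>a b. integrable lborel (\<lambda>x. indicator (cbox a b) x * F x))"

lemma locally_integrable_borelD [measurable_dest]:
  "locally_integrable_borel F \<Longrightarrow> F \<in> borel_measurable borel"
  by (simp add: locally_integrable_borel_def)

lemma locally_integrable_borel_finite:
  assumes "locally_integrable_borel F"
  shows "(\<integral>\<^sup>+x. indicator (cbox a b) x * ennreal \<bar>F x\<bar> \<partial>lborel) < \<infinity>"
proof -
  have "integrable lborel (\<lambda>x. indicator (cbox a b) x * F x)"
    using assms by (simp add: locally_integrable_borel_def)
  then have "(\<integral>\<^sup>+x. ennreal (norm (indicator (cbox a b) x * F x)) \<partial>lborel) < \<infinity>"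
    by (simp add: integrable_iff_bounded)
  then show ?thesis
    by (simp add: abs_mult ennreal_mult' ennreal_indicator)
qed

lemma bounded_segment_box:
  fixes c d h :: "real ^ 'n"
  obtains C D where "\<And>x s. s \<in> {0..1} \<Longrightarrow> x \<in> cbox c d \<Longrightarrow> x + s *\<^sub>R h \<in> cbox C D"
proof -
  have "bounded ((\<lambda>p. fst p + snd p *\<^sub>R h) ` (cbox c d \<times> {0..1}))"
    by (intro compact_imp_bounded compact_continuous_image compact_Times continuous_intros) auto
  then obtain C D where *: "(\<lambda>p. fst p + snd p *\<^sub>R h) ` (cbox c d \<times> {0..1}) \<subseteq> cbox C D"
    using bounded_subset_cbox_symmetric by meson
  have "x + s *\<^sub>R h \<in> cbox C D" if "s \<in> {0..1}" "x \<in> cbox c d" for x s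
    using that by (intro subsetD[OF *] image_eqI[of _ _ "(x, s)"]) auto
  then show ?thesis by (rule that)
qed

text \<open>For s in [0, 1] the shifted support of \<psi> stays in one box \<open>cbox C D\<close>,
  on which F is integrable. This is what allows x and s to be exchanged by Fubini's theorem.\<close>

lemma integrable_segment1:
  fixes F \<psi> :: "real ^ 'n \<Rightarrow> real"
  assumes F: "locally_integrable_borel F" and [measurable]: "\<psi> \<in> borel_measurable borel"
    and \<psi>: "\<And>x. \<bar>\<psi> x\<bar> \<le> K * indicator (cbox c d) x"
  shows "integrable (lborel \<Otimes>\<^sub>M lborel) (\<lambda>(x, s). F x * \<psi> (x - s *\<^sub>R h) * indicator {0..1::real} s)"
proof -
  note [measurable] = F[THEN locally_integrable_borelD]
  obtain C D where CD: "\<And>x s. s \<in> {0..1} \<Longrightarrow> x \<in> cbox c d \<Longrightarrow> x + s *\<^sub>R h \<in> cbox C D"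
    using bounded_segment_box[of c d h] by blast
  have K: "0 \<le> K * indicator (cbox c d) x" for x using order_trans[OF abs_ge_zero \<psi>] .
  have "(\<integral>\<^sup>+p. ennreal (norm (case p of (x, s) \<Rightarrow> F x * \<psi> (x - s *\<^sub>R h) * indicator {0..1::real} s)) \<partial>(lborel \<Otimes>\<^sub>M lborel))
    = (\<integral>\<^sup>+s. \<integral>\<^sup>+x. ennreal (norm (F x * \<psi> (x - s *\<^sub>R h) * indicator {0..1::real} s)) \<partial>lborel \<partial>lborel)"
    by (subst lborel_pair.nn_integral_snd[symmetric]) auto
  also have "\<dots> \<le> (\<integral>\<^sup>+s. \<integral>\<^sup>+x. ennreal \<bar>K\<bar> * (indicator (cbox C D) x * ennreal \<bar>F x\<bar>) * indicator {0..1::real} s \<partial>lborel \<partial>lborel)"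
  proof (intro nn_integral_mono)
    fix s :: real and x :: "real ^ 'n"
    have "\<bar>F x * \<psi> (x - s *\<^sub>R h) * indicator {0..1::real} s\<bar> \<le> \<bar>K\<bar> * (indicator (cbox C D) x * \<bar>F x\<bar>) * indicator {0..1::real} s"
    proof (cases "s \<in> {0..1} \<and> x - s *\<^sub>R h \<in> cbox c d")
      case True
      then have "x \<in> cbox C D" using CD[of s "x - s *\<^sub>R h"] by simp
      then show ?thesis
        using True mult_left_mono[OF \<psi>[of "x - s *\<^sub>R h"], of "\<bar>F x\<bar>"] mult_left_mono[OF abs_ge_self[of K], of "\<bar>F x\<bar>"]
        by (simp add: abs_mult mult.commute)
    next
      case False
      then show ?thesis using \<psi>[of "x - s *\<^sub>R h"] by (auto simp: indicator_def)
    qed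
    then have "ennreal (norm (F x * \<psi> (x - s *\<^sub>R h) * indicator {0..1::real} s)) \<le> ennreal (\<bar>K\<bar> * (indicator (cbox C D) x * \<bar>F x\<bar>) * indicator {0..1::real} s)"
      by (simp add: ennreal_leI)
    also have "\<dots> = ennreal \<bar>K\<bar> * (indicator (cbox C D) x * ennreal \<bar>F x\<bar>) * indicator {0..1::real} s"
      by (simp add: ennreal_mult' ennreal_indicator)
    finally show "ennreal (norm (F x * \<psi> (x - s *\<^sub>R h) * indicator {0..1::real} s)) \<le> \<dots>" .
  qed
  also have "\<dots> = ennreal \<bar>K\<bar> * (\<integral>\<^sup>+x. indicator (cbox C D) x * ennreal \<bar>F x\<bar> \<partial>lborel)"
    by (simp add: nn_integral_cmult nn_integral_multc)
  also have "\<dots> < \<infinity>"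
    using locally_integrable_borel_finite[OF F, of C D] by (simp add: ennreal_mult_less_top)
  finally show ?thesis by (intro integrableI_bounded) auto
qed

text \<open>Translation by s h, for each fixed s, turns the integrand into that of
  \<open>integrable_segment1\<close>.\<close>

lemma integrable_segment2:
  fixes F \<psi> :: "real ^ 'n \<Rightarrow> real"
  assumes F: "locally_integrable_borel F" and [measurable]: "\<psi> \<in> borel_measurable borel"
    and \<psi>: "\<And>x. \<bar>\<psi> x\<bar> \<le> K * indicator (cbox c d) x"
  shows "integrable (lborel \<Otimes>\<^sub>M lborel) (\<lambda>(x, s). F (x + s *\<^sub>R h) * \<psi> x * indicator {0..1::real} s)"
proof -
  note [measurable] = F[THEN locally_integrable_borelD]
  have "(\<integral>\<^sup>+p. ennreal (norm (case p of (x, s) \<Rightarrow> F (x + s *\<^sub>R h) * \<psi> x * indicator {0..1::real} s)) \<partial>(lborel \<Otimes>\<^sub>M lborel))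
    = (\<integral>\<^sup>+s. \<integral>\<^sup>+x. ennreal (norm (F (x + s *\<^sub>R h) * \<psi> ((x + s *\<^sub>R h) - s *\<^sub>R h) * indicator {0..1::real} s)) \<partial>lborel \<partial>lborel)"
    by (subst lborel_pair.nn_integral_snd[symmetric]) auto
  also have "\<dots> = (\<integral>\<^sup>+s. \<integral>\<^sup>+x. ennreal (norm (F x * \<psi> (x - s *\<^sub>R h) * indicator {0..1::real} s)) \<partial>lborel \<partial>lborel)"
    by (intro nn_integral_cong
      nn_integral_translate[of "\<lambda>x. ennreal (norm (F x * \<psi> (x - _ *\<^sub>R h) * indicator {0..1::real} _))"]) measurable
  also have "\<dots> = (\<integral>\<^sup>+p. ennreal (norm (case p of (x, s) \<Rightarrow> F x * \<psi> (x - s *\<^sub>R h) * indicator {0..1::real} s)) \<partial>(lborel \<Otimes>\<^sub>M lborel))"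
    by (subst lborel_pair.nn_integral_snd[symmetric]) auto
  also have "\<dots> < \<infinity>"
    using integrable_segment1[OF F _ \<psi>, of h] by (simp add: integrable_iff_bounded)
  finally show ?thesis by (intro integrableI_bounded) auto
qed

text \<open>Lebesgue differentiation over the cubes with corner x and side h: all quotients are 0,
  so u x = 0 off the exceptional null set.\<close>

lemma AE_zero_if_box_integrals_zero:
  fixes u :: "real ^ 'n \<Rightarrow> real"
  assumes u: "locally_integrable_borel u"
    and zero: "\<And>c d. (\<integral>x. u x * indicator (box c d) x \<partial>lborel) = 0"
  shows "AE x in lborel. u x = 0"
proof -
  have int: "u integrable_on cbox a b" "integral (cbox a b) u = 0" for a b
  proof -
    have *: "set_integrable lborel (cbox a b) u"
      using u by (simp add: locally_integrable_borel_def set_integrable_def)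
    have **: "set_integrable lborel (box a b) u"
      by (rule set_integrable_subset[OF *]) (auto simp: box_subset_cbox)
    show "u integrable_on cbox a b" using set_borel_integral_eq_integral[OF *] by simp
    have "integral (cbox a b) u = integral (box a b) u" by (simp add: integral_open_interval)
    also have "\<dots> = (\<integral>x. u x * indicator (box a b) x \<partial>lborel)"
      using set_borel_integral_eq_integral(2)[OF **] by (simp add: set_lebesgue_integral_def mult.commute)
    finally show "integral (cbox a b) u = 0" by (simp add: zero)
  qed
  obtain N where N: "negligible N"
    and lim: "\<And>x e. \<lbrakk>x \<notin> N; 0 < e\<rbrakk> \<Longrightarrow> \<exists>d>0. \<forall>h. 0 < h \<and> h < d \<longrightarrow>
        norm (integral (cbox x (x + h *\<^sub>R One)) u /\<^sub>R h ^ DIM(real ^ 'n) - u x) < e"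
    by (rule integrable_ccontinuous_explicit[OF int(1)]) blast
  have "u x = 0" if xN: "x \<notin> N" for x
  proof (rule ccontr)
    assume "u x \<noteq> 0"
    then obtain d :: real where "d > 0" "\<forall>h. 0 < h \<and> h < d \<longrightarrow> norm (0 - u x) < \<bar>u x\<bar>"
      using lim[OF xN, of "\<bar>u x\<bar>"] unfolding int by auto
    then show False using dense[of 0 d] by auto
  qed
  then have "{x. u x \<noteq> 0} \<subseteq> N" by blast
  then have "{x. u x \<noteq> 0} \<in> null_sets lebesgue"
    using N negligible_subset negligible_iff_null_sets by blast
  then have "AE x in lebesgue. u x = 0"
    by (rule AE_I') auto
  then show ?thesis by (simp add: AE_completion_iff)
qed

lemma box_bump_bound: "0 \<le> e \<Longrightarrow> \<bar>box_bump c d e x\<bar> \<le> 1 * indicator (cbox c d) x"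
  using box_bump_zero[of x c d e] box_bump_nonneg[of c d e x] box_bump_le_1[of e c d x] box_subset_cbox[of c d]
  by (auto simp: indicator_def)

text \<open>Dominated convergence with e = 1 / (k + 1) passes from bumps to indicators of boxes; the
  dominating function is |u| on the closed box.\<close>

lemma AE_zero_if_box_bump_integrals_zero:
  fixes u :: "real ^ 'n \<Rightarrow> real"
  assumes u: "locally_integrable_borel u"
    and zero: "\<And>c d e. 0 < e \<Longrightarrow> (\<integral>x. u x * box_bump c d e x \<partial>lborel) = 0"
  shows "AE x in lborel. u x = 0"
proof (rule AE_zero_if_box_integrals_zero[OF u])
  fix c d :: "real ^ 'n"
  note [measurable] = u[THEN locally_integrable_borelD]
  have [measurable]: "box_bump c d (1 / Suc k) \<in> borel_measurable borel" for k
    by (intro borel_measurable_continuous_onI continuous_on_box_bump) simp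
  have "(\<lambda>k. \<integral>x. u x * box_bump c d (1 / Suc k) x \<partial>lborel) \<longlonglongrightarrow> (\<integral>x. u x * indicator (box c d) x \<partial>lborel)"
  proof (rule integral_dominated_convergence)
    show "integrable lborel (\<lambda>x. \<bar>indicator (cbox c d) x * u x\<bar>)"
      using u by (simp add: locally_integrable_borel_def)
    show "AE x in lborel. (\<lambda>k. u x * box_bump c d (1 / Suc k) x) \<longlonglongrightarrow> u x * indicator (box c d) x"
      by (intro AE_I2 tendsto_intros box_bump_tendsto)
    show "AE x in lborel. norm (u x * box_bump c d (1 / Suc k) x) \<le> \<bar>indicator (cbox c d) x * u x\<bar>" for k
      using mult_left_mono[OF box_bump_bound[of "1 / Suc k" c d], of "\<bar>u _\<bar>"] by (simp add: abs_mult mult.commute)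
  qed measurable
  moreover have "(\<integral>x. u x * box_bump c d (1 / Suc k) x \<partial>lborel) = 0" for k
    by (rule zero) simp
  ultimately show "(\<integral>x. u x * indicator (box c d) x \<partial>lborel) = 0"
    by (simp only: LIMSEQ_const_iff)
qed

section \<open>Increments along almost every segment\<close>

lemma partial_deriv_translate_box_bump:
  assumes e: "0 < e"
  shows "partial_deriv i (box_bump (c + v) (d + v) e) x = partial_deriv i (box_bump c d e) (x - v)"
proof -
  have "((\<lambda>y. y - v) has_derivative (\<lambda>h. h)) (at x)"
    by (auto intro!: derivative_eq_intros)
  from has_derivative_compose[OF this has_derivative_partial_deriv[OF box_bump_differentiable[OF e, of c d]]]
  have "(box_bump (c + v) (d + v) e has_derivative
      (\<lambda>h. \<Sum>i\<in>UNIV. h $ i * partial_deriv i (box_bump c d e) (x - v))) (at x)"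
    by (simp add: box_bump_translate)
  from frechet_derivative_at[OF this, symmetric] show ?thesis
    by (simp add: partial_deriv_def axis_def if_distrib[of "\<lambda>u. u * _"] cong: if_cong)
qed

lemma integrable_translate:
  fixes F :: "'a::euclidean_space \<Rightarrow> real"
  assumes "integrable lborel F"
  shows "integrable lborel (\<lambda>x. F (x + v))"
proof -
  have "integrable (distr lborel borel ((+) v)) F"
    using assms by (simp add: lborel_distr_plus)
  then have "integrable lborel (\<lambda>x. F (v + x))"
    using assms by (subst (asm) integrable_distr_eq) auto
  then show ?thesis by (simp add: add.commute)
qed

lemma locally_integrable_borel_mult:
  assumes F: "locally_integrable_borel F" and [measurable]: "\<psi> \<in> borel_measurable borel"
    and \<psi>: "\<And>x. \<bar>\<psi> x\<bar> \<le> K * indicator (cbox c d) x"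
  shows "integrable lborel (\<lambda>x. F x * \<psi> x)"
proof (rule Bochner_Integration.integrable_bound)
  have [measurable]: "F \<in> borel_measurable borel" by (rule locally_integrable_borelD[OF F])
  show "(\<lambda>x. F x * \<psi> x) \<in> borel_measurable lborel" by simp
  show "integrable lborel (\<lambda>x. K * (indicator (cbox c d) x * F x))"
    using F by (simp add: locally_integrable_borel_def)
  show "AE x in lborel. norm (F x * \<psi> x) \<le> norm (K * (indicator (cbox c d) x * F x))"
    using mult_left_mono[OF order_trans[OF \<psi> abs_ge_self], of "\<bar>F _\<bar>"]
    by (auto simp: abs_mult mult_ac intro!: AE_I2)
qed

lemma locally_integrable_borel_translate:
  fixes F :: "real ^ 'n \<Rightarrow> real"
  assumes F: "locally_integrable_borel F"
  shows "locally_integrable_borel (\<lambda>x. F (x + v))"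
proof -
  note [measurable] = F[THEN locally_integrable_borelD]
  have "integrable lborel (\<lambda>x. indicator (cbox a b) x * F (x + v))" for a b
  proof -
    have "integrable lborel (\<lambda>x. indicator (cbox (a + v) (b + v)) (x + v) * F (x + v))"
      using F by (intro integrable_translate) (simp add: locally_integrable_borel_def)
    then show ?thesis by (simp add: indicator_def mem_box_cart)
  qed
  then show ?thesis by (simp add: locally_integrable_borel_def)
qed

lemma locally_integrable_borel_diff:
  "locally_integrable_borel F \<Longrightarrow> locally_integrable_borel G \<Longrightarrow> locally_integrable_borel (\<lambda>x. F x - G x)"
  by (auto simp: locally_integrable_borel_def right_diff_distrib)

lemma borel_measurable_box_bump [measurable]: "0 < e \<Longrightarrow> box_bump c d e \<in> borel_measurable borel"
  and borel_measurable_partial_box_bump [measurable]: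
    "0 < e \<Longrightarrow> partial_deriv i (box_bump c d e) \<in> borel_measurable borel"
  by (auto intro!: borel_measurable_continuous_onI continuous_on_box_bump continuous_on_partial_box_bump)

text \<open>Borel representatives of a function and of its weak gradient, with integration by parts
  recorded for the box bumps.\<close>

locale weak_deriv =
  fixes f :: "real ^ 'n \<Rightarrow> real" and g :: "real ^ 'n \<Rightarrow> real ^ 'n"
  assumes f: "locally_integrable_borel f"
    and g: "\<And>h. locally_integrable_borel (\<lambda>x. g x \<bullet> h)"
    and g_measurable [measurable]: "g \<in> borel_measurable borel"
    and weak: "\<And>c d e i. 0 < e \<Longrightarrow>
      (\<integral>x. f x * partial_deriv i (box_bump c d e) x \<partial>lborel) = - (\<integral>x. g x $ i * box_bump c d e x \<partial>lborel)"
begin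

lemma f_measurable [measurable]: "f \<in> borel_measurable borel"
  using f by (rule locally_integrable_borelD)

text \<open>The bump shifted by v is the bump of the shifted box, so the weak equation applies to
  it; combining the n coordinate equations linearly gives the direction h.\<close>

lemma weak_translate:
  assumes e: "0 < e"
  shows "(\<integral>x. f x * (\<Sum>i\<in>UNIV. h $ i * partial_deriv i (box_bump c d e) (x - v)) \<partial>lborel)
    = - (\<integral>x. (g x \<bullet> h) * box_bump c d e (x - v) \<partial>lborel)"
proof -
  let ?\<phi> = "box_bump (c + v) (d + v) e"
  have i1: "integrable lborel (\<lambda>x. f x * partial_deriv i ?\<phi> x)" for i
  proof -
    obtain K where "\<And>x. \<bar>partial_deriv i ?\<phi> x\<bar> \<le> K * indicator (cbox (c + v) (d + v)) x"
      using partial_box_bump_bounded[OF e] by blast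
    then show ?thesis using e by (intro locally_integrable_borel_mult[OF f]) auto
  qed
  have i2: "integrable lborel (\<lambda>x. g x $ i * ?\<phi> x)" for i
    using e locally_integrable_borel_mult[OF g[of "axis i 1"] _ box_bump_bound[of e "c + v" "d + v"]]
    by (simp add: inner_axis)
  have "(\<integral>x. f x * (\<Sum>i\<in>UNIV. h $ i * partial_deriv i (box_bump c d e) (x - v)) \<partial>lborel)
      = (\<integral>x. (\<Sum>i\<in>UNIV. h $ i * (f x * partial_deriv i ?\<phi> x)) \<partial>lborel)"
    by (simp add: partial_deriv_translate_box_bump[OF e] sum_distrib_left mult_ac)
  also have "\<dots> = (\<Sum>i\<in>UNIV. h $ i * (\<integral>x. f x * partial_deriv i ?\<phi> x \<partial>lborel))"
    by (subst Bochner_Integration.integral_sum) (auto intro!: i1)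
  also have "\<dots> = - (\<Sum>i\<in>UNIV. h $ i * (\<integral>x. g x $ i * ?\<phi> x \<partial>lborel))"
    by (simp add: weak[OF e] sum_negf)
  also have "(\<Sum>i\<in>UNIV. h $ i * (\<integral>x. g x $ i * ?\<phi> x \<partial>lborel))
      = (\<integral>x. (\<Sum>i\<in>UNIV. h $ i * (g x $ i * ?\<phi> x)) \<partial>lborel)"
    by (subst Bochner_Integration.integral_sum) (auto intro!: i2)
  also have "\<dots> = (\<integral>x. (g x \<bullet> h) * box_bump c d e (x - v) \<partial>lborel)"
    by (simp add: box_bump_translate inner_vec_def sum_distrib_left sum_distrib_right mult_ac)
  finally show ?thesis .
qed

text \<open>The shift is moved from f to the bump, the increment of the bump is written as an
  integral along the segment, integration by parts is applied for each fixed s, and the shift is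
  moved back. Fubini's theorem exchanges x and s before and after.\<close>

lemma segment_identity_weak:
  assumes e: "0 < e"
  shows "(\<integral>x. (f (x + h) - f x) * box_bump c d e x \<partial>lborel)
    = (\<integral>x. (\<integral>s. (g (x + s *\<^sub>R h) \<bullet> h) * indicator {0..1} s \<partial>lborel) * box_bump c d e x \<partial>lborel)"
proof -
  let ?\<phi> = "box_bump c d e"
  let ?D = "\<lambda>y. \<Sum>i\<in>UNIV. h $ i * partial_deriv i ?\<phi> y"
  note m [measurable] = borel_measurable_box_bump[OF e] borel_measurable_partial_box_bump[OF e]
  note bound = box_bump_bound[OF less_imp_le[OF e], of c d]
  have i0: "integrable lborel (\<lambda>x. f x * ?\<phi> x)"
    by (rule locally_integrable_borel_mult[OF f _ bound]) measurable
  have i1: "integrable lborel (\<lambda>x. f (x + h) * ?\<phi> x)"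
    by (rule locally_integrable_borel_mult[OF locally_integrable_borel_translate[OF f] _ bound]) measurable
  have i1': "integrable lborel (\<lambda>x. f x * ?\<phi> (x - h))"
    using integrable_translate[OF i1, of "- h"] by simp
  have "(\<integral>x. (f (x + h) - f x) * ?\<phi> x \<partial>lborel)
      = (\<integral>x. f (x + h) * ?\<phi> ((x + h) - h) \<partial>lborel) - (\<integral>x. f x * ?\<phi> x \<partial>lborel)"
    using i0 i1 by (simp add: left_diff_distrib)
  also have "(\<integral>x. f (x + h) * ?\<phi> ((x + h) - h) \<partial>lborel) = (\<integral>x. f x * ?\<phi> (x - h) \<partial>lborel)"
    by (rule integral_translate[of "\<lambda>x. f x * ?\<phi> (x - h)"]) measurable
  also have "\<dots> - (\<integral>x. f x * ?\<phi> x \<partial>lborel) = - (\<integral>x. f x * (?\<phi> x - ?\<phi> (x - h)) \<partial>lborel)"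
    using i0 i1' by (simp add: right_diff_distrib)
  also have "(\<integral>x. f x * (?\<phi> x - ?\<phi> (x - h)) \<partial>lborel)
      = (\<integral>x. (\<integral>s. f x * ?D (x - s *\<^sub>R h) * indicator {0..1} s \<partial>lborel) \<partial>lborel)"
    by (subst box_bump_segment[OF e, symmetric]) (simp add: mult.assoc)
  also have "\<dots> = (\<integral>s. (\<integral>x. f x * ?D (x - s *\<^sub>R h) * indicator {0..1} s \<partial>lborel) \<partial>lborel)"
  proof (rule lborel_pair.Fubini_integral[symmetric])
    have "integrable (lborel \<Otimes>\<^sub>M lborel)
        (\<lambda>(x, s). f x * partial_deriv i ?\<phi> (x - s *\<^sub>R h) * indicator {0..1::real} s)" for i
    proof -
      obtain K where "\<And>x. \<bar>partial_deriv i ?\<phi> x\<bar> \<le> K * indicator (cbox c d) x"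
        using partial_box_bump_bounded[OF e] by blast
      then show ?thesis by (intro integrable_segment1[OF f]) auto
    qed
    then have "integrable (lborel \<Otimes>\<^sub>M lborel)
        (\<lambda>p. \<Sum>i\<in>UNIV. h $ i * (case p of (x, s) \<Rightarrow> f x * partial_deriv i ?\<phi> (x - s *\<^sub>R h) * indicator {0..1::real} s))"
      by (intro Bochner_Integration.integrable_sum integrable_mult_right)
    then show "integrable (lborel \<Otimes>\<^sub>M lborel) (\<lambda>(x, s). f x * ?D (x - s *\<^sub>R h) * indicator {0..1} s)"
      by (simp add: case_prod_beta' sum_distrib_left sum_distrib_right mult_ac)
  qed
  also have "\<dots> = (\<integral>s. - (\<integral>x. (g x \<bullet> h) * ?\<phi> (x - s *\<^sub>R h) \<partial>lborel) * indicator {0..1} s \<partial>lborel)"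
    by (simp only: weak_translate[OF e] integral_mult_left_zero)
  also have "(\<lambda>s. \<integral>x. (g x \<bullet> h) * ?\<phi> (x - s *\<^sub>R h) \<partial>lborel)
      = (\<lambda>s. \<integral>x. (g (x + s *\<^sub>R h) \<bullet> h) * ?\<phi> x \<partial>lborel)"
  proof
    fix s
    show "(\<integral>x. (g x \<bullet> h) * ?\<phi> (x - s *\<^sub>R h) \<partial>lborel) = (\<integral>x. (g (x + s *\<^sub>R h) \<bullet> h) * ?\<phi> x \<partial>lborel)"
      using integral_translate[of "\<lambda>x. (g x \<bullet> h) * ?\<phi> (x - s *\<^sub>R h)" "s *\<^sub>R h"] by simp
  qed
  also have "- (\<integral>s. - (\<integral>x. (g (x + s *\<^sub>R h) \<bullet> h) * ?\<phi> x \<partial>lborel) * indicator {0..1} s \<partial>lborel)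
      = (\<integral>s. (\<integral>x. (g (x + s *\<^sub>R h) \<bullet> h) * ?\<phi> x * indicator {0..1} s \<partial>lborel) \<partial>lborel)"
    by simp
  also have "\<dots> = (\<integral>x. (\<integral>s. (g (x + s *\<^sub>R h) \<bullet> h) * ?\<phi> x * indicator {0..1} s \<partial>lborel) \<partial>lborel)"
    by (rule lborel_pair.Fubini_integral) (rule integrable_segment2[OF g _ bound], measurable)
  also have "\<dots> = (\<integral>x. (\<integral>s. (g (x + s *\<^sub>R h) \<bullet> h) * indicator {0..1} s \<partial>lborel) * ?\<phi> x \<partial>lborel)"
  proof (intro Bochner_Integration.integral_cong refl)
    fix x
    show "(\<integral>s. (g (x + s *\<^sub>R h) \<bullet> h) * ?\<phi> x * indicator {0..1} s \<partial>lborel)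
        = (\<integral>s. (g (x + s *\<^sub>R h) \<bullet> h) * indicator {0..1} s \<partial>lborel) * ?\<phi> x"
      unfolding integral_mult_left_zero[symmetric] by (simp add: mult_ac)
  qed
  finally show ?thesis .
qed

lemma locally_integrable_segment:
  "locally_integrable_borel (\<lambda>x. \<integral>s. (g (x + s *\<^sub>R h) \<bullet> h) * indicator {0..1} s \<partial>lborel)"
proof -
  have "integrable lborel (\<lambda>x. indicator (cbox a b) x * (\<integral>s. (g (x + s *\<^sub>R h) \<bullet> h) * indicator {0..1} s \<partial>lborel))" for a b
  proof -
    have "integrable lborel (\<lambda>x. \<integral>s. (g (x + s *\<^sub>R h) \<bullet> h) * indicator (cbox a b) x * indicator {0..1} s \<partial>lborel)"
      by (rule lborel_pair.integrable_fst, rule integrable_segment2[OF g, where K = 1 and c = a and d = b]) auto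
    moreover have "(\<lambda>x. \<integral>s. (g (x + s *\<^sub>R h) \<bullet> h) * indicator (cbox a b) x * indicator {0..1} s \<partial>lborel)
        = (\<lambda>x. indicator (cbox a b) x * (\<integral>s. (g (x + s *\<^sub>R h) \<bullet> h) * indicator {0..1} s \<partial>lborel))"
      unfolding integral_mult_right_zero[symmetric] by (simp add: mult_ac)
    ultimately show ?thesis by simp
  qed
  then show ?thesis by (simp add: locally_integrable_borel_def)
qed

lemma segment_identity:
  "AE x in lborel. f (x + h) - f x = (\<integral>s. (g (x + s *\<^sub>R h) \<bullet> h) * indicator {0..1} s \<partial>lborel)"
proof -
  let ?G = "\<lambda>x. \<integral>s. (g (x + s *\<^sub>R h) \<bullet> h) * indicator {0..1} s \<partial>lborel"
  have d: "locally_integrable_borel (\<lambda>x. f (x + h) - f x)"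
    by (intro locally_integrable_borel_diff locally_integrable_borel_translate f)
  have "AE x in lborel. (f (x + h) - f x) - ?G x = 0"
  proof (rule AE_zero_if_box_bump_integrals_zero)
    show "locally_integrable_borel (\<lambda>x. (f (x + h) - f x) - ?G x)"
      by (intro locally_integrable_borel_diff d locally_integrable_segment)
    fix c d' and e :: real assume e: "0 < e"
    note bound = box_bump_bound[OF less_imp_le[OF e], of c d']
    have "integrable lborel (\<lambda>x. (f (x + h) - f x) * box_bump c d' e x)"
      "integrable lborel (\<lambda>x. ?G x * box_bump c d' e x)"
      using e by (auto intro!: locally_integrable_borel_mult[OF _ _ bound] d locally_integrable_segment)
    then have "(\<integral>x. ((f (x + h) - f x) - ?G x) * box_bump c d' e x \<partial>lborel)
        = (\<integral>x. (f (x + h) - f x) * box_bump c d' e x \<partial>lborel) - (\<integral>x. ?G x * box_bump c d' e x \<partial>lborel)"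
      by (subst left_diff_distrib) (rule Bochner_Integration.integral_diff)
    then show "(\<integral>x. ((f (x + h) - f x) - ?G x) * box_bump c d' e x \<partial>lborel) = 0"
      by (simp add: segment_identity_weak[OF e])
  qed
  then show ?thesis by simp
qed

text \<open>Countably many boxes exhaust the space, and Fubini's theorem gives integrability along
  almost every segment starting in each of them.\<close>

lemma AE_integrable_segment:
  "AE x in lborel. integrable lborel (\<lambda>s. (g (x + s *\<^sub>R h) \<bullet> h) * indicator {0..1} s)"
proof -
  let ?B = "\<lambda>k::nat. cbox (- (real k *\<^sub>R One)) (real k *\<^sub>R One) :: (real ^ 'n) set"
  have "AE x in lborel. \<forall>k. integrable lborel (\<lambda>s. (g (x + s *\<^sub>R h) \<bullet> h) * indicator (?B k) x * indicator {0..1} s)"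
    unfolding AE_all_countable
    by (intro allI lborel_pair.AE_integrable_fst integrable_segment2[OF g, where K = 1]) auto
  then show ?thesis
  proof (rule AE_mp, intro AE_I2 impI)
    fix x assume *: "\<forall>k. integrable lborel (\<lambda>s. (g (x + s *\<^sub>R h) \<bullet> h) * indicator (?B k) x * indicator {0..1} s)"
    have "x \<in> (\<Union>k::nat. box (- (real k *\<^sub>R One)) (real k *\<^sub>R One))"
      by (subst UN_box_eq_UNIV) simp
    then obtain k :: nat where "x \<in> ?B k" using box_subset_cbox by blast
    then show "integrable lborel (\<lambda>s. (g (x + s *\<^sub>R h) \<bullet> h) * indicator {0..1} s)"
      using *[rule_format, of k] by simp
  qed
qed

text \<open>The identity for the shift s h gives, for each fixed s, almost every x; exchanging the
  quantifiers on the product space yields one null set of x off which almost every s works. The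
  substitution r |-> s r in the integral requires s > 0, and s = 0 is a single point.\<close>

lemma segment_identity_initial:
  "AE x in lborel. AE s in lborel. s \<in> {0..1} \<longrightarrow>
     f (x + s *\<^sub>R h) = f x + (\<integral>r. (g (x + r *\<^sub>R h) \<bullet> h) * indicator {0..s} r \<partial>lborel)"
proof -
  have ae: "AE x in lborel. s \<in> {0..1} \<longrightarrow>
     f (x + s *\<^sub>R h) = f x + (\<integral>r. (g (x + r *\<^sub>R h) \<bullet> h) * indicator {0..s} r \<partial>lborel)" if s0: "s \<noteq> 0" for s
  proof (cases "s \<in> {0..1}")
    case True
    then have s: "0 < s" using s0 by simp
    have "(\<integral>r. (g (x + r *\<^sub>R (s *\<^sub>R h)) \<bullet> (s *\<^sub>R h)) * indicator {0..1} r \<partial>lborel)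
        = (\<integral>r. (g (x + r *\<^sub>R h) \<bullet> h) * indicator {0..s} r \<partial>lborel)" for x
    proof -
      have "(\<integral>r. (g (x + r *\<^sub>R h) \<bullet> h) * indicator {0..s} r \<partial>lborel)
          = s * (\<integral>r. (g (x + (0 + s * r) *\<^sub>R h) \<bullet> h) * indicator {0..s} (0 + s * r) \<partial>lborel)"
        using s lborel_integral_real_affine[of s "\<lambda>r. (g (x + r *\<^sub>R h) \<bullet> h) * indicator {0..s} r" 0] by simp
      moreover have "indicator {0..s} (0 + s * r) = (indicator {0..1} r :: real)" for r
        using s by (auto simp: indicator_def zero_le_mult_iff)
      ultimately show ?thesis by (simp add: mult_ac)
    qed
    then show ?thesis using segment_identity[of "s *\<^sub>R h"] by (auto simp: algebra_simps)
  qed auto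
  have ae': "AE s in lborel. AE x in lborel. s \<in> {0..1} \<longrightarrow>
     f (x + s *\<^sub>R h) = f x + (\<integral>r. (g (x + r *\<^sub>R h) \<bullet> h) * indicator {0..s} r \<partial>lborel)"
    by (rule AE_mp[OF AE_lborel_singleton[of 0]], intro AE_I2 impI ae)
  \<comment> \<open>The varying upper limit becomes a condition on the pair (s, r), so that
    measurability in both variables can be derived.\<close>
  have *: "indicator {0..s} r = (if 0 \<le> r \<and> r \<le> s then 1 else 0 :: real)" for r s :: real
    by (simp add: indicator_def)
  have [measurable]: "(\<lambda>p. \<integral>r. (g (fst p + r *\<^sub>R h) \<bullet> h) * indicator {0..snd p} r \<partial>lborel)
      \<in> borel_measurable (lborel \<Otimes>\<^sub>M lborel)"
    unfolding * by measurable
  have "{p \<in> space (lborel \<Otimes>\<^sub>M lborel). snd p \<in> {0..1} \<longrightarrow>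
     f (fst p + snd p *\<^sub>R h) = f (fst p) + (\<integral>r. (g (fst p + r *\<^sub>R h) \<bullet> h) * indicator {0..snd p} r \<partial>lborel)}
     \<in> sets (lborel \<Otimes>\<^sub>M lborel)"
    by measurable
  from lborel_pair.AE_commute[OF this] ae' show ?thesis by (rule iffD2)
qed

end

text \<open>Keeping only the part of the path where \<open>a < F < b\<close> replaces the chain rule for truncations.\<close>

lemma crossing_integral_bound:
  fixes G :: "real \<Rightarrow> real"
  assumes G: "integrable lborel (\<lambda>s. G s * indicator {0..1} s)"
    and ab: "a < b"
    and F: "\<And>s. F s = F0 + (\<integral>r. G r * indicator {0..s} r \<partial>lborel)"
    and F01: "F0 \<le> a" "b \<le> F 1"
  shows "ennreal (b - a) \<le> (\<integral>\<^sup>+s. ennreal \<bar>G s\<bar> * indicator {s\<in>{0..1}. a < F s \<and> F s < b} s \<partial>lborel)"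
proof -
  have int: "integrable lborel (\<lambda>r. G r * indicator {0..s} r)" if "s \<le> 1" for s
  proof -
    have "integrable lborel (\<lambda>r. G r * indicator {0..1} r * indicator {0..s} r)"
      using G by (rule integrable_real_mult_indicator[rotated]) simp
    moreover have "G r * indicator {0..1} r * indicator {0..s} r = G r * indicator {0..s} r" for r
      using that by (auto simp: indicator_def)
    ultimately show ?thesis by simp
  qed
  have set: "set_integrable lborel {0..s} G" if "s \<le> 1" for s
    using int[OF that] by (simp add: set_integrable_def mult.commute)
  have Fint: "F s = F0 + integral {0..s} G" if "s \<in> {0..1}" for s
    using set_borel_integral_eq_integral(2)[OF set[of s]] that
    by (simp add: F set_lebesgue_integral_def mult.commute)
  have cont: "continuous_on {0..1} F"
  proof -
    have "continuous_on {0..1} (\<lambda>s. F0 + integral {0..s} G)"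
      using set_borel_integral_eq_integral(1)[OF set[of 1]]
      by (intro continuous_intros indefinite_integral_continuous_1) simp
    then show ?thesis by (rule continuous_on_eq) (rule Fint[symmetric])
  qed
  \<comment> \<open>The point \<open>s0\<close> is the last time at which F is at most a, and
    \<open>s1\<close> the first later time at which F is at least b; in between, F stays strictly
    inside the band.\<close>
  define S where "S = {s\<in>{0..1}. F s \<le> a}"
  have "compact S"
    unfolding S_def compact_eq_bounded_closed
    using continuous_closed_preimage[OF cont, of "{..a}"]
    by (auto simp: vimage_def Int_def conj_commute intro: bounded_subset[OF bounded_closed_interval[of 0 1]])
  moreover have "0 \<in> S" using F01 Fint[of 0] by (simp add: S_def)
  ultimately obtain s0 where s0: "s0 \<in> S" "\<And>s. s \<in> S \<Longrightarrow> s \<le> s0"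
    using compact_attains_sup[of S] by auto
  define T where "T = {s\<in>{s0..1}. b \<le> F s}"
  have s01: "s0 \<in> {0..1}" "F s0 \<le> a" using s0 by (auto simp: S_def)
  have "compact T"
    unfolding T_def compact_eq_bounded_closed
    using continuous_closed_preimage[OF continuous_on_subset[OF cont, of "{s0..1}"], of "{b..}"]
      s01
    by (auto simp: vimage_def Int_def conj_commute intro: bounded_subset[OF bounded_closed_interval[of s0 1]])
  moreover have "1 \<in> T" using F01 s01 by (simp add: T_def)
  ultimately obtain s1 where s1: "s1 \<in> T" "\<And>s. s \<in> T \<Longrightarrow> s1 \<le> s"
    using compact_attains_inf[of T] by auto
  have s1': "s1 \<in> {s0..1}" "b \<le> F s1" using s1(1) by (auto simp: T_def)
  have mid: "a < F s \<and> F s < b" if "s0 < s" "s < s1" for s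
    using s0(2)[of s] s1(2)[of s] that s01 s1' by (force simp: S_def T_def)
  have eq: "G r * indicator {0..s1} r - G r * indicator {0..s0} r = G r * indicator {s0<..s1} r" for r
    using s01 s1' by (auto simp: indicator_def)
  have i: "integrable lborel (\<lambda>r. G r * indicator {s0<..s1} r)"
    using Bochner_Integration.integrable_diff[OF int[of s1] int[of s0]] s01 s1' by (simp add: eq)
  have "b - a \<le> F s1 - F s0" using s01 s1' by simp
  also have "\<dots> = (\<integral>r. G r * indicator {s0<..s1} r \<partial>lborel)"
    using Bochner_Integration.integral_diff[OF int[of s1] int[of s0]] s01 s1' by (simp add: F eq)
  also have "\<dots> \<le> norm \<dots>" by simp
  finally have "ennreal (b - a) \<le> ennreal (norm (\<integral>r. G r * indicator {s0<..s1} r \<partial>lborel))"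
    by (rule ennreal_leI)
  also have "\<dots> \<le> (\<integral>\<^sup>+r. ennreal (norm (G r * indicator {s0<..s1} r)) \<partial>lborel)"
    by (rule integral_norm_bound_ennreal[OF i])
  also have "\<dots> \<le> (\<integral>\<^sup>+s. ennreal \<bar>G s\<bar> * indicator {s\<in>{0..1}. a < F s \<and> F s < b} s \<partial>lborel)"
  \<comment> \<open>Only the end point \<open>s1\<close> of the half-open interval can violate the
    pointwise inequality, since F is not below b there.\<close>
  proof (rule nn_integral_mono_AE)
    have "ennreal (norm (G r * indicator {s0<..s1} r)) \<le> ennreal \<bar>G r\<bar> * indicator {s\<in>{0..1}. a < F s \<and> F s < b} r"
      if "r \<noteq> s1" for r
      using mid[of r] that s01 s1' by (auto simp: indicator_def)
    then show "AE r in lborel. ennreal (norm (G r * indicator {s0<..s1} r))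
        \<le> ennreal \<bar>G r\<bar> * indicator {s\<in>{0..1}. a < F s \<and> F s < b} r"
      using AE_lborel_singleton[of s1] by (auto elim: AE_mp)
  qed
  finally show ?thesis .
qed

section \<open>Poincare inequalities on cubes\<close>

lemma mem_cube: "x \<in> cube a l \<longleftrightarrow> (\<forall>i. a $ i \<le> x $ i \<and> x $ i \<le> a $ i + l)"
  by (simp add: cube_def mem_box_cart)

lemma sets_cube [measurable]: "cube a l \<in> sets borel"
  by (simp add: cube_def)

lemma emeasure_cube:
  fixes a :: "real ^ 'n" and l :: real
  assumes "0 \<le> l"
  shows "emeasure lborel (cube a l) = ennreal (l ^ CARD('n))"
proof -
  have "a \<bullet> b \<le> (\<chi> i. a $ i + l) \<bullet> b" if "b \<in> Basis" for b :: "real ^ 'n"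
    using that assms by (auto simp: Basis_vec_def inner_axis)
  then have "emeasure lborel (cube a l) = ennreal (\<Prod>b\<in>Basis. ((\<chi> i. a $ i + l) - a) \<bullet> b)"
    unfolding cube_def by (intro emeasure_lborel_cbox)
  also have "(\<Prod>b\<in>Basis. ((\<chi> i. a $ i + l) - a) \<bullet> b) = (\<Prod>b\<in>(Basis :: (real ^ 'n) set). l)"
    by (intro prod.cong refl) (auto simp: Basis_vec_def inner_axis)
  finally show ?thesis by simp
qed

lemma convex_cube: "convex (cube a l)"
  unfolding cube_def by (rule convex_box)

text \<open>By convexity the segment between two points of the cube stays in it, and for fixed h and
  s the translation x |-> x + s h preserves Lebesgue measure, so the integral over x is at most that
  of w over the cube. The factor \<open>CARD('n) * l\<close> bounds \<open>norm h\<close> through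
  the sum of the coordinates, and \<open>(2 * l) ^ CARD('n)\<close> is the volume of the cube
  [-l, l]^n that contains all differences h.\<close>

lemma segment_average_bound:
  fixes a :: "real ^ 'n" and l :: real and w :: "real ^ 'n \<Rightarrow> ennreal"
  assumes [measurable]: "w \<in> borel_measurable borel" and l: "0 < l"
  shows "(\<integral>\<^sup>+h. \<integral>\<^sup>+x. indicator (cube a l) x * indicator (cube a l) (x + h) *
      (\<integral>\<^sup>+s. ennreal (norm h) * w (x + s *\<^sub>R h) * indicator {0..1} s \<partial>lborel) \<partial>lborel \<partial>lborel)
    \<le> ennreal (CARD('n) * l * (2 * l) ^ CARD('n)) * (\<integral>\<^sup>+y. w y * indicator (cube a l) y \<partial>lborel)"
    (is "?L \<le> _")
proof -
  let ?R = "cube a l"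
  let ?I = "\<integral>\<^sup>+y. w y * indicator ?R y \<partial>lborel"
  let ?H = "cube (\<chi> i. - l) (2 * l) :: (real ^ 'n) set"
  have inner: "(\<integral>\<^sup>+x. indicator ?R x * indicator ?R (x + h) *
      (\<integral>\<^sup>+s. ennreal (norm h) * w (x + s *\<^sub>R h) * indicator {0..1} s \<partial>lborel) \<partial>lborel)
      \<le> ennreal (CARD('n) * l) * ?I * indicator ?H h" for h
  proof -
    have pt: "indicator ?R x * indicator ?R (x + h) * (ennreal (norm h) * w (x + s *\<^sub>R h) * indicator {0..1} s)
        \<le> ennreal (CARD('n) * l) * indicator ?H h * indicator {0..1} s * (w (x + s *\<^sub>R h) * indicator ?R (x + s *\<^sub>R h))" for x s
    proof (cases "x \<in> ?R \<and> x + h \<in> ?R \<and> s \<in> {0..1}")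
      case True
      have "(1 - s) *\<^sub>R x + s *\<^sub>R (x + h) \<in> ?R"
        using True by (intro convexD[OF convex_cube]) auto
      then have R: "x + s *\<^sub>R h \<in> ?R" by (simp add: algebra_simps)
      have hi: "\<bar>h $ i\<bar> \<le> l" for i
      proof -
        have "a $ i \<le> x $ i" "x $ i \<le> a $ i + l" "a $ i \<le> x $ i + h $ i" "x $ i + h $ i \<le> a $ i + l"
          using True by (auto simp: mem_cube)
        then show ?thesis by linarith
      qed
      have "- l \<le> h $ i \<and> h $ i \<le> - l + 2 * l" for i using hi[of i] by linarith
      then have H: "h \<in> ?H" by (simp add: mem_cube)
      have "norm h \<le> (\<Sum>i\<in>UNIV. \<bar>h $ i\<bar>)" by (rule norm_le_l1_cart)
      also have "\<dots> \<le> CARD('n) * l" using hi by (intro sum_bounded_above)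
      finally show ?thesis using True R H by (simp add: ennreal_leI mult_right_mono)
    qed (auto simp: indicator_def)
    have "(\<integral>\<^sup>+x. indicator ?R x * indicator ?R (x + h) *
        (\<integral>\<^sup>+s. ennreal (norm h) * w (x + s *\<^sub>R h) * indicator {0..1} s \<partial>lborel) \<partial>lborel)
      = (\<integral>\<^sup>+x. \<integral>\<^sup>+s. indicator ?R x * indicator ?R (x + h) * (ennreal (norm h) * w (x + s *\<^sub>R h) * indicator {0..1} s) \<partial>lborel \<partial>lborel)"
      by (intro nn_integral_cong nn_integral_cmult[symmetric]) measurable
    also have "\<dots> \<le> (\<integral>\<^sup>+x. \<integral>\<^sup>+s. ennreal (CARD('n) * l) * indicator ?H h * indicator {0..1::real} s *
        (w (x + s *\<^sub>R h) * indicator ?R (x + s *\<^sub>R h)) \<partial>lborel \<partial>lborel)"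
      by (intro nn_integral_mono pt)
    also have "\<dots> = (\<integral>\<^sup>+s. \<integral>\<^sup>+x. ennreal (CARD('n) * l) * indicator ?H h * indicator {0..1::real} s *
        (w (x + s *\<^sub>R h) * indicator ?R (x + s *\<^sub>R h)) \<partial>lborel \<partial>lborel)"
      by (rule lborel_pair.Fubini') measurable
    also have "\<dots> = (\<integral>\<^sup>+s. ennreal (CARD('n) * l) * indicator ?H h * ?I * indicator {0..1::real} s \<partial>lborel)"
    proof (intro nn_integral_cong)
      fix s :: real
      have "(\<integral>\<^sup>+x. w (x + s *\<^sub>R h) * indicator ?R (x + s *\<^sub>R h) \<partial>lborel) = ?I"
        by (rule nn_integral_translate[of "\<lambda>x. w x * indicator ?R x"]) measurable
      then show "(\<integral>\<^sup>+x. ennreal (CARD('n) * l) * indicator ?H h * indicator {0..1::real} s *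
          (w (x + s *\<^sub>R h) * indicator ?R (x + s *\<^sub>R h)) \<partial>lborel)
          = ennreal (CARD('n) * l) * indicator ?H h * ?I * indicator {0..1::real} s"
        by (subst nn_integral_cmult) (simp_all add: mult_ac)
    qed
    also have "\<dots> = ennreal (CARD('n) * l) * indicator ?H h * ?I"
      by (subst nn_integral_cmult) simp_all
    finally show ?thesis by (simp add: mult_ac)
  qed
  have "?L \<le> (\<integral>\<^sup>+h. ennreal (CARD('n) * l) * ?I * indicator ?H h \<partial>lborel)"
    by (intro nn_integral_mono inner)
  also have "\<dots> = ennreal (CARD('n) * l) * ?I * ennreal ((2 * l) ^ CARD('n))"
    using l by (subst nn_integral_cmult) (simp_all add: emeasure_cube)
  also have "\<dots> = ennreal (CARD('n) * l * (2 * l) ^ CARD('n)) * ?I"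
    using l by (simp add: ennreal_mult' mult_ac)
  finally show ?thesis .
qed

text \<open>The almost-everywhere statements along segments hold for each fixed h, so pairs (x, y)
  are reparametrised by x and h = y - x.\<close>

lemma nn_integral_pairs_eq_translates:
  fixes \<Phi> :: "real ^ 'n \<Rightarrow> real ^ 'n \<Rightarrow> ennreal"
  assumes [measurable]: "case_prod \<Phi> \<in> borel_measurable (borel \<Otimes>\<^sub>M borel)"
  shows "(\<integral>\<^sup>+x. \<integral>\<^sup>+y. \<Phi> x y \<partial>lborel \<partial>lborel) = (\<integral>\<^sup>+h. \<integral>\<^sup>+x. \<Phi> x (x + h) \<partial>lborel \<partial>lborel)"
proof -
  have "(\<integral>\<^sup>+y. \<Phi> x y \<partial>lborel) = (\<integral>\<^sup>+h. \<Phi> x (x + h) \<partial>lborel)" for x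
    using nn_integral_translate[of "\<Phi> x" x] by (simp add: add.commute)
  then have "(\<integral>\<^sup>+x. \<integral>\<^sup>+y. \<Phi> x y \<partial>lborel \<partial>lborel) = (\<integral>\<^sup>+x. \<integral>\<^sup>+h. \<Phi> x (x + h) \<partial>lborel \<partial>lborel)"
    by simp
  also have "\<dots> = (\<integral>\<^sup>+h. \<integral>\<^sup>+x. \<Phi> x (x + h) \<partial>lborel \<partial>lborel)"
    by (rule lborel_pair.Fubini') measurable
  finally show ?thesis .
qed

section \<open>Poincare inequalities from increments along segments\<close>

context weak_deriv
begin

text \<open>Here \<open>F\<close> is the absolutely continuous version of f on the segment. It takes
  the values of f at both ends, which the crossing argument needs; inside it agrees with f for
  almost every s, which is enough under the integral.\<close>

lemma segment_crossing_bound: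
  fixes a b :: real
  assumes ab: "a < b"
  shows "AE x in lborel. f x \<le> a \<longrightarrow> b \<le> f (x + h) \<longrightarrow> ennreal (b - a) \<le>
    (\<integral>\<^sup>+s. ennreal (norm h) * (ennreal (norm (g (x + s *\<^sub>R h))) * indicator {y. a < f y \<and> f y < b} (x + s *\<^sub>R h))
      * indicator {0..1} s \<partial>lborel)"
  using segment_identity[of h] AE_integrable_segment[of h] segment_identity_initial[of h]
proof eventually_elim
  case (elim x)
  define G where "G s = g (x + s *\<^sub>R h) \<bullet> h" for s
  define F where "F s = f x + (\<integral>r. G r * indicator {0..s} r \<partial>lborel)" for s
  show ?case
  proof (intro impI)
    assume "f x \<le> a" "b \<le> f (x + h)"
    then have "ennreal (b - a) \<le> (\<integral>\<^sup>+s. ennreal \<bar>G s\<bar> * indicator {s\<in>{0..1}. a < F s \<and> F s < b} s \<partial>lborel)"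
      using elim(1,2) by (intro crossing_integral_bound[OF _ ab, of G F "f x"]) (auto simp: F_def G_def)
    also have "\<dots> \<le> (\<integral>\<^sup>+s. ennreal (norm h) * (ennreal (norm (g (x + s *\<^sub>R h))) * indicator {y. a < f y \<and> f y < b} (x + s *\<^sub>R h))
      * indicator {0..1} s \<partial>lborel)"
    proof (rule nn_integral_mono_AE)
      show "AE s in lborel. ennreal \<bar>G s\<bar> * indicator {s\<in>{0..1}. a < F s \<and> F s < b} s \<le>
          ennreal (norm h) * (ennreal (norm (g (x + s *\<^sub>R h))) * indicator {y. a < f y \<and> f y < b} (x + s *\<^sub>R h)) * indicator {0..1} s"
        using elim(3)
      proof eventually_elim
        case (elim s)
        have "ennreal \<bar>G s\<bar> \<le> ennreal (norm h) * ennreal (norm (g (x + s *\<^sub>R h)))"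
          unfolding G_def using Cauchy_Schwarz_ineq2[of "g (x + s *\<^sub>R h)" h]
          by (subst ennreal_mult[symmetric]) (auto intro!: ennreal_leI simp: mult.commute)
        moreover have "F s = f (x + s *\<^sub>R h)" if "s \<in> {0..1}" using elim that by (simp add: F_def G_def)
        ultimately show ?case by (auto simp: indicator_def)
      qed
    qed
    finally show "ennreal (b - a) \<le> \<dots>" .
  qed
qed

lemma segment_oscillation_bound:
  "AE x in lborel. ennreal \<bar>f (x + h) - f x\<bar> \<le>
    (\<integral>\<^sup>+s. ennreal (norm h) * ennreal (norm (g (x + s *\<^sub>R h))) * indicator {0..1} s \<partial>lborel)"
  using segment_identity[of h] AE_integrable_segment[of h]
proof eventually_elim
  case (elim x)
  have "ennreal \<bar>f (x + h) - f x\<bar> \<le> (\<integral>\<^sup>+s. ennreal (norm ((g (x + s *\<^sub>R h) \<bullet> h) * indicator {0..1} s)) \<partial>lborel)"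
    unfolding elim(1) using integral_norm_bound_ennreal[OF elim(2)] by simp
  also have "\<dots> \<le> (\<integral>\<^sup>+s. ennreal (norm h) * ennreal (norm (g (x + s *\<^sub>R h))) * indicator {0..1} s \<partial>lborel)"
  proof (intro nn_integral_mono)
    fix s :: real
    have "ennreal \<bar>g (x + s *\<^sub>R h) \<bullet> h\<bar> \<le> ennreal (norm h) * ennreal (norm (g (x + s *\<^sub>R h)))"
      using Cauchy_Schwarz_ineq2[of "g (x + s *\<^sub>R h)" h]
      by (subst ennreal_mult[symmetric]) (auto intro!: ennreal_leI simp: mult.commute)
    then show "ennreal (norm ((g (x + s *\<^sub>R h) \<bullet> h) * indicator {0..1} s))
        \<le> ennreal (norm h) * ennreal (norm (g (x + s *\<^sub>R h))) * indicator {0..1} s"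
      by (auto simp: indicator_def)
  qed
  finally show ?case .
qed

text \<open>The crossing bound is integrated over all pairs with x in {f \<le> a} and x + h in {f
  \<ge> b}; its constant left side then turns into the product with the two measures.\<close>

lemma level_poincare:
  fixes l a b :: real
  assumes l: "0 < l" and ab: "a < b"
  shows "ennreal (b - a) * emeasure lborel {x\<in>cube c l. f x \<le> a} * emeasure lborel {x\<in>cube c l. b \<le> f x}
    \<le> ennreal (CARD('n) * l * (2 * l) ^ CARD('n)) *
        (\<integral>\<^sup>+y. ennreal (norm (g y)) * indicator {y. a < f y \<and> f y < b} y * indicator (cube c l) y \<partial>lborel)"
proof -
  let ?R = "cube c l"
  let ?w = "\<lambda>y. ennreal (norm (g y)) * indicator {y. a < f y \<and> f y < b} y"
  let ?A = "{x\<in>?R. f x \<le> a}" and ?B = "{x\<in>?R. b \<le> f x}"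
  have "ennreal (b - a) * emeasure lborel ?A * emeasure lborel ?B
      = (\<integral>\<^sup>+x. \<integral>\<^sup>+y. ennreal (b - a) * indicator ?A x * indicator ?B y \<partial>lborel \<partial>lborel)"
    by (simp add: nn_integral_cmult nn_integral_multc)
  also have "\<dots> = (\<integral>\<^sup>+h. \<integral>\<^sup>+x. ennreal (b - a) * indicator ?A x * indicator ?B (x + h) \<partial>lborel \<partial>lborel)"
    by (rule nn_integral_pairs_eq_translates) measurable
  also have "\<dots> \<le> (\<integral>\<^sup>+h. \<integral>\<^sup>+x. indicator ?R x * indicator ?R (x + h) *
      (\<integral>\<^sup>+s. ennreal (norm h) * ?w (x + s *\<^sub>R h) * indicator {0..1} s \<partial>lborel) \<partial>lborel \<partial>lborel)"
  proof (rule nn_integral_mono, rule nn_integral_mono_AE)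
    fix h
    show "AE x in lborel. ennreal (b - a) * indicator ?A x * indicator ?B (x + h) \<le> indicator ?R x * indicator ?R (x + h) *
      (\<integral>\<^sup>+s. ennreal (norm h) * ?w (x + s *\<^sub>R h) * indicator {0..1} s \<partial>lborel)"
      using segment_crossing_bound[OF ab, of h] by eventually_elim (auto simp: indicator_def)
  qed
  also have "\<dots> \<le> ennreal (CARD('n) * l * (2 * l) ^ CARD('n)) * (\<integral>\<^sup>+y. ?w y * indicator ?R y \<partial>lborel)"
    by (rule segment_average_bound[OF _ l]) measurable
  finally show ?thesis .
qed

text \<open>The deviation from the mean at x is at most the average of |f y - f x| over y, which
  reduces the claim to pairs of points, now with the full oscillation in place of a crossing. It
  serves the cube Q itself, which has no dyadic parent.\<close>

lemma poincare:
  fixes l :: real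
  assumes l: "0 < l"
  shows "(\<integral>\<^sup>+x. ennreal \<bar>f x - (\<integral>y. f y * indicator (cube c l) y \<partial>lborel) / l ^ CARD('n)\<bar> * indicator (cube c l) x \<partial>lborel)
    \<le> ennreal (CARD('n) * l * 2 ^ CARD('n)) *
        (\<integral>\<^sup>+y. ennreal (norm (g y)) * indicator (cube c l) y \<partial>lborel)"
proof -
  let ?R = "cube c l" and ?N = "CARD('n)"
  let ?c = "(\<integral>y. f y * indicator ?R y \<partial>lborel) / l ^ ?N"
  let ?I = "\<integral>\<^sup>+y. ennreal (norm (g y)) * indicator ?R y \<partial>lborel"
  have int: "integrable lborel (\<lambda>y. f y * indicator ?R y)"
    using f by (simp add: locally_integrable_borel_def cube_def mult.commute)
  have i1: "integrable lborel (indicator ?R :: _ \<Rightarrow> real)"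
    using l by (simp add: emeasure_cube)
  have R: "(\<integral>y. indicator ?R y \<partial>lborel) = l ^ ?N"
    using l by (simp add: measure_def emeasure_cube)
  have pt: "ennreal (l ^ ?N) * ennreal \<bar>f x - ?c\<bar> \<le> (\<integral>\<^sup>+y. ennreal \<bar>f y - f x\<bar> * indicator ?R y \<partial>lborel)" for x
  proof -
    have i: "integrable lborel (\<lambda>y. (f y - f x) * indicator ?R y)"
      using int i1 by (simp add: left_diff_distrib)
    have "(\<integral>y. (f y - f x) * indicator ?R y \<partial>lborel) = (\<integral>y. f y * indicator ?R y \<partial>lborel) - f x * l ^ ?N"
      using int i1 R by (simp add: left_diff_distrib)
    also have "\<dots> = - (l ^ ?N * (f x - ?c))"
      using l by (simp add: right_diff_distrib)
    finally have "l ^ ?N * \<bar>f x - ?c\<bar> = norm (\<integral>y. (f y - f x) * indicator ?R y \<partial>lborel)"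
      using l by (simp add: abs_mult)
    then have "ennreal (l ^ ?N) * ennreal \<bar>f x - ?c\<bar> = ennreal (norm (\<integral>y. (f y - f x) * indicator ?R y \<partial>lborel))"
      using l by (simp add: ennreal_mult[symmetric])
    also have "\<dots> \<le> (\<integral>\<^sup>+y. ennreal (norm ((f y - f x) * indicator ?R y)) \<partial>lborel)"
      by (rule integral_norm_bound_ennreal[OF i])
    also have "\<dots> = (\<integral>\<^sup>+y. ennreal \<bar>f y - f x\<bar> * indicator ?R y \<partial>lborel)"
      by (intro nn_integral_cong) (simp add: indicator_def)
    finally show ?thesis .
  qed
  have "ennreal (l ^ ?N) * (\<integral>\<^sup>+x. ennreal \<bar>f x - ?c\<bar> * indicator ?R x \<partial>lborel)
      = (\<integral>\<^sup>+x. (ennreal (l ^ ?N) * ennreal \<bar>f x - ?c\<bar>) * indicator ?R x \<partial>lborel)"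
    by (subst nn_integral_cmult[symmetric]) (auto simp: mult_ac)
  also have "\<dots> \<le> (\<integral>\<^sup>+x. (\<integral>\<^sup>+y. ennreal \<bar>f y - f x\<bar> * indicator ?R y \<partial>lborel) * indicator ?R x \<partial>lborel)"
    by (intro nn_integral_mono mult_right_mono pt) auto
  also have "\<dots> = (\<integral>\<^sup>+x. \<integral>\<^sup>+y. indicator ?R x * indicator ?R y * ennreal \<bar>f y - f x\<bar> \<partial>lborel \<partial>lborel)"
    by (intro nn_integral_cong, subst nn_integral_multc[symmetric]) (auto simp: mult_ac)
  also have "\<dots> = (\<integral>\<^sup>+h. \<integral>\<^sup>+x. indicator ?R x * indicator ?R (x + h) * ennreal \<bar>f (x + h) - f x\<bar> \<partial>lborel \<partial>lborel)"
    by (rule nn_integral_pairs_eq_translates) measurable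
  also have "\<dots> \<le> (\<integral>\<^sup>+h. \<integral>\<^sup>+x. indicator ?R x * indicator ?R (x + h) *
      (\<integral>\<^sup>+s. ennreal (norm h) * ennreal (norm (g (x + s *\<^sub>R h))) * indicator {0..1} s \<partial>lborel) \<partial>lborel \<partial>lborel)"
  proof (rule nn_integral_mono, rule nn_integral_mono_AE)
    fix h
    show "AE x in lborel. indicator ?R x * indicator ?R (x + h) * ennreal \<bar>f (x + h) - f x\<bar> \<le> indicator ?R x * indicator ?R (x + h) *
      (\<integral>\<^sup>+s. ennreal (norm h) * ennreal (norm (g (x + s *\<^sub>R h))) * indicator {0..1} s \<partial>lborel)"
      using segment_oscillation_bound[of h] by eventually_elim (auto intro: mult_left_mono)
  qed
  also have "\<dots> \<le> ennreal (?N * l * (2 * l) ^ ?N) * ?I"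
    by (rule segment_average_bound[OF _ l]) measurable
  also have "\<dots> = ennreal (l ^ ?N) * (ennreal (?N * l * 2 ^ ?N) * ?I)"
    using l by (simp add: ennreal_mult' power_mult_distrib mult_ac)
  finally have *: "ennreal (l ^ ?N) * (\<integral>\<^sup>+x. ennreal \<bar>f x - ?c\<bar> * indicator ?R x \<partial>lborel)
      \<le> ennreal (l ^ ?N) * (ennreal (?N * l * 2 ^ ?N) * ?I)" .
  have "ennreal (1 / l ^ ?N) * (ennreal (l ^ ?N) * X) = X" for X
    using l by (simp add: mult.assoc[symmetric] ennreal_mult[symmetric])
  then show ?thesis using mult_left_mono[OF *, of "ennreal (1 / l ^ ?N)"] by simp
qed

end

section \<open>Dyadic cubes\<close>

text \<open>A dyadic cube is addressed by the list of bisection choices leading to it, the latest choice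
  first, so that the parent of the cube of \<open>p\<close> is the cube of \<open>tl p\<close>.\<close>

fun dyadic_corner :: "real ^ 'n \<Rightarrow> real \<Rightarrow> 'n set list \<Rightarrow> real ^ 'n" where
  "dyadic_corner a l [] = a"
| "dyadic_corner a l (S # p) =
     (\<chi> i. dyadic_corner a l p $ i + (if i \<in> S then l / 2 ^ length p / 2 else 0))"

definition dyadic_cube :: "real ^ 'n \<Rightarrow> real \<Rightarrow> 'n set list \<Rightarrow> (real ^ 'n) set" where
  "dyadic_cube a l p = cube (dyadic_corner a l p) (l / 2 ^ length p)"

lemma dyadic_cube_Nil: "dyadic_cube a l [] = cube a l"
  by (simp add: dyadic_cube_def)

lemma sets_dyadic_cube [measurable]: "dyadic_cube a l p \<in> sets borel"
  by (simp add: dyadic_cube_def)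

lemma side_length_dyadic_cube: "0 < l \<Longrightarrow> side_length (dyadic_cube a l p) = l / 2 ^ length p"
  by (simp add: dyadic_cube_def side_length_cube)

lemma emeasure_dyadic_cube:
  fixes a :: "real ^ 'n"
  shows "0 \<le> l \<Longrightarrow> emeasure lborel (dyadic_cube a l p) = ennreal ((l / 2 ^ length p) ^ CARD('n))"
  by (simp add: dyadic_cube_def emeasure_cube)

lemma dyadic_cube_Cons_subset:
  assumes "0 < l"
  shows "dyadic_cube a l (S # p) \<subseteq> dyadic_cube a l p"
proof
  fix x assume x: "x \<in> dyadic_cube a l (S # p)"
  define r where "r = l / 2 ^ length p"
  have r: "0 < r" using assms by (simp add: r_def)
  have "dyadic_corner a l p $ i \<le> x $ i \<and> x $ i \<le> dyadic_corner a l p $ i + r" for i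
    using x[unfolded dyadic_cube_def mem_cube, rule_format, of i] r
    by (auto simp: r_def[symmetric] mult.commute[of 2] divide_divide_eq_left[symmetric] split: if_splits)
  then show "x \<in> dyadic_cube a l p"
    by (simp add: dyadic_cube_def mem_cube r_def)
qed

lemma dyadic_cube_drop_subset:
  assumes "0 < l"
  shows "dyadic_cube a l p \<subseteq> dyadic_cube a l (drop k p)"
proof (induction p arbitrary: k)
  case (Cons S p)
  then show ?case
    using dyadic_cube_Cons_subset[OF assms, of a S p] by (cases k) auto
qed simp

lemma dyadic_cube_subset: "0 < l \<Longrightarrow> dyadic_cube a l p \<subseteq> cube a l"
  using dyadic_cube_drop_subset[of l a p "length p"] by (simp add: dyadic_cube_Nil)

lemma dyadic_cube_child:
  assumes "x \<in> dyadic_cube a l p"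
  obtains S where "x \<in> dyadic_cube a l (S # p)"
proof
  define r where "r = l / 2 ^ length p"
  \<comment> \<open>A point on a bisecting hyperplane is put into the upper half; the cubes are
    closed, so either choice is legitimate.\<close>
  show "x \<in> dyadic_cube a l ({i. dyadic_corner a l p $ i + l / 2 ^ length p / 2 \<le> x $ i} # p)"
    unfolding dyadic_cube_def mem_cube
  proof
    fix i
    have "dyadic_corner a l p $ i \<le> x $ i \<and> x $ i \<le> dyadic_corner a l p $ i + r"
      using assms by (simp add: dyadic_cube_def mem_cube r_def)
    then show "dyadic_corner a l ({i. dyadic_corner a l p $ i + l / 2 ^ length p / 2 \<le> x $ i} # p) $ i \<le> x $ i \<and>
        x $ i \<le> dyadic_corner a l ({i. dyadic_corner a l p $ i + l / 2 ^ length p / 2 \<le> x $ i} # p) $ i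
          + l / 2 ^ length ({i. dyadic_corner a l p $ i + l / 2 ^ length p / 2 \<le> x $ i} # p)"
      by (auto simp: r_def[symmetric] mult.commute[of 2] divide_divide_eq_left[symmetric])
  qed
qed

lemma dyadic_cube_level:
  assumes "x \<in> cube a l"
  shows "\<exists>p. length p = k \<and> x \<in> dyadic_cube a l p"
proof (induction k)
  case 0
  then show ?case using assms by (simp add: dyadic_cube_Nil)
next
  case (Suc k)
  then show ?case by (metis dyadic_cube_child length_Cons)
qed

text \<open>The definition of \<open>bisect\<close> ranges over all presentations of the set as a
  cube, but corner and side length are determined by the set.\<close>

lemma bisect_dyadic_cube:
  fixes a :: "real ^ 'n"
  assumes "0 < l"
  shows "bisect (dyadic_cube a l p) = range (\<lambda>S. dyadic_cube a l (S # p))"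
proof -
  let ?l = "l / 2 ^ length p" and ?a = "dyadic_corner a l p"
  have l: "0 < ?l" using assms by simp
  have "bisect (dyadic_cube a l p) = {cube (\<chi> i. ?a $ i + (if i \<in> S then ?l / 2 else 0)) (?l / 2) | S. True}"
  proof (intro equalityI subsetI)
    fix X assume "X \<in> bisect (dyadic_cube a l p)"
    then obtain b m S where X: "0 < m" "cube ?a ?l = cube b m"
      "X = cube (\<chi> i. b $ i + (if i \<in> S then m / 2 else 0)) (m / 2)"
      unfolding bisect_def dyadic_cube_def by blast
    then have "b = ?a" "m = ?l" using cube_eq_iff[OF l X(1), of ?a b] X(2) by simp_all
    then show "X \<in> {cube (\<chi> i. ?a $ i + (if i \<in> S then ?l / 2 else 0)) (?l / 2) | S. True}"
      using X(3) by blast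
  next
    fix X assume "X \<in> {cube (\<chi> i. ?a $ i + (if i \<in> S then ?l / 2 else 0)) (?l / 2) | S. True}"
    then show "X \<in> bisect (dyadic_cube a l p)"
      unfolding bisect_def dyadic_cube_def using l by blast
  qed
  also have "\<dots> = range (\<lambda>S. dyadic_cube a l (S # p))"
    by (auto simp: dyadic_cube_def mult.commute)
  finally show ?thesis .
qed

lemma dyadic_gen_cube:
  assumes "0 < l"
  shows "dyadic_gen k (cube a l) = dyadic_cube a l ` {p. length p = k}"
proof (induction k)
  case 0
  then show ?case by (auto simp: dyadic_cube_Nil)
next
  case (Suc k)
  have "dyadic_gen (Suc k) (cube a l) = (\<Union>p\<in>{p. length p = k}. range (\<lambda>S. dyadic_cube a l (S # p)))"
    by (simp add: Suc bisect_dyadic_cube[OF assms])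
  also have "\<dots> = dyadic_cube a l ` {p. length p = Suc k}"
    by (auto simp: length_Suc_conv)
  finally show ?case .
qed

lemma dyadic_eq: "0 < l \<Longrightarrow> dyadic (cube a l) = range (dyadic_cube a l)"
  by (auto simp: dyadic_def dyadic_gen_cube)

text \<open>Points off all bisecting hyperplanes, which lie in only one closed dyadic cube of each generation.\<close>

definition dyadic_separated :: "real ^ 'n \<Rightarrow> real \<Rightarrow> real ^ 'n \<Rightarrow> bool" where
  "dyadic_separated a l x \<longleftrightarrow> (\<forall>p i. x $ i \<noteq> dyadic_corner a l p $ i + l / 2 ^ length p / 2)"

text \<open>Addresses form a countable type, so only countably many hyperplanes are
  excluded.\<close>

lemma AE_dyadic_separated: "AE x in lborel. dyadic_separated a l (x :: real ^ 'n)"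
  unfolding dyadic_separated_def AE_all_countable
proof (intro allI)
  fix p and i :: 'n
  let ?c = "dyadic_corner a l p $ i + l / 2 ^ length p / 2"
  have "{x :: real ^ 'n. x $ i = ?c} \<in> null_sets lebesgue"
    using negligible_standard_hyperplane[of "axis i (1::real) :: real ^ 'n" ?c]
    by (simp add: negligible_iff_null_sets[symmetric] inner_axis)
  then have "AE x :: real ^ 'n in lebesgue. x $ i \<noteq> ?c"
    by (rule AE_I') auto
  then show "AE x in lborel. x $ i \<noteq> ?c" by (simp add: AE_completion_iff)
qed

text \<open>Off the bisecting hyperplanes, x determines in every coordinate which half of the
  current cube contains it, hence one entry of the address after the other.\<close>

lemma dyadic_cube_unique:
  assumes l: "0 < l" and x: "dyadic_separated a l x"
  shows "length p = length q \<Longrightarrow> x \<in> dyadic_cube a l p \<Longrightarrow> x \<in> dyadic_cube a l q \<Longrightarrow> p = q"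
proof (induction p q rule: list_induct2)
  case (Cons S p T q)
  then have pq: "p = q" using dyadic_cube_Cons_subset[OF l] by blast
  have S: "U = {i. dyadic_corner a l p $ i + l / 2 ^ length p / 2 \<le> x $ i}"
    if "x \<in> dyadic_cube a l (U # p)" for U
  proof -
    have "i \<in> U \<longleftrightarrow> dyadic_corner a l p $ i + l / 2 ^ length p / 2 \<le> x $ i" for i
    proof -
      define r where "r = l / 2 ^ length p"
      have "x $ i \<noteq> dyadic_corner a l p $ i + r / 2" using x by (simp add: dyadic_separated_def r_def)
      then show ?thesis
        using that[unfolded dyadic_cube_def mem_cube, rule_format, of i]
        by (auto simp: r_def[symmetric] mult.commute[of 2] divide_divide_eq_left[symmetric] split: if_splits)
    qed
    then show ?thesis by blast
  qed
  have "S = T"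
    using S[of S] S[of T] Cons.prems(1,2) unfolding pq by simp
  then show ?case using pq by simp
qed simp

section \<open>Small cubes, dyadic density and quantiles\<close>

lemma dyadic_cube_dist:
  fixes a :: "real ^ 'n"
  assumes "x \<in> dyadic_cube a l p" "y \<in> dyadic_cube a l p"
  shows "dist x y \<le> CARD('n) * (l / 2 ^ length p)"
proof -
  have "\<bar>(x - y) $ i\<bar> \<le> l / 2 ^ length p" for i
    using assms[unfolded dyadic_cube_def mem_cube, rule_format, of i] by auto
  then have "(\<Sum>i\<in>UNIV. \<bar>(x - y) $ i\<bar>) \<le> CARD('n) * (l / 2 ^ length p)"
    by (intro sum_bounded_above)
  then show ?thesis using norm_le_l1_cart[of "x - y"] by (simp add: dist_norm)
qed

lemma dyadic_cube_small:
  fixes a :: "real ^ 'n"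
  assumes l: "0 < l" and x: "x \<in> cube a l" and U: "open U" "x \<in> U"
  obtains p where "x \<in> dyadic_cube a l p" "dyadic_cube a l p \<subseteq> U"
proof -
  obtain r where r: "0 < r" "ball x r \<subseteq> U" using U open_contains_ball by blast
  have "(\<lambda>k. CARD('n) * l * (1 / 2) ^ k) \<longlonglongrightarrow> CARD('n) * l * 0"
    by (intro tendsto_intros LIMSEQ_power_zero) simp
  from order_tendstoD(2)[OF this, of r] r obtain k where k: "CARD('n) * l * (1 / 2) ^ k < r"
    by (auto simp: eventually_sequentially)
  obtain p where p: "length p = k" "x \<in> dyadic_cube a l p" using dyadic_cube_level[OF x] by blast
  have "dyadic_cube a l p \<subseteq> ball x r"
    using dyadic_cube_dist[OF p(2)] k p(1) by (force simp: power_divide)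
  then show ?thesis using that p r by blast
qed

text \<open>Outer regularity shows that the set \<open>N\<close> of exceptional points satisfies |N|
  \<le> \<gamma> (|N| + e) for every e > 0, which is impossible for 0 < |N| < \<infinity> because
  \<gamma> < 1.\<close>

lemma dyadic_density:
  fixes a :: "real ^ 'n" and l \<gamma> :: real
  assumes l: "0 < l" and \<gamma>: "0 \<le> \<gamma>" "\<gamma> < 1" and E [measurable]: "E \<in> sets borel"
  shows "AE x in lborel. x \<in> cube a l \<longrightarrow> x \<in> E \<longrightarrow>
    (\<exists>p. x \<in> dyadic_cube a l p \<and> ennreal \<gamma> * emeasure lborel (dyadic_cube a l p) < emeasure lborel (dyadic_cube a l p \<inter> E))"
proof -
  let ?D = "dyadic_cube a l"
  define B where "B = {p. ennreal \<gamma> * emeasure lborel (?D p) < emeasure lborel (?D p \<inter> E)}"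
  define N where "N = (E \<inter> cube a l) - (\<Union>p\<in>B. ?D p)"
  have N [measurable]: "N \<in> sets borel" unfolding N_def by measurable
  have Nfin: "emeasure lborel N < \<infinity>"
  proof -
    have "emeasure lborel N \<le> emeasure lborel (cube a l)"
      by (rule emeasure_mono) (auto simp: N_def)
    also have "\<dots> < \<infinity>" using l by (simp add: emeasure_cube)
    finally show ?thesis .
  qed
  \<comment> \<open>The cubes of one generation inside an open superset of \<open>N\<close> eventually cover \<open>N\<close>, and
    \<open>N\<close> has density at most \<open>\<gamma>\<close> in each of them.\<close>
  have step: "emeasure lborel N \<le> ennreal \<gamma> * (emeasure lborel N + ennreal e)" if e: "0 < e" for e :: real
  proof -
    obtain U where U: "open U" "N \<subseteq> U" "emeasure lborel (U - N) < ennreal e"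
      using outer_regular_lborel[OF N e] by blast
    have [measurable]: "U \<in> sets borel" using U by simp
    define V where "V k = {p. length p = k \<and> ?D p \<subseteq> U \<and> ?D p \<inter> N \<noteq> {}}" for k
    have finV: "finite (V k)" for k
      by (rule finite_subset[OF _ finite_lists_length_eq[of "UNIV :: 'n set set" k]]) (auto simp: V_def)
    define W where "W k = (\<Union>p\<in>V k. ?D p)" for k
    have [measurable]: "W k \<in> sets borel" for k
      unfolding W_def by (intro sets.finite_UN finV) simp
    have "N \<subseteq> (\<Union>k. N \<inter> W k)"
    proof
      fix x assume x: "x \<in> N"
      then obtain p where "x \<in> ?D p" "?D p \<subseteq> U"
        using dyadic_cube_small[OF l _ U(1), of x a] U(2) by (auto simp: N_def)
      then show "x \<in> (\<Union>k. N \<inter> W k)" using x by (auto simp: W_def V_def)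
    qed
    then have NW: "N \<inter> (\<Union>k. W k) = N" by blast
    \<comment> \<open>A point of \<open>N\<close> in a cube of \<open>V k\<close> lies in one of its
      children, which again is contained in \<open>U\<close> and meets \<open>N\<close>.\<close>
    have inc: "incseq (\<lambda>k. N \<inter> W k)"
    proof (rule incseq_SucI, rule subsetI)
      fix k x assume "x \<in> N \<inter> W k"
      then obtain p where p: "x \<in> N" "length p = k" "?D p \<subseteq> U" "x \<in> ?D p" by (auto simp: W_def V_def)
      then obtain S where S: "x \<in> ?D (S # p)" using dyadic_cube_child by blast
      then have "S # p \<in> V (Suc k)" using p dyadic_cube_Cons_subset[OF l, of a S p] by (auto simp: V_def)
      then show "x \<in> N \<inter> W (Suc k)" using S p by (auto simp: W_def)
    qed
    have "emeasure lborel (N \<inter> W k) \<le> ennreal \<gamma> * emeasure lborel U" for k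
    proof -
      have "emeasure lborel (N \<inter> W k) \<le> emeasure lborel (\<Union>p\<in>V k. ?D p \<inter> E)"
        by (intro emeasure_mono sets.finite_UN finV) (auto simp: W_def N_def)
      also have "\<dots> \<le> (\<Sum>p\<in>V k. emeasure lborel (?D p \<inter> E))"
        by (intro emeasure_subadditive_finite finV) auto
      also have "\<dots> \<le> (\<Sum>p\<in>V k. ennreal \<gamma> * emeasure lborel (?D p))"
        by (intro sum_mono) (auto simp: V_def N_def B_def not_less)
      also have "\<dots> = ennreal \<gamma> * (\<integral>\<^sup>+x. (\<Sum>p\<in>V k. indicator (?D p) x) \<partial>lborel)"
        by (subst nn_integral_sum) (auto simp: sum_distrib_left)
      \<comment> \<open>Closed cubes of one generation overlap in their boundaries only, so almost
        every point is counted at most once.\<close>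
      also have "(\<integral>\<^sup>+x. (\<Sum>p\<in>V k. indicator (?D p) x) \<partial>lborel) \<le> (\<integral>\<^sup>+x. indicator U x \<partial>lborel)"
      proof (rule nn_integral_mono_AE)
        show "AE x in lborel. (\<Sum>p\<in>V k. indicator (?D p) x) \<le> (indicator U x :: ennreal)"
          using AE_dyadic_separated[of a l]
        proof eventually_elim
          case (elim x)
          show ?case
          proof (cases "\<exists>p\<in>V k. x \<in> ?D p")
            case True
            then obtain p where p: "p \<in> V k" "x \<in> ?D p" by blast
            have "indicator (?D q) x = (if q = p then 1 else 0 :: ennreal)" if "q \<in> V k" for q
            proof -
              have "x \<in> ?D q \<longleftrightarrow> q = p"
                using dyadic_cube_unique[OF l elim, of q p] p that unfolding V_def by blast
              then show ?thesis by (simp add: indicator_def)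
            qed
            then have "(\<Sum>q\<in>V k. indicator (?D q) x) = (\<Sum>q\<in>V k. if q = p then 1 else 0 :: ennreal)"
              by (rule sum.cong[OF refl])
            also have "\<dots> = 1" using p finV[of k] by simp
            finally show ?thesis using p by (auto simp: V_def)
          next
            case False
            then have "(\<Sum>q\<in>V k. indicator (?D q) x) = (0 :: ennreal)"
              by (intro sum.neutral) auto
            then show ?thesis by simp
          qed
        qed
      qed
      finally show ?thesis by (simp add: mult_left_mono)
    qed
    then have "(SUP k. emeasure lborel (N \<inter> W k)) \<le> ennreal \<gamma> * emeasure lborel U"
      by (rule SUP_least)
    moreover have "(SUP k. emeasure lborel (N \<inter> W k)) = emeasure lborel N"
      by (subst SUP_emeasure_incseq[OF _ inc]) (auto simp: NW)
    ultimately have "emeasure lborel N \<le> ennreal \<gamma> * emeasure lborel U" by simp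
    also have "emeasure lborel U \<le> emeasure lborel N + ennreal e"
    proof -
      have "emeasure lborel U = emeasure lborel N + emeasure lborel (U - N)"
        using U(2) by (subst plus_emeasure) (auto simp: Un_absorb1)
      then show ?thesis using U(3) by (simp add: add_left_mono less_imp_le)
    qed
    finally show ?thesis by (simp add: mult_left_mono)
  qed
  obtain m where m: "emeasure lborel N = ennreal m" "0 \<le> m"
    using Nfin by (cases "emeasure lborel N") auto
  have "m \<le> \<gamma> * m + \<gamma> * e" if "0 < e" for e
  proof -
    have "ennreal m \<le> ennreal (\<gamma> * (m + e))"
      using step[OF that] m \<gamma> that by (simp add: ennreal_mult')
    then have "m \<le> \<gamma> * (m + e)"
      using m(2) \<gamma> that by (subst (asm) ennreal_le_iff) auto
    then show ?thesis by (simp add: distrib_left)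
  qed
  have le: "m \<le> \<gamma> * m + e" if "0 < e" for e
  proof -
    have "\<gamma> * e \<le> 1 * e" using that \<gamma> by (intro mult_right_mono) auto
    then show ?thesis using \<open>\<And>e. 0 < e \<Longrightarrow> m \<le> \<gamma> * m + \<gamma> * e\<close>[OF that] by linarith
  qed
  have "m \<le> \<gamma> * m" by (rule field_le_epsilon) (rule le)
  then have "(1 - \<gamma>) * m \<le> 0" by (simp add: algebra_simps)
  then have "m = 0" using \<gamma> m(2) by (simp add: mult_le_0_iff)
  then have "N \<in> null_sets lborel" using m by (auto simp: null_sets_def)
  then have "AE x in lborel. x \<notin> N" by (rule AE_not_in)
  then show ?thesis by eventually_elim (auto simp: N_def B_def)
qed

text \<open>The witness is the infimum s of the levels t for which {f > t} fills at most the
  fraction \<gamma> of R. Continuity of the measure as t decreases to s bounds {f > s} from above,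
  and as t increases to s it bounds {f \<ge> s} from below; the two sets differ in measure if f
  takes the value s with positive measure.\<close>

lemma ex_upper_quantile:
  fixes f :: "'a \<Rightarrow> real" and \<gamma> :: real
  assumes [measurable]: "f \<in> borel_measurable M" "R \<in> sets M" and fin: "emeasure M R < \<infinity>"
    and pos: "0 < measure M R" and \<gamma>: "0 < \<gamma>" "\<gamma> < 1"
  shows "\<exists>s. \<gamma> * measure M R \<le> measure M {x\<in>R. s \<le> f x} \<and> measure M {x\<in>R. s < f x} \<le> \<gamma> * measure M R"
proof -
  let ?m = "measure M R"
  have Rs: "R \<subseteq> space M" by (rule sets.sets_into_space) simp
  have sets: "{x\<in>R. t < f x} \<in> sets M" "{x\<in>R. t \<le> f x} \<in> sets M" for t
  proof -
    have "{x\<in>R. t < f x} = R \<inter> {x\<in>space M. t < f x}" "{x\<in>R. t \<le> f x} = R \<inter> {x\<in>space M. t \<le> f x}"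
      using Rs by auto
    then show "{x\<in>R. t < f x} \<in> sets M" "{x\<in>R. t \<le> f x} \<in> sets M" by simp_all
  qed
  have fm: "emeasure M S \<noteq> \<infinity>" if "S \<in> sets M" "S \<subseteq> R" for S
    using emeasure_mono[of S R M] fin that(2) \<open>R \<in> sets M\<close> by (auto simp: top_unique)
  have fm1: "emeasure M {x\<in>R. t < f x} \<noteq> \<infinity>" for t
    by (rule fm[OF sets(1)]) blast
  have mono: "measure M {x\<in>R. t < f x} \<le> measure M {x\<in>R. s < f x}" if "s \<le> t" for s t
  proof (rule measure_mono_fmeasurable)
    show "{x\<in>R. t < f x} \<subseteq> {x\<in>R. s < f x}" using that by auto
    show "{x\<in>R. s < f x} \<in> fmeasurable M"
      using fm1[of s] sets by (simp add: fmeasurable_def top.not_eq_extremum)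
  qed (rule sets)
  have lim_dec: "(\<lambda>k. measure M {x\<in>R. t k < f x}) \<longlonglongrightarrow> measure M (\<Inter>k. {x\<in>R. t k < f x})"
    if "incseq t" for t :: "nat \<Rightarrow> real"
  proof (rule Lim_measure_decseq)
    show "decseq (\<lambda>k. {x\<in>R. t k < f x})"
      unfolding decseq_def using incseqD[OF that] by (auto intro: le_less_trans)
  qed (use sets(1) fm1 in auto)
  have lim_inc: "(\<lambda>k. measure M {x\<in>R. t k < f x}) \<longlonglongrightarrow> measure M (\<Union>k. {x\<in>R. t k < f x})"
    if "decseq t" for t :: "nat \<Rightarrow> real"
  proof (rule Lim_measure_incseq)
    show "incseq (\<lambda>k. {x\<in>R. t k < f x})"
      unfolding incseq_def using decseqD[OF that] by (auto intro: le_less_trans)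
    have "(\<Union>k. {x\<in>R. t k < f x}) \<in> sets M" using sets(1) by auto
    then show "emeasure M (\<Union>k. {x\<in>R. t k < f x}) \<noteq> \<infinity>" by (rule fm) blast
  qed (use sets(1) in auto)
  \<comment> \<open>The measure of {f > t} tends to 0 as t grows and to that of R as t decreases;
    since 0 < \<gamma> < 1, this makes \<open>T\<close> nonempty and bounded below.\<close>
  have "\<exists>k. \<not> real k < f x" for x
    using real_arch_simple[of "f x"] by (simp add: not_less)
  then have "(\<Inter>k. {x\<in>R. real k < f x}) = {}" by blast
  with lim_dec[of real] have "(\<lambda>k. measure M {x\<in>R. real k < f x}) \<longlonglongrightarrow> 0"
    by (simp add: incseq_def)
  from order_tendstoD(2)[OF this, of "\<gamma> * ?m"] obtain t1 where t1: "measure M {x\<in>R. real t1 < f x} < \<gamma> * ?m"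
    using \<gamma> pos by (auto simp: eventually_sequentially)
  have "\<exists>k. - real k < f x" for x
    using reals_Archimedean2[of "- f x"] by (simp add: minus_less_iff)
  then have "(\<Union>k. {x\<in>R. - real k < f x}) = R" by blast
  with lim_inc[of "\<lambda>k. - real k"] have "(\<lambda>k. measure M {x\<in>R. - real k < f x}) \<longlonglongrightarrow> ?m"
    by (simp add: decseq_def)
  from order_tendstoD(1)[OF this, of "\<gamma> * ?m"] obtain t0 where t0: "\<gamma> * ?m < measure M {x\<in>R. - real t0 < f x}"
    using \<gamma> pos by (auto simp: eventually_sequentially)
  define T where "T = {t. measure M {x\<in>R. t < f x} \<le> \<gamma> * ?m}"
  have T1: "T \<noteq> {}" using t1 by (auto simp: T_def intro: less_imp_le)
  have "- real t0 \<le> t" if "t \<in> T" for t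
    using that t0 mono[of t "- real t0"] by (force simp: T_def)
  then have T2: "bdd_below T" by (rule bdd_belowI)
  define s where "s = Inf T"
  have up: "measure M {x\<in>R. t < f x} \<le> \<gamma> * ?m" if st: "s < t" for t
  proof -
    obtain t' where "t' \<in> T" "t' < t" using cInf_less_iff[OF T1 T2, of t] st unfolding s_def by blast
    then show ?thesis using mono[of t' t] by (simp add: T_def)
  qed
  have down: "\<gamma> * ?m \<le> measure M {x\<in>R. t < f x}" if "t < s" for t
  proof (rule ccontr)
    assume "\<not> ?thesis"
    then have "t \<in> T" by (simp add: T_def)
    then show False using cInf_lower[OF _ T2, of t] that by (simp add: s_def)
  qed
  have dec: "decseq (\<lambda>k. inverse (real (Suc k)))"
    by (auto simp: decseq_def le_imp_inverse_le)
  have "(\<Union>k. {x\<in>R. s + inverse (real (Suc k)) < f x}) = {x\<in>R. s < f x}"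
  proof (intro equalityI subsetI)
    fix x assume "x \<in> (\<Union>k. {x\<in>R. s + inverse (real (Suc k)) < f x})"
    then obtain k where k: "x \<in> R" "s + inverse (real (Suc k)) < f x" by blast
    have "0 < inverse (real (Suc k))" by simp
    with k(2) have "s < f x" by linarith
    with k(1) show "x \<in> {x\<in>R. s < f x}" by blast
  next
    fix x assume x: "x \<in> {x\<in>R. s < f x}"
    then obtain k where "inverse (real (Suc k)) < f x - s" using reals_Archimedean[of "f x - s"] by auto
    then have "s + inverse (real (Suc k)) < f x" by linarith
    then show "x \<in> (\<Union>k. {x\<in>R. s + inverse (real (Suc k)) < f x})" using x by blast
  qed
  with lim_inc[of "\<lambda>k. s + inverse (real (Suc k))"] dec
  have "(\<lambda>k. measure M {x\<in>R. s + inverse (real (Suc k)) < f x}) \<longlonglongrightarrow> measure M {x\<in>R. s < f x}"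
    by (simp add: decseq_def)
  then have 1: "measure M {x\<in>R. s < f x} \<le> \<gamma> * ?m"
    by (rule LIMSEQ_le_const2) (auto intro!: up)
  have "(\<Inter>k. {x\<in>R. s - inverse (real (Suc k)) < f x}) = {x\<in>R. s \<le> f x}"
  proof (intro equalityI subsetI)
    fix x assume x: "x \<in> (\<Inter>k. {x\<in>R. s - inverse (real (Suc k)) < f x})"
    have "s \<le> f x"
    proof (rule ccontr)
      assume "\<not> s \<le> f x"
      then obtain k where "inverse (real (Suc k)) < s - f x" using reals_Archimedean[of "s - f x"] by auto
      moreover have "s - inverse (real (Suc k)) < f x" using x by blast
      ultimately show False by linarith
    qed
    then show "x \<in> {x\<in>R. s \<le> f x}" using x by blast
  next
    fix x assume x: "x \<in> {x\<in>R. s \<le> f x}"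
    have "s - inverse (real (Suc k)) < f x" for k
    proof -
      have "0 < inverse (real (Suc k))" by simp
      then show ?thesis using x by (simp only: mem_Collect_eq) linarith
    qed
    then show "x \<in> (\<Inter>k. {x\<in>R. s - inverse (real (Suc k)) < f x})" using x by blast
  qed
  with lim_dec[of "\<lambda>k. s - inverse (real (Suc k))"] dec
  have "(\<lambda>k. measure M {x\<in>R. s - inverse (real (Suc k)) < f x}) \<longlonglongrightarrow> measure M {x\<in>R. s \<le> f x}"
    by (simp add: decseq_def incseq_def)
  then have 2: "\<gamma> * ?m \<le> measure M {x\<in>R. s \<le> f x}"
    by (rule LIMSEQ_le_const) (auto intro!: down)
  from 1 2 show ?thesis by blast
qed

section \<open>Quantiles along the dyadic tree\<close>

text \<open>This is the lower end of the band of levels assigned to a cube; the quantile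
  \<open>s p\<close> of the cube itself enters only for its children.\<close>

fun running_max :: "real \<Rightarrow> ('b list \<Rightarrow> real) \<Rightarrow> 'b list \<Rightarrow> real" where
  "running_max c s [] = c"
| "running_max c s (S # p) = max (running_max c s p) (s p)"

definition jump :: "real \<Rightarrow> ('b list \<Rightarrow> real) \<Rightarrow> 'b list \<Rightarrow> real" where
  "jump c s p = max 0 (s p - running_max c s p)"

lemma jump_nonneg: "0 \<le> jump c s p"
  by (simp add: jump_def)

lemma running_max_append_ge: "us \<noteq> [] \<Longrightarrow> s p \<le> running_max c s (us @ p)"
proof (induction us)
  case (Cons S us)
  then show ?case by (cases us) auto
qed simp

text \<open>Telescoping: including the quantile of p raises the running maximum by exactly
  \<open>jump c s p\<close>. The lists \<open>drop k p\<close> are p and all its ancestors.\<close>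

lemma sum_jumps: "max (running_max c s p) (s p) - c = (\<Sum>k\<le>length p. jump c s (drop k p))"
proof (induction p)
  case Nil
  then show ?case by (simp add: jump_def)
next
  case (Cons S p)
  have "(\<Sum>k\<le>length (S # p). jump c s (drop k (S # p))) = jump c s (S # p) + (\<Sum>k\<le>length p. jump c s (drop k p))"
    by (simp only: list.size add_Suc_right add_0_right sum.atMost_Suc_shift drop_0 drop_Suc_Cons)
  then show ?case using Cons by (simp add: jump_def)
qed

lemma sum_le_nn_integral_count_space:
  fixes h :: "'b \<Rightarrow> ennreal"
  assumes "finite F"
  shows "(\<Sum>q\<in>F. h q) \<le> (\<integral>\<^sup>+q. h q \<partial>count_space UNIV)"
proof -
  have "(\<Sum>q\<in>F. h q) = (\<integral>\<^sup>+q. h q * indicator F q \<partial>count_space UNIV)"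
    using assms by (simp add: nn_integral_count_space_indicator[symmetric] nn_integral_count_space_finite)
  also have "\<dots> \<le> (\<integral>\<^sup>+q. h q \<partial>count_space UNIV)"
    by (intro nn_integral_mono) (auto simp: indicator_def)
  finally show ?thesis .
qed

text \<open>The ancestors of p, with p included, have distinct addresses and cubes that contain x,
  so the telescoping sum is part of the sum over all q.\<close>

lemma jumps_along_branch:
  fixes a :: "real ^ 'n"
  assumes l: "0 < l" and x: "x \<in> dyadic_cube a l p"
  shows "ennreal (s p - c) \<le> (\<integral>\<^sup>+q. ennreal (jump c s q) * indicator (dyadic_cube a l q) x \<partial>count_space UNIV)"
proof -
  let ?F = "(\<lambda>k. drop k p) ` {..length p}"
  have inj: "inj_on (\<lambda>k. drop k p) {..length p}"
  proof (rule inj_onI)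
    fix j k assume "j \<in> {..length p}" "k \<in> {..length p}" "drop j p = drop k p"
    then have "length p - j = length p - k" "j \<le> length p" "k \<le> length p" by (metis length_drop, auto)
    then show "j = k" by simp
  qed
  have "s p - c \<le> (\<Sum>k\<le>length p. jump c s (drop k p))"
    using sum_jumps[of c s p] by linarith
  then have "ennreal (s p - c) \<le> ennreal (\<Sum>k\<le>length p. jump c s (drop k p))"
    by (rule ennreal_leI)
  also have "\<dots> = (\<Sum>k\<le>length p. ennreal (jump c s (drop k p)))"
    by (simp add: sum_ennreal jump_nonneg)
  also have "\<dots> = (\<Sum>q\<in>?F. ennreal (jump c s q))"
    by (subst sum.reindex[OF inj]) (simp add: o_def)
  also have "\<dots> = (\<Sum>q\<in>?F. ennreal (jump c s q) * indicator (dyadic_cube a l q) x)"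
  proof (intro sum.cong refl)
    fix q assume "q \<in> ?F"
    then have "x \<in> dyadic_cube a l q" using dyadic_cube_drop_subset[OF l, of a p] x by blast
    then show "ennreal (jump c s q) = ennreal (jump c s q) * indicator (dyadic_cube a l q) x" by simp
  qed
  also have "\<dots> \<le> (\<integral>\<^sup>+q. ennreal (jump c s q) * indicator (dyadic_cube a l q) x \<partial>count_space UNIV)"
    by (rule sum_le_nn_integral_count_space) simp
  finally show ?thesis .
qed

text \<open>The cubes containing a separated point form a single branch. On it the band of p ends at
  \<open>s p\<close>, and the bands of all proper descendants start at or above \<open>s p\<close>,
  so t lies in at most one of them.\<close>

lemma jump_intervals_overlap:
  fixes a :: "real ^ 'n"
  assumes l: "0 < l" and x: "dyadic_separated a l x"
  shows "(\<integral>\<^sup>+p. indicator (dyadic_cube a l p) x * indicator {running_max c s p<..<s p} t \<partial>count_space UNIV) \<le> (1 :: ennreal)"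
proof -
  define P where "P p \<longleftrightarrow> x \<in> dyadic_cube a l p \<and> t \<in> {running_max c s p<..<s p}" for p
  have le: "p = q" if p: "P p" and q: "P q" and len: "length p \<le> length q" for p q
  proof -
    \<comment> \<open>The ancestor of q in the generation of p contains x, so it is p.\<close>
    define us where "us = take (length q - length p) q"
    define q' where "q' = drop (length q - length p) q"
    have q_eq: "q = us @ q'" by (simp add: us_def q'_def)
    have "x \<in> dyadic_cube a l q'"
      using dyadic_cube_drop_subset[OF l] q by (auto simp: P_def q'_def)
    then have "q' = p"
      using dyadic_cube_unique[OF l x, of q' p] p len by (simp add: P_def q'_def)
    then have q_eq: "q = us @ p" using q_eq by simp
    have "\<not> s p \<le> running_max c s q"
      using p q by (auto simp: P_def)
    then have "us = []"
      unfolding q_eq using running_max_append_ge[of us s p c] by blast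
    then show "p = q" by (simp add: q_eq)
  qed
  have uniq: "p = q" if "P p" "P q" for p q
    using that le[of p q] le[of q p] by (metis nat_le_linear)
  show ?thesis
  proof (cases "\<exists>p. P p")
    case True
    then obtain p where p: "P p" by blast
    have "(\<integral>\<^sup>+q. indicator (dyadic_cube a l q) x * indicator {running_max c s q<..<s q} t \<partial>count_space UNIV)
        \<le> (\<integral>\<^sup>+q. indicator {p} q \<partial>count_space UNIV :: ennreal)"
    proof (intro nn_integral_mono)
      fix q
      show "indicator (dyadic_cube a l q) x * indicator {running_max c s q<..<s q} t \<le> (indicator {p} q :: ennreal)"
      proof (cases "P q")
        case True
        then have "q = p" using uniq p by blast
        then show ?thesis by (simp add: indicator_def)
      next
        case False
        then show ?thesis by (auto simp: P_def indicator_def)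
      qed
    qed
    also have "\<dots> = 1" by simp
    finally show ?thesis .
  next
    case False
    then have zero: "indicator (dyadic_cube a l q) x * indicator {running_max c s q<..<s q} t = (0 :: ennreal)" for q
      by (auto simp: P_def indicator_def)
    show ?thesis unfolding zero by simp
  qed
qed

text \<open>With \<open>\<gamma> = 2^-(n+1)\<close>, a level exceeded on at most the fraction \<open>\<gamma>\<close> of a cube is
  exceeded on at most half of each of its children.\<close>

locale dyadic_quantiles = weak_deriv f g
  for f :: "real ^ 'n \<Rightarrow> real" and g +
  fixes a :: "real ^ 'n" and l \<gamma> :: real and s :: "'n set list \<Rightarrow> real"
  assumes l: "0 < l" and \<gamma>_def: "\<gamma> = 1 / 2 ^ Suc CARD('n)"
    and quantile_le: "\<gamma> * measure lborel (dyadic_cube a l p) \<le> measure lborel {x\<in>dyadic_cube a l p. s p \<le> f x}"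
    and quantile_ge: "measure lborel {x\<in>dyadic_cube a l p. s p < f x} \<le> \<gamma> * measure lborel (dyadic_cube a l p)"
begin

abbreviation D where "D \<equiv> dyadic_cube a l"

definition mean :: real where "mean = (\<integral>y. f y * indicator (cube a l) y \<partial>lborel) / l ^ CARD('n)"

definition side :: "'n set list \<Rightarrow> real" where "side p = l / 2 ^ length p"

lemma side_pos: "0 < side p"
  using l by (simp add: side_def)

lemma measure_D: "measure lborel (D p) = side p ^ CARD('n)"
  using l by (simp add: measure_def emeasure_dyadic_cube side_def)

lemma emeasure_D_fin: "emeasure lborel (D p) < \<infinity>"
  using l by (simp add: emeasure_dyadic_cube)

lemma emeasure_sub_D: "S \<in> sets borel \<Longrightarrow> S \<subseteq> D p \<Longrightarrow> emeasure lborel S = ennreal (measure lborel S)"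
  using emeasure_mono[of S "D p" lborel] emeasure_D_fin[of p]
  by (intro emeasure_eq_ennreal_measure) (auto simp: top_unique)

lemma measure_mono_D: "S \<in> sets borel \<Longrightarrow> T \<in> sets borel \<Longrightarrow> S \<subseteq> T \<Longrightarrow> T \<subseteq> D p \<Longrightarrow> measure lborel S \<le> measure lborel T"
  using emeasure_mono[of T "D p" lborel] emeasure_D_fin[of p]
  by (intro measure_mono_fmeasurable) (auto simp: fmeasurable_def intro: le_less_trans)

lemma \<gamma>: "0 < \<gamma>" "\<gamma> < 1"
proof -
  have "(1::real) \<le> 2 ^ CARD('n)" by simp
  then have "(1::real) < 2 ^ Suc CARD('n)" unfolding power_Suc by linarith
  then show "0 < \<gamma>" "\<gamma> < 1" by (simp_all add: \<gamma>_def)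
qed

section \<open>The cost of single jumps and of all jumps together\<close>

lemma power_card_eq: "x ^ CARD('n) = x * x ^ (CARD('n) - 1)" for x :: real
  by (simp add: power_eq_if)

text \<open>This is the level Poincare inequality for the band from a' to b'. The set {f \<ge> b'}
  has measure at least \<gamma> r^n since b' is a quantile of the cube, and {f \<le> a'} fills at
  least half of it since a' is at least the quantile of the parent, whose side is 2 r. Dividing by
  r^(n+1) leaves the constant n 2^n (2 / \<gamma>) = n 4^(n+1).\<close>

lemma jump_bound_child:
  "ennreal (jump mean s (S # p) * side (S # p) ^ (CARD('n) - 1)) \<le> ennreal (CARD('n) * 4 ^ Suc CARD('n)) *
     (\<integral>\<^sup>+y. ennreal (norm (g y)) * indicator {running_max mean s (S # p)<..<s (S # p)} (f y) * indicator (D (S # p)) y \<partial>lborel)"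
    (is "_ \<le> _ * ?I")
proof (cases "?I = \<infinity> \<or> jump mean s (S # p) = 0")
  case True
  then show ?thesis by (auto simp: ennreal_mult_eq_top_iff)
next
  case False
  define a' where "a' = running_max mean s (S # p)"
  define b' where "b' = s (S # p)"
  define r where "r = side (S # p)"
  define n where "n = CARD('n)"
  have r: "0 < r" using side_pos by (simp add: r_def)
  have ab: "a' < b'" and j: "jump mean s (S # p) = b' - a'"
    using False by (auto simp: jump_def a'_def b'_def max_def split: if_splits)
  obtain i where i: "?I = ennreal i" "0 \<le> i" using False by (cases ?I) auto
  define mA where "mA = measure lborel {x\<in>D (S # p). f x \<le> a'}"
  define mB where "mB = measure lborel {x\<in>D (S # p). b' \<le> f x}"
  have B: "\<gamma> * r ^ n \<le> mB"
    using quantile_le[of "S # p"] by (simp add: mB_def b'_def measure_D r_def n_def)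
  have "measure lborel {x\<in>D (S # p). a' < f x} \<le> measure lborel {x\<in>D p. s p < f x}"
  proof (rule measure_mono_D[of _ _ p])
    have "s p \<le> a'" by (simp add: a'_def)
    then show "{x\<in>D (S # p). a' < f x} \<subseteq> {x\<in>D p. s p < f x}"
      using dyadic_cube_Cons_subset[OF l, of a S p] by auto
  qed auto
  also have "\<dots> \<le> \<gamma> * (2 * r) ^ n"
    using quantile_ge[of p] by (simp add: measure_D r_def side_def n_def)
  also have "\<dots> = r ^ n / 2"
    by (simp add: \<gamma>_def n_def power_mult_distrib)
  finally have "measure lborel {x\<in>D (S # p). a' < f x} \<le> r ^ n / 2" .
  moreover have "mA = measure lborel (D (S # p)) - measure lborel {x\<in>D (S # p). a' < f x}"
  proof -
    have "{x\<in>D (S # p). f x \<le> a'} = D (S # p) - {x\<in>D (S # p). a' < f x}" by auto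
    then show ?thesis
      using emeasure_D_fin[of "S # p"] unfolding mA_def by (simp add: measure_Diff)
  qed
  ultimately have A: "r ^ n / 2 \<le> mA" by (simp add: measure_D r_def n_def)
  have "ennreal (b' - a') * emeasure lborel {x\<in>D (S # p). f x \<le> a'} * emeasure lborel {x\<in>D (S # p). b' \<le> f x}
      \<le> ennreal (n * r * (2 * r) ^ n) * ?I"
    using level_poincare[of r a' b' "dyadic_corner a l (S # p)"] r ab
    by (simp add: dyadic_cube_def r_def side_def a'_def b'_def n_def indicator_def)
  then have "ennreal ((b' - a') * mA * mB) \<le> ennreal (n * r * (2 * r) ^ n * i)"
    using ab r i by (simp add: emeasure_sub_D[of _ "S # p"] mA_def mB_def ennreal_mult')
  then have le: "(b' - a') * mA * mB \<le> n * r * (2 * r) ^ n * i"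
    using i r by (subst (asm) ennreal_le_iff) auto
  have mAB: "0 \<le> mA" "0 \<le> mB" by (simp_all add: mA_def mB_def)
  have P: "r ^ n = r * r ^ (n - 1)" unfolding n_def by (rule power_card_eq)
  have "((b' - a') * r ^ (n - 1)) * (\<gamma> / 2) * (r ^ n * r) = (b' - a') * (r ^ n / 2) * (\<gamma> * r ^ n)"
    by (subst (3) P) (simp add: mult_ac)
  also have "\<dots> \<le> (b' - a') * mA * mB"
    using ab A B r \<gamma> mAB by (intro mult_mono mult_left_mono) simp_all
  also note le
  also have "n * r * (2 * r) ^ n * i = (n * 2 ^ n * i) * (r ^ n * r)"
    by (simp add: power_mult_distrib mult_ac)
  finally have "((b' - a') * r ^ (n - 1)) * (\<gamma> / 2) * (r ^ n * r) \<le> (n * 2 ^ n * i) * (r ^ n * r)" .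
  then have "((b' - a') * r ^ (n - 1)) * (\<gamma> / 2) \<le> n * 2 ^ n * i"
    using r by (subst (asm) mult_le_cancel_right_pos) auto
  then have "(b' - a') * r ^ (n - 1) \<le> n * 2 ^ n * i * (2 / \<gamma>)"
    using \<gamma> by (simp add: field_simps)
  also have "\<dots> = n * 4 ^ Suc n * i"
  proof -
    have "(4::real) ^ n = 2 ^ n * 2 ^ n" by (simp add: power_mult_distrib[symmetric])
    then show ?thesis by (simp add: \<gamma>_def n_def)
  qed
  finally show ?thesis
    unfolding i(1) using i(2) j by (simp add: n_def r_def ennreal_mult'[symmetric] ennreal_leI)
qed

text \<open>Nothing bounds the measure of {f \<le> mean} from below, so Chebyshev's inequality for
  {f \<ge> \<open>s []\<close>} is combined with the Poincare inequality on the whole cube, and the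
  gradient is not restricted to a band. The resulting constant 2 n 4^n is enlarged to the one for
  the other cubes.\<close>

lemma jump_bound_root:
  "ennreal (jump mean s [] * side [] ^ (CARD('n) - 1)) \<le> ennreal (CARD('n) * 4 ^ Suc CARD('n)) *
     (\<integral>\<^sup>+y. ennreal (norm (g y)) * indicator (D []) y \<partial>lborel)"
    (is "_ \<le> _ * ?I")
proof (cases "?I = \<infinity> \<or> jump mean s [] = 0")
  case True
  then show ?thesis by (auto simp: ennreal_mult_eq_top_iff)
next
  case False
  define n where "n = CARD('n)"
  have j: "jump mean s [] = s [] - mean" "mean < s []"
    using False by (auto simp: jump_def max_def split: if_splits)
  obtain i where i: "?I = ennreal i" "0 \<le> i" using False by (cases ?I) auto
  define mB where "mB = measure lborel {x\<in>cube a l. s [] \<le> f x}"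
  have B: "\<gamma> * l ^ n \<le> mB"
    using quantile_le[of "[]"] measure_D[of "[]"] by (simp add: mB_def side_def n_def dyadic_cube_Nil)
  have em: "emeasure lborel {x\<in>cube a l. s [] \<le> f x} = ennreal mB"
    unfolding mB_def by (rule emeasure_sub_D[of _ "[]"]) (auto simp: dyadic_cube_Nil)
  have "ennreal ((s [] - mean) * mB) = ennreal (s [] - mean) * emeasure lborel {x\<in>cube a l. s [] \<le> f x}"
    using j by (simp add: em ennreal_mult')
  also have "\<dots> = (\<integral>\<^sup>+x. ennreal (s [] - mean) * indicator {x\<in>cube a l. s [] \<le> f x} x \<partial>lborel)"
    by (simp add: nn_integral_cmult_indicator)
  also have "\<dots> \<le> (\<integral>\<^sup>+x. ennreal \<bar>f x - mean\<bar> * indicator (cube a l) x \<partial>lborel)"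
    by (intro nn_integral_mono) (auto simp: indicator_def intro!: ennreal_leI)
  also have "\<dots> \<le> ennreal (n * l * 2 ^ n) * ?I"
    using poincare[OF l, of a] by (simp add: mean_def n_def dyadic_cube_Nil)
  also have "\<dots> = ennreal (n * l * 2 ^ n * i)"
    using i l by (simp add: ennreal_mult')
  finally have le: "(s [] - mean) * mB \<le> n * l * 2 ^ n * i"
    using i l by (subst (asm) ennreal_le_iff) auto
  have P: "l ^ n = l * l ^ (n - 1)" unfolding n_def by (rule power_card_eq)
  have "((s [] - mean) * l ^ (n - 1) * \<gamma>) * l = (s [] - mean) * (\<gamma> * l ^ n)"
    by (subst P) (simp add: mult_ac)
  also have "\<dots> \<le> (s [] - mean) * mB"
    using j B by (intro mult_left_mono) auto
  also note le
  also have "n * l * 2 ^ n * i = (n * 2 ^ n * i) * l" by (simp add: mult_ac)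
  finally have "((s [] - mean) * l ^ (n - 1) * \<gamma>) * l \<le> (n * 2 ^ n * i) * l" .
  then have "(s [] - mean) * l ^ (n - 1) * \<gamma> \<le> n * 2 ^ n * i"
    using l by (subst (asm) mult_le_cancel_right_pos) auto
  then have "(s [] - mean) * l ^ (n - 1) \<le> n * 2 ^ n * i * (1 / \<gamma>)"
    using \<gamma> by (simp add: field_simps)
  also have "\<dots> = n * (2 * 4 ^ n) * i"
  proof -
    have "(4::real) ^ n = 2 ^ n * 2 ^ n" by (simp add: power_mult_distrib[symmetric])
    then show ?thesis by (simp add: \<gamma>_def n_def)
  qed
  also have "\<dots> \<le> n * 4 ^ Suc n * i"
    using i by (intro mult_right_mono mult_left_mono) auto
  finally show ?thesis
    unfolding i(1) using i(2) j by (simp add: n_def side_def ennreal_mult'[symmetric] ennreal_leI)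
qed

text \<open>In the application \<kappa> p is \<mu>(D p)^(1/q) and W is the maximal function to the
  power 1/q. Each term is split into jump * side^(n-1), paid by the gradient, and \<kappa> /
  side^(n-1), absorbed into W under the integral. After exchanging sum and integral the overlap is
  at most 2: one from the root, charged on its whole cube, and one from the disjoint bands.\<close>

lemma sum_jumps_bound:
  fixes \<kappa> :: "'n set list \<Rightarrow> real" and W :: "real ^ 'n \<Rightarrow> ennreal"
  assumes [measurable]: "W \<in> borel_measurable borel"
    and \<kappa>: "\<And>p. 0 \<le> \<kappa> p"
    and W: "\<And>p y. y \<in> D p \<Longrightarrow> ennreal (\<kappa> p / side p ^ (CARD('n) - 1)) \<le> W y"
  shows "(\<integral>\<^sup>+p. ennreal (jump mean s p * \<kappa> p) \<partial>count_space UNIV) \<le>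
    ennreal (2 * (CARD('n) * 4 ^ Suc CARD('n))) * (\<integral>\<^sup>+y. ennreal (norm (g y)) * W y * indicator (cube a l) y \<partial>lborel)"
proof -
  let ?C = "ennreal (CARD('n) * 4 ^ Suc CARD('n))"
  define \<theta> :: "'n set list \<Rightarrow> real ^ 'n \<Rightarrow> ennreal" where
    "\<theta> p y = (if p = [] then 1 else indicator {running_max mean s p<..<s p} (f y)) * indicator (D p) y" for p y
  have [measurable]: "\<theta> p \<in> borel_measurable borel" for p
    unfolding \<theta>_def by measurable
  have single: "ennreal (jump mean s p * \<kappa> p) \<le> (\<integral>\<^sup>+y. ?C * (ennreal (norm (g y)) * W y) * \<theta> p y \<partial>lborel)" for p
  proof -
    let ?d = "side p ^ (CARD('n) - 1)"
    have d: "0 < ?d" using side_pos by simp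
    have "ennreal (jump mean s p * \<kappa> p) = ennreal (jump mean s p * ?d) * ennreal (\<kappa> p / ?d)"
      using d \<kappa>[of p] jump_nonneg[of mean s p] side_pos[of p] by (simp add: ennreal_mult[symmetric])
    also have "ennreal (jump mean s p * ?d) \<le> ?C * (\<integral>\<^sup>+y. ennreal (norm (g y)) * \<theta> p y \<partial>lborel)"
      using jump_bound_root jump_bound_child by (cases p) (simp_all add: \<theta>_def mult_ac)
    also have "?C * (\<integral>\<^sup>+y. ennreal (norm (g y)) * \<theta> p y \<partial>lborel) * ennreal (\<kappa> p / ?d)
        = (\<integral>\<^sup>+y. ?C * (ennreal (norm (g y)) * ennreal (\<kappa> p / ?d)) * \<theta> p y \<partial>lborel)"
      by (simp add: nn_integral_cmult[symmetric] nn_integral_multc[symmetric] mult_ac)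
    also have "\<dots> \<le> (\<integral>\<^sup>+y. ?C * (ennreal (norm (g y)) * W y) * \<theta> p y \<partial>lborel)"
    proof (intro nn_integral_mono)
      fix y
      show "?C * (ennreal (norm (g y)) * ennreal (\<kappa> p / ?d)) * \<theta> p y \<le> ?C * (ennreal (norm (g y)) * W y) * \<theta> p y"
      proof (cases "y \<in> D p")
        case True
        then show ?thesis by (intro mult_right_mono mult_left_mono W) auto
      qed (simp add: \<theta>_def)
    qed
    finally show ?thesis by (simp add: mult_right_mono)
  qed
  have "(\<integral>\<^sup>+p. ennreal (jump mean s p * \<kappa> p) \<partial>count_space UNIV)
      \<le> (\<integral>\<^sup>+p. \<integral>\<^sup>+y. ?C * (ennreal (norm (g y)) * W y) * \<theta> p y \<partial>lborel \<partial>count_space UNIV)"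
    by (intro nn_integral_mono single)
  also have "\<dots> = (\<integral>\<^sup>+y. \<integral>\<^sup>+p. ?C * (ennreal (norm (g y)) * W y) * \<theta> p y \<partial>count_space UNIV \<partial>lborel)"
    by (rule nn_integral_count_space_nn_integral[symmetric]) auto
  also have "\<dots> \<le> (\<integral>\<^sup>+y. ?C * (ennreal (norm (g y)) * W y) * (2 * indicator (cube a l) y) \<partial>lborel)"
  proof (rule nn_integral_mono_AE)
    show "AE y in lborel. (\<integral>\<^sup>+p. ?C * (ennreal (norm (g y)) * W y) * \<theta> p y \<partial>count_space UNIV)
        \<le> ?C * (ennreal (norm (g y)) * W y) * (2 * indicator (cube a l) y)"
      using AE_dyadic_separated[of a l]
    proof eventually_elim
      case (elim y)
      have "(\<integral>\<^sup>+p. \<theta> p y \<partial>count_space UNIV) \<le> 2 * indicator (cube a l) y"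
      proof (cases "y \<in> cube a l")
        case True
        have "(\<integral>\<^sup>+p. \<theta> p y \<partial>count_space UNIV) \<le>
            (\<integral>\<^sup>+p. indicator {[]} p + indicator (D p) y * indicator {running_max mean s p<..<s p} (f y) \<partial>count_space UNIV)"
          by (intro nn_integral_mono) (auto simp: \<theta>_def indicator_def)
        also have "\<dots> = 1 + (\<integral>\<^sup>+p. indicator (D p) y * indicator {running_max mean s p<..<s p} (f y) \<partial>count_space UNIV)"
          by (subst nn_integral_add) auto
        also have "\<dots> \<le> 1 + 1"
          by (intro add_left_mono jump_intervals_overlap[OF l elim])
        finally show ?thesis using True by simp
      next
        case False
        then have "y \<notin> D p" for p using dyadic_cube_subset[OF l, of a p] by blast
        then have "\<theta> p y = 0" for p by (simp add: \<theta>_def)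
        then show ?thesis by simp
      qed
      then show ?case
        by (subst nn_integral_cmult) (auto intro: mult_left_mono)
    qed
  qed
  also have "\<dots> = ?C * 2 * (\<integral>\<^sup>+y. ennreal (norm (g y)) * W y * indicator (cube a l) y \<partial>lborel)"
    by (subst nn_integral_cmult[symmetric]) (auto simp: mult_ac)
  also have "?C * 2 = ennreal (2 * (CARD('n) * 4 ^ Suc CARD('n)))"
    by (simp only: of_nat_mult[of 2] of_nat_numeral ennreal_mult'[OF zero_le_numeral] ennreal_numeral mult.commute)
  finally show ?thesis .
qed

text \<open>Each level below f x is exceeded by the quantile of some cube containing x, so the jumps
  along the branch add up to more than its distance from the mean; the supremum over such levels
  gives the claim.\<close>

lemma pointwise_bound:
  assumes "\<And>t. t < f x \<Longrightarrow> \<exists>p. x \<in> D p \<and> t < s p"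
  shows "ennreal (f x - mean) \<le> (\<integral>\<^sup>+q. ennreal (jump mean s q) * indicator (D q) x \<partial>count_space UNIV)"
proof (rule dense_le)
  fix z assume z: "z < ennreal (f x - mean)"
  then obtain r where r: "z = ennreal r" "0 \<le> r" by (cases z) auto
  then have "r < f x - mean" using z by (simp add: ennreal_less_iff)
  then obtain p where p: "x \<in> D p" "mean + r < s p" using assms[of "mean + r"] by auto
  have "z \<le> ennreal (s p - mean)" unfolding r(1) using p by (intro ennreal_leI) simp
  also have "\<dots> \<le> (\<integral>\<^sup>+q. ennreal (jump mean s q) * indicator (D q) x \<partial>count_space UNIV)"
    by (rule jumps_along_branch[OF l p(1)])
  finally show "z \<le> \<dots>" .
qed

lemma quantile_gt:
  assumes "\<gamma> * measure lborel (D p) < measure lborel {x\<in>D p. t < f x}"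
  shows "t < s p"
proof (rule ccontr)
  assume "\<not> t < s p"
  then have "measure lborel {x\<in>D p. t < f x} \<le> measure lborel {x\<in>D p. s p < f x}"
    by (intro measure_mono_D[of _ _ p]) auto
  then show False using quantile_ge[of p] assms by linarith
qed

text \<open>Density is applied at rational levels only, so that one null set serves all real
  t.\<close>

lemma AE_quantile_gt:
  "AE x in lborel. x \<in> cube a l \<longrightarrow> (\<forall>t. t < f x \<longrightarrow> (\<exists>p. x \<in> D p \<and> t < s p))"
proof -
  have "AE x in lborel. \<forall>q :: rat. x \<in> cube a l \<longrightarrow> x \<in> {x. of_rat q < f x} \<longrightarrow> (\<exists>p. x \<in> D p \<and>
      ennreal \<gamma> * emeasure lborel (D p) < emeasure lborel (D p \<inter> {x. of_rat q < f x}))"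
    unfolding AE_all_countable using \<gamma> by (intro allI dyadic_density l) auto
  then show ?thesis
  proof eventually_elim
    case (elim x)
    show ?case
    proof (intro impI allI)
      fix t assume x: "x \<in> cube a l" and "t < f x"
      then obtain q :: rat where q: "t < of_rat q" "of_rat q < f x" using of_rat_dense by blast
      then obtain p where p: "x \<in> D p" "ennreal \<gamma> * emeasure lborel (D p) < emeasure lborel (D p \<inter> {x. of_rat q < f x})"
        using elim x by blast
      have "ennreal (\<gamma> * measure lborel (D p)) < ennreal (measure lborel {x\<in>D p. of_rat q < f x})"
        using p(2) \<gamma> by (simp add: emeasure_sub_D[of _ p] ennreal_mult' Int_def)
      then have "of_rat q < s p"
        using \<gamma> by (intro quantile_gt) (simp add: ennreal_less_iff)
      then show "\<exists>p. x \<in> D p \<and> t < s p" using p q by (meson less_trans)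
    qed
  qed
qed

text \<open>On a small cube around x all values exceed t, and 1 > \<gamma>. This holds at every
  point of the cube without an exceptional set, as a measure with a singular part requires.\<close>

lemma continuous_quantile_gt:
  assumes f: "continuous_on UNIV f" and x: "x \<in> cube a l" and t: "t < f x"
  shows "\<exists>p. x \<in> D p \<and> t < s p"
proof -
  have "open {y. t < f y}" by (rule open_Collect_less) (auto intro: f)
  then obtain p where p: "x \<in> D p" "D p \<subseteq> {y. t < f y}"
    using dyadic_cube_small[OF l x, of "{y. t < f y}"] t by blast
  then have "{y\<in>D p. t < f y} = D p" by blast
  then have "t < s p"
    using \<gamma> side_pos[of p] by (intro quantile_gt) (simp add: measure_D)
  then show ?thesis using p by blast
qed

end

lemma (in weak_deriv) ex_dyadic_quantiles:
  fixes a :: "real ^ 'n" and l :: real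
  assumes l: "0 < l"
  shows "\<exists>s. dyadic_quantiles f g a l (1 / 2 ^ Suc CARD('n)) s"
proof -
  let ?\<gamma> = "1 / 2 ^ Suc CARD('n) :: real"
  have "\<exists>s. ?\<gamma> * measure lborel (dyadic_cube a l p) \<le> measure lborel {x\<in>dyadic_cube a l p. s \<le> f x} \<and>
      measure lborel {x\<in>dyadic_cube a l p. s < f x} \<le> ?\<gamma> * measure lborel (dyadic_cube a l p)" for p
  proof (rule ex_upper_quantile)
    show "emeasure lborel (dyadic_cube a l p) < \<infinity>" "0 < measure lborel (dyadic_cube a l p)"
      using l by (simp_all add: emeasure_dyadic_cube measure_def)
    have "(1::real) \<le> 2 ^ CARD('n)" by simp
    then have "(1::real) < 2 ^ Suc CARD('n)" unfolding power_Suc by linarith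
    then show "?\<gamma> < 1" by simp
  qed auto
  then have "\<forall>p. \<exists>s. ?\<gamma> * measure lborel (dyadic_cube a l p) \<le> measure lborel {x\<in>dyadic_cube a l p. s \<le> f x} \<and>
      measure lborel {x\<in>dyadic_cube a l p. s < f x} \<le> ?\<gamma> * measure lborel (dyadic_cube a l p)" by blast
  from choice[OF this] obtain s where "\<And>p. ?\<gamma> * measure lborel (dyadic_cube a l p) \<le> measure lborel {x\<in>dyadic_cube a l p. s p \<le> f x} \<and>
      measure lborel {x\<in>dyadic_cube a l p. s p < f x} \<le> ?\<gamma> * measure lborel (dyadic_cube a l p)" by blast
  then have "dyadic_quantiles f g a l ?\<gamma> s"
    using l by unfold_locales auto
  then show ?thesis by blast
qed

section \<open>The weighted inequality\<close>

text \<open>The tangent line of y^q at y = H lies below the graph; the inequality is derived here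
  from Young's inequality with weights 1 / q and 1 - 1 / q.\<close>

lemma powr_tangent_bound:
  fixes q y H :: real
  assumes q: "1 \<le> q" and y: "0 \<le> y" and H: "0 < H"
  shows "q * H powr (q - 1) * y \<le> y powr q + (q - 1) * H powr q"
proof (cases "y = 0")
  case True
  then show ?thesis using q by simp
next
  case False
  have e: "q * (1 - 1 / q) = q - 1" using q by (simp add: field_simps)
  have "(y powr q) powr (1 / q) * (H powr q) powr (1 - 1 / q) \<le> 1 / q * y powr q + (1 - 1 / q) * H powr q"
    using q y H False by (intro Youngs_inequality_0) auto
  also have "(y powr q) powr (1 / q) * (H powr q) powr (1 - 1 / q) = y * H powr (q - 1)"
    using q y False by (simp add: powr_powr e)
  finally have "q * (y * H powr (q - 1)) \<le> q * (1 / q * y powr q + (1 - 1 / q) * H powr q)"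
    using q by (intro mult_left_mono) auto
  also have "\<dots> = y powr q + (q - 1) * H powr q"
    using q e by (simp add: distrib_left mult.assoc[symmetric])
  finally show ?thesis by (simp add: mult_ac)
qed

lemma ennpowr_ennreal: "0 \<le> x \<Longrightarrow> ennpowr (ennreal x) p = ennreal (x powr p)"
  by (simp add: ennpowr_def)

lemma ennpowr_mono:
  assumes "x \<le> y" "0 \<le> p"
  shows "ennpowr x p \<le> ennpowr y p"
proof (cases "y = \<infinity>")
  case False
  then have "x \<noteq> \<infinity>" using assms(1) by (auto simp: top_unique)
  moreover have "enn2real x \<le> enn2real y"
    using assms(1) False by (intro enn2real_mono) (auto simp: top.not_eq_extremum)
  ultimately show ?thesis using assms(2) by (auto simp: ennpowr_def intro!: ennreal_leI powr_mono2)
qed (simp add: ennpowr_def)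

lemma borel_measurable_ennpowr [measurable]: "(\<lambda>x. ennpowr x p) \<in> borel_measurable borel"
  unfolding ennpowr_def by measurable

text \<open>Jensen's inequality for the weights \<open>w i / \<sigma>\<close>, obtained by summing the tangent line bound.\<close>

lemma weighted_sum_powr_le:
  fixes \<tau> w m :: "'i \<Rightarrow> real" and q H \<sigma> :: real
  assumes q: "1 \<le> q" and H: "0 \<le> H" and \<sigma>: "0 < \<sigma>"
    and \<tau>: "\<And>i. 0 \<le> \<tau> i" and m: "\<And>i. i \<in> I \<Longrightarrow> 0 < m i" "\<And>i. 0 \<le> m i"
    and w: "\<And>i. w i = \<tau> i * m i powr (1 / q)"
    and sum_w: "(\<integral>\<^sup>+i. ennreal (w i) \<partial>count_space UNIV) = ennreal \<sigma>"
    and le: "ennreal H \<le> (\<integral>\<^sup>+i. ennreal (\<tau> i) * indicator I i \<partial>count_space UNIV)"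
  shows "ennreal (H powr q) \<le> (\<integral>\<^sup>+i. ennreal (\<sigma> powr (q - 1) * (w i / m i)) * indicator I i \<partial>count_space UNIV)"
    (is "_ \<le> ?X")
proof (cases "H = 0 \<or> ?X = \<infinity>")
  case True
  then show ?thesis by auto
next
  case False
  then have H: "0 < H" using H by simp
  obtain X where X: "?X = ennreal X" "0 \<le> X" using False by (cases ?X) auto
  have w0: "0 \<le> w i" for i using \<tau> by (simp add: w)
  \<comment> \<open>The constant term of the tangent line, spread over the indices: the weights w i
    / \<sigma> sum to 1, so these terms add up to (q - 1) H^q.\<close>
  let ?K = "(q - 1) * H powr q / \<sigma>"
  have K: "0 \<le> ?K" using q \<sigma> by simp
  have single: "ennreal (q * H powr (q - 1)) * (ennreal (\<tau> i) * indicator I i) \<le>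
      ennreal (\<sigma> powr (q - 1) * (w i / m i)) * indicator I i + ennreal ?K * ennreal (w i)" for i
  proof (cases "i \<in> I")
    case True
    have mi: "0 < m i" using m(1)[OF True] .
    \<comment> \<open>The value averaged with weight w i / \<sigma>: the product of the two is
      \<tau> i.\<close>
    let ?y = "\<sigma> * m i powr (- (1 / q))"
    have "q * H powr (q - 1) * ?y \<le> ?y powr q + (q - 1) * H powr q"
      using q H \<sigma> by (intro powr_tangent_bound) auto
    then have "w i / \<sigma> * (q * H powr (q - 1) * ?y) \<le> w i / \<sigma> * (?y powr q + (q - 1) * H powr q)"
      using w0 \<sigma> by (intro mult_left_mono) auto
    also have "w i / \<sigma> * (q * H powr (q - 1) * ?y) = q * H powr (q - 1) * \<tau> i"
      using \<sigma> mi by (simp add: w powr_minus field_simps)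
    also have "?y powr q = \<sigma> powr q / m i"
    proof -
      have "(m i powr (- (1 / q))) powr q = m i powr (- 1)"
        unfolding powr_powr using q by simp
      then show ?thesis using \<sigma> mi by (simp add: powr_mult powr_minus divide_inverse)
    qed
    also have "w i / \<sigma> * (\<sigma> powr q / m i + (q - 1) * H powr q) = \<sigma> powr (q - 1) * (w i / m i) + ?K * w i"
      using \<sigma> by (simp add: powr_diff field_simps)
    finally have "ennreal (q * H powr (q - 1) * \<tau> i) \<le> ennreal (\<sigma> powr (q - 1) * (w i / m i) + ?K * w i)"
      by (rule ennreal_leI)
    also have "\<dots> = ennreal (\<sigma> powr (q - 1) * (w i / m i)) + ennreal (?K * w i)"
      using mult_nonneg_nonneg[OF K w0[of i]] w0[of i] mi by (intro ennreal_plus) simp_all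
    finally show ?thesis
      using True K q \<tau>[of i] w0[of i] by (simp add: ennreal_mult[symmetric])
  qed simp
  have "ennreal (q * H powr q) = ennreal (q * H powr (q - 1)) * ennreal H"
    using q H by (simp add: ennreal_mult[symmetric] powr_mult_base[symmetric] powr_diff)
  also have "\<dots> \<le> ennreal (q * H powr (q - 1)) * (\<integral>\<^sup>+i. ennreal (\<tau> i) * indicator I i \<partial>count_space UNIV)"
    by (intro mult_left_mono le) simp
  also have "\<dots> = (\<integral>\<^sup>+i. ennreal (q * H powr (q - 1)) * (ennreal (\<tau> i) * indicator I i) \<partial>count_space UNIV)"
    by (rule nn_integral_cmult[symmetric]) simp
  also have "\<dots> \<le> (\<integral>\<^sup>+i. ennreal (\<sigma> powr (q - 1) * (w i / m i)) * indicator I i + ennreal ?K * ennreal (w i) \<partial>count_space UNIV)"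
    by (intro nn_integral_mono single)
  also have "\<dots> = ?X + ennreal ?K * ennreal \<sigma>"
    by (subst nn_integral_add) (simp_all add: nn_integral_cmult sum_w)
  also have "\<dots> = ennreal (X + (q - 1) * H powr q)"
  proof -
    have "ennreal ?K * ennreal \<sigma> = ennreal (?K * \<sigma>)"
      using K \<sigma> by (intro ennreal_mult[symmetric]) auto
    also have "?K * \<sigma> = (q - 1) * H powr q" using \<sigma> by simp
    finally show ?thesis unfolding X(1) using X(2) q by (simp add: ennreal_plus)
  qed
  finally have "q * H powr q \<le> X + (q - 1) * H powr q"
    using X(2) q by (subst (asm) ennreal_le_iff) auto
  then have "H powr q \<le> X" by (simp add: algebra_simps)
  then show ?thesis unfolding X(1) by (rule ennreal_leI)
qed

text \<open>The triangle inequality in L^q for a countable sum of multiples of indicators; each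
  summand has norm \<tau> i |R i|^(1/q). Integrating the pointwise Jensen bound gives \<sigma>^(q-1)
  times the sum of the w i, that is, at most \<sigma>^q.\<close>

lemma ennpowr_nn_integral_le_sum:
  fixes \<tau> :: "'i::countable \<Rightarrow> real" and h :: "'a \<Rightarrow> real" and q :: real
  assumes q: "1 \<le> q" and R [measurable]: "\<And>i. R i \<in> sets M" and fin: "\<And>i. emeasure M (R i) < \<infinity>"
    and \<tau>: "\<And>i. 0 \<le> \<tau> i" and h: "\<And>x. 0 \<le> h x"
    and le: "AE x in M. ennreal (h x) \<le> (\<integral>\<^sup>+i. ennreal (\<tau> i) * indicator (R i) x \<partial>count_space UNIV)"
  shows "ennpowr (\<integral>\<^sup>+x. ennreal (h x powr q) \<partial>M) (1 / q) \<le>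
    (\<integral>\<^sup>+i. ennreal (\<tau> i * measure M (R i) powr (1 / q)) \<partial>count_space UNIV)"
    (is "_ \<le> ?S")
proof (cases "?S = \<infinity>")
  case False
  then obtain \<sigma> where \<sigma>: "?S = ennreal \<sigma>" "0 \<le> \<sigma>" by (cases ?S) auto
  define m where "m i = measure M (R i)" for i
  define w where "w i = \<tau> i * m i powr (1 / q)" for i
  have em: "emeasure M (R i) = ennreal (m i)" for i
    using fin[of i] unfolding m_def by (intro emeasure_eq_ennreal_measure) auto
  have m0: "0 \<le> m i" for i by (simp add: m_def)
  have w0: "0 \<le> w i" for i using \<tau> by (simp add: w_def)
  have sum_w: "(\<integral>\<^sup>+i. ennreal (w i) \<partial>count_space UNIV) = ennreal \<sigma>"
    using \<sigma>(1) by (simp add: w_def m_def)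
  \<comment> \<open>Null sets among the R i are discarded first, because the quotients w i / m i are
    meaningful only for m i > 0.\<close>
  have "AE x in M. m i = 0 \<longrightarrow> x \<notin> R i" for i
  proof (cases "m i = 0")
    case True
    then have "R i \<in> null_sets M" using em[of i] by (auto simp: null_sets_def)
    then show ?thesis using AE_not_in by auto
  qed simp
  then have nz: "AE x in M. \<forall>i. m i = 0 \<longrightarrow> x \<notin> R i" by (simp add: AE_all_countable)
  show ?thesis
  \<comment> \<open>The weights w i / \<sigma> require \<sigma> > 0. If \<sigma> = 0, every index
    has \<tau> i = 0 or a null set R i, so h vanishes almost everywhere.\<close>
  proof (cases "\<sigma> = 0")
    case True
    then have "AE i in count_space UNIV. ennreal (w i) = 0"
      using sum_w nn_integral_0_iff_AE[of "\<lambda>i. ennreal (w i)" "count_space UNIV"] by simp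
    then have "ennreal (w i) = 0" for i by (simp add: AE_count_space)
    then have "w i = 0" for i
      using w0 by (simp add: ennreal_eq_0_iff antisym)
    then have wz: "\<tau> i = 0 \<or> m i = 0" for i
      by (simp add: w_def)
    have "AE x in M. h x = 0"
      using le nz
    proof eventually_elim
      case (elim x)
      have zero: "ennreal (\<tau> i) * indicator (R i) x = 0" for i
        using wz[of i] elim(2) by auto
      show ?case using elim(1) h[of x] unfolding zero by simp
    qed
    then have "(\<integral>\<^sup>+x. ennreal (h x powr q) \<partial>M) = (\<integral>\<^sup>+x. 0 \<partial>M)"
      by (intro nn_integral_cong_AE) auto
    then show ?thesis by (simp add: ennpowr_def)
  next
    case False
    then have \<sigma>0: "0 < \<sigma>" using \<sigma> by simp
    let ?z = "\<lambda>i. ennreal (\<sigma> powr (q - 1) * (w i / m i))"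
    have "(\<integral>\<^sup>+x. ennreal (h x powr q) \<partial>M) \<le> (\<integral>\<^sup>+x. \<integral>\<^sup>+i. ?z i * indicator (R i) x \<partial>count_space UNIV \<partial>M)"
    proof (rule nn_integral_mono_AE)
      show "AE x in M. ennreal (h x powr q) \<le> (\<integral>\<^sup>+i. ?z i * indicator (R i) x \<partial>count_space UNIV)"
        using le nz
      proof eventually_elim
        case (elim x)
        have ind: "(indicator (R i) x :: ennreal) = indicator {i. x \<in> R i} i" for i
          by (simp add: indicator_def)
        have mi: "0 < m i" if "i \<in> {i. x \<in> R i}" for i
          using that elim(2) m0[of i] by (auto simp: less_le)
        show ?case
          unfolding ind
          by (rule weighted_sum_powr_le[OF q h \<sigma>0 \<tau> mi m0 w_def sum_w elim(1)[unfolded ind]])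
      qed
    qed
    also have "\<dots> = (\<integral>\<^sup>+i. ?z i * ennreal (m i) \<partial>count_space UNIV)"
      by (subst nn_integral_count_space_nn_integral) (auto simp: nn_integral_cmult em)
    also have "\<dots> \<le> (\<integral>\<^sup>+i. ennreal (\<sigma> powr (q - 1)) * ennreal (w i) \<partial>count_space UNIV)"
    proof (intro nn_integral_mono)
      fix i
      have "\<sigma> powr (q - 1) * (w i / m i) * m i \<le> \<sigma> powr (q - 1) * w i"
        using w0[of i] by (cases "m i = 0") auto
      then show "?z i * ennreal (m i) \<le> ennreal (\<sigma> powr (q - 1)) * ennreal (w i)"
        using w0[of i] m0[of i] by (simp add: ennreal_mult[symmetric] ennreal_leI)
    qed
    also have "\<dots> = ennreal (\<sigma> powr (q - 1)) * ennreal \<sigma>"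
      by (simp add: nn_integral_cmult sum_w)
    also have "\<dots> = ennreal (\<sigma> powr q)"
      using \<sigma>0 by (simp add: ennreal_mult[symmetric] powr_diff)
    finally have "ennpowr (\<integral>\<^sup>+x. ennreal (h x powr q) \<partial>M) (1 / q) \<le> ennpowr (ennreal (\<sigma> powr q)) (1 / q)"
      using q by (intro ennpowr_mono) auto
    also have "\<dots> = ennreal \<sigma>"
      using \<sigma>0 q by (simp add: ennpowr_ennreal powr_powr)
    finally show ?thesis by (simp add: \<sigma>(1))
  qed
qed simp

section \<open>The maximal function and the inequality for Borel representatives\<close>

lemma dyadic_maximal_eq_SUP:
  fixes a :: "real ^ 'n"
  assumes l: "0 < l"
  shows "dyadic_maximal \<alpha> (cube a l) \<mu> x = (SUP p. ennreal ((l / 2 ^ length p) powr \<alpha>) *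
    (emeasure \<mu> (dyadic_cube a l p) / emeasure lborel (dyadic_cube a l p)) * indicator (dyadic_cube a l p) x)"
    (is "_ = (SUP p. ?t p * indicator (?D p) x)")
proof (rule antisym)
  let ?T = "\<lambda>Q'. ennreal (side_length Q' powr \<alpha>) * (emeasure \<mu> Q' / emeasure lborel Q')"
  show "dyadic_maximal \<alpha> (cube a l) \<mu> x \<le> (SUP p. ?t p * indicator (?D p) x)"
    unfolding dyadic_maximal_def dyadic_eq[OF l]
  proof (rule SUP_least)
    fix Q' assume "Q' \<in> {Q' \<in> range ?D. x \<in> Q'}"
    then obtain p where p: "Q' = ?D p" "x \<in> ?D p" by auto
    have "?t p * indicator (?D p) x \<le> (SUP p. ?t p * indicator (?D p) x)"
      by (rule SUP_upper) simp
    then show "?T Q' \<le> (SUP p. ?t p * indicator (?D p) x)"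
      using p by (simp add: side_length_dyadic_cube[OF l])
  qed
  show "(SUP p. ?t p * indicator (?D p) x) \<le> dyadic_maximal \<alpha> (cube a l) \<mu> x"
  proof (rule SUP_least)
    fix p
    show "?t p * indicator (?D p) x \<le> dyadic_maximal \<alpha> (cube a l) \<mu> x"
    proof (cases "x \<in> ?D p")
      case True
      then have "?T (?D p) \<le> dyadic_maximal \<alpha> (cube a l) \<mu> x"
        unfolding dyadic_maximal_def dyadic_eq[OF l] by (intro SUP_upper) auto
      then show ?thesis using True by (simp add: side_length_dyadic_cube[OF l])
    qed simp
  qed
qed

lemma weak_deriv_uminus:
  assumes "weak_deriv f g"
  shows "weak_deriv (\<lambda>x. - f x) (\<lambda>x. - g x)"
proof -
  interpret weak_deriv f g by fact
  have neg: "locally_integrable_borel (\<lambda>x. - F x)" if "locally_integrable_borel F" for F :: "real ^ 'a \<Rightarrow> real"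
    using that by (auto simp: locally_integrable_borel_def)
  show ?thesis
    using f g by unfold_locales (auto simp: weak intro!: neg)
qed

text \<open>The dyadic argument runs on the Borel representative f, while F is the given function,
  equal to it \<mu>-almost everywhere. The constant collects a factor 2 from the overlap and another
  from treating both f and - f.\<close>

lemma (in weak_deriv) weighted_poincare:
  fixes \<mu> :: "(real ^ 'n) measure" and F :: "real ^ 'n \<Rightarrow> real" and q \<alpha> l :: real and a :: "real ^ 'n"
  assumes q: "1 \<le> q" and \<alpha>: "\<alpha> = CARD('n) - q * (CARD('n) - 1)" and l: "0 < l"
    and sets_\<mu>: "sets \<mu> = sets borel" and fin: "\<And>K. compact K \<Longrightarrow> emeasure \<mu> K < \<infinity>"
    and F: "AE x in \<mu>. F x = f x"
    and reg: "absolutely_continuous lborel \<mu> \<or> continuous_on UNIV f"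
    and avg: "avg = (\<integral>y. f y * indicator (cube a l) y \<partial>lborel) / l ^ CARD('n)"
  shows "ennpowr (\<integral>\<^sup>+x\<in>cube a l. ennreal (\<bar>F x - avg\<bar> powr q) \<partial>\<mu>) (1 / q) \<le>
    ennreal (4 * (CARD('n) * 4 ^ Suc CARD('n))) *
      (\<integral>\<^sup>+y\<in>cube a l. ennreal (norm (g y)) * ennpowr (dyadic_maximal \<alpha> (cube a l) \<mu> y) (1 / q) \<partial>lborel)"
proof -
  let ?\<gamma> = "1 / 2 ^ Suc CARD('n) :: real"
  let ?D = "dyadic_cube a l"
  obtain s1 where "dyadic_quantiles f g a l ?\<gamma> s1" using ex_dyadic_quantiles[OF l] by blast
  then interpret P: dyadic_quantiles f g a l ?\<gamma> s1 .
  interpret neg: weak_deriv "\<lambda>x. - f x" "\<lambda>x. - g x"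
    by (rule weak_deriv_uminus) (rule weak_deriv_axioms)
  obtain s2 where "dyadic_quantiles (\<lambda>x. - f x) (\<lambda>x. - g x) a l ?\<gamma> s2" using neg.ex_dyadic_quantiles[OF l] by blast
  then interpret N: dyadic_quantiles "\<lambda>x. - f x" "\<lambda>x. - g x" a l ?\<gamma> s2 .
  have c: "P.mean = avg" "N.mean = - avg"
    by (simp_all add: P.mean_def N.mean_def avg)
  \<comment> \<open>The jumps of f bound f - avg and those of - f bound avg - f; their sum dominates
    |f - avg|, and the triangle inequality is applied once to both.\<close>
  define \<tau> where "\<tau> p = jump P.mean s1 p + jump N.mean s2 p" for p
  define \<kappa> where "\<kappa> p = measure \<mu> (?D p) powr (1 / q)" for p
  define W where "W y = ennpowr (dyadic_maximal \<alpha> (cube a l) \<mu> y) (1 / q)" for y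
  have \<tau>0: "0 \<le> \<tau> p" for p by (simp add: \<tau>_def jump_nonneg)
  have finD: "emeasure \<mu> (?D p) < \<infinity>" for p
    by (rule fin) (simp add: dyadic_cube_def cube_def)
  have AE1: "AE x in \<mu>. x \<in> cube a l \<longrightarrow> (\<forall>t. t < f x \<longrightarrow> (\<exists>p. x \<in> ?D p \<and> t < s1 p))"
    using reg
  proof
    assume "absolutely_continuous lborel \<mu>"
    then show ?thesis
      by (rule absolutely_continuous_AE[rotated]) (use P.AE_quantile_gt sets_\<mu> in auto)
  qed (use P.continuous_quantile_gt in auto)
  have AE2: "AE x in \<mu>. x \<in> cube a l \<longrightarrow> (\<forall>t. t < - f x \<longrightarrow> (\<exists>p. x \<in> ?D p \<and> t < s2 p))"
    using reg
  proof
    assume "absolutely_continuous lborel \<mu>"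
    then show ?thesis
      by (rule absolutely_continuous_AE[rotated]) (use N.AE_quantile_gt sets_\<mu> in auto)
  next
    assume "continuous_on UNIV f"
    then have "continuous_on UNIV (\<lambda>x. - f x)" by (rule continuous_on_minus)
    then show ?thesis using N.continuous_quantile_gt by auto
  qed
  have "ennpowr (\<integral>\<^sup>+x. ennreal ((\<bar>F x - avg\<bar> * indicator (cube a l) x) powr q) \<partial>\<mu>) (1 / q)
      \<le> (\<integral>\<^sup>+p. ennreal (\<tau> p * measure \<mu> (?D p) powr (1 / q)) \<partial>count_space UNIV)"
  proof (rule ennpowr_nn_integral_le_sum[OF q _ finD \<tau>0])
    show "?D p \<in> sets \<mu>" for p by (simp add: sets_\<mu>)
    show "AE x in \<mu>. ennreal (\<bar>F x - avg\<bar> * indicator (cube a l) x) \<le>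
        (\<integral>\<^sup>+p. ennreal (\<tau> p) * indicator (?D p) x \<partial>count_space UNIV)"
      using AE1 AE2 F
    proof eventually_elim
      case (elim x)
      show ?case
      proof (cases "x \<in> cube a l")
        case True
        have "ennreal (f x - avg) \<le> (\<integral>\<^sup>+p. ennreal (jump P.mean s1 p) * indicator (?D p) x \<partial>count_space UNIV)"
          using P.pointwise_bound[of x] elim(1) True by (simp add: c)
        also have "\<dots> \<le> (\<integral>\<^sup>+p. ennreal (\<tau> p) * indicator (?D p) x \<partial>count_space UNIV)"
          by (intro nn_integral_mono mult_right_mono ennreal_leI) (auto simp: \<tau>_def jump_nonneg)
        finally have 1: "ennreal (f x - avg) \<le> \<dots>" .
        have "ennreal (avg - f x) \<le> (\<integral>\<^sup>+p. ennreal (jump N.mean s2 p) * indicator (?D p) x \<partial>count_space UNIV)"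
          using N.pointwise_bound[of x] elim(2) True by (simp add: c)
        also have "\<dots> \<le> (\<integral>\<^sup>+p. ennreal (\<tau> p) * indicator (?D p) x \<partial>count_space UNIV)"
          by (intro nn_integral_mono mult_right_mono ennreal_leI) (auto simp: \<tau>_def jump_nonneg)
        finally have 2: "ennreal (avg - f x) \<le> \<dots>" .
        have "\<bar>F x - avg\<bar> = f x - avg \<or> \<bar>F x - avg\<bar> = avg - f x"
          using elim(3) by (auto simp: abs_if)
        then show ?thesis using 1 2 True by auto
      qed simp
    qed
  qed simp
  also have "(\<lambda>x. ennreal ((\<bar>F x - avg\<bar> * indicator (cube a l) x) powr q))
      = (\<lambda>x. ennreal (\<bar>F x - avg\<bar> powr q) * indicator (cube a l) x)"
    by (auto simp: indicator_def)
  also have "(\<integral>\<^sup>+p. ennreal (\<tau> p * measure \<mu> (?D p) powr (1 / q)) \<partial>count_space UNIV)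
      = (\<integral>\<^sup>+p. ennreal (jump P.mean s1 p * \<kappa> p) + ennreal (jump N.mean s2 p * \<kappa> p) \<partial>count_space UNIV)"
    by (intro nn_integral_cong)
      (simp add: \<tau>_def \<kappa>_def distrib_right ennreal_plus[symmetric] jump_nonneg del: ennreal_plus)
  also have "\<dots> = (\<integral>\<^sup>+p. ennreal (jump P.mean s1 p * \<kappa> p) \<partial>count_space UNIV)
      + (\<integral>\<^sup>+p. ennreal (jump N.mean s2 p * \<kappa> p) \<partial>count_space UNIV)"
    by (rule nn_integral_add) auto
  also have "\<dots> \<le> ennreal (2 * (CARD('n) * 4 ^ Suc CARD('n))) * (\<integral>\<^sup>+y. ennreal (norm (g y)) * W y * indicator (cube a l) y \<partial>lborel)
      + ennreal (2 * (CARD('n) * 4 ^ Suc CARD('n))) * (\<integral>\<^sup>+y. ennreal (norm (g y)) * W y * indicator (cube a l) y \<partial>lborel)"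
  proof -
    \<comment> \<open>Written as a supremum over the countable type of addresses, with 0 for cubes
      that miss y, the maximal function is Borel measurable.\<close>
    have W_meas: "W \<in> borel_measurable borel"
      unfolding W_def dyadic_maximal_eq_SUP[OF l] by measurable
    have \<kappa>0: "0 \<le> \<kappa> p" for p by (simp add: \<kappa>_def)
    have W_ge: "ennreal (\<kappa> p / (l / 2 ^ length p) ^ (CARD('n) - 1)) \<le> W y" if y: "y \<in> ?D p" for p y
    proof -
      define r where "r = l / 2 ^ length p"
      define m where "m = measure \<mu> (?D p)"
      have r: "0 < r" using l by (simp add: r_def)
      have em: "emeasure \<mu> (?D p) = ennreal m"
        using finD[of p] unfolding m_def by (intro emeasure_eq_ennreal_measure) auto
      have "ennreal (r powr \<alpha>) * (ennreal m / ennreal (r ^ CARD('n))) \<le> dyadic_maximal \<alpha> (cube a l) \<mu> y"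
      proof -
        have "ennreal (r powr \<alpha>) * (emeasure \<mu> (?D p) / emeasure lborel (?D p)) * indicator (?D p) y
            \<le> dyadic_maximal \<alpha> (cube a l) \<mu> y"
          unfolding dyadic_maximal_eq_SUP[OF l] r_def by (rule SUP_upper) simp
        then show ?thesis using y l by (simp add: em emeasure_dyadic_cube r_def)
      qed
      moreover have "ennreal (r powr \<alpha>) * (ennreal m / ennreal (r ^ CARD('n))) = ennreal (r powr \<alpha> * (m / r ^ CARD('n)))"
        using r by (simp add: divide_ennreal m_def ennreal_mult[symmetric])
      ultimately have "ennpowr (ennreal (r powr \<alpha> * (m / r ^ CARD('n)))) (1 / q) \<le> W y"
        unfolding W_def using q by (intro ennpowr_mono) auto
      moreover have "ennpowr (ennreal (r powr \<alpha> * (m / r ^ CARD('n)))) (1 / q) = ennreal (m powr (1 / q) / r ^ (CARD('n) - 1))"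
      proof -
        have n: "real (CARD('n) - 1) = real CARD('n) - 1" by (simp add: of_nat_diff)
        \<comment> \<open>Since \<alpha> - n = - q (n - 1), the power 1 / q turns r^(\<alpha> - n)
          into r^(-(n - 1)).\<close>
        have "r powr \<alpha> * (m / r ^ CARD('n)) = m * r powr (\<alpha> - CARD('n))"
          using r by (simp add: powr_diff powr_realpow)
        also have "\<alpha> - CARD('n) = - (q * real (CARD('n) - 1))"
          unfolding \<alpha> n by simp
        also have "(m * r powr (- (q * real (CARD('n) - 1)))) powr (1 / q)
            = m powr (1 / q) * r powr (- real (CARD('n) - 1))"
          using q r by (simp add: m_def powr_mult powr_powr)
        also have "r powr (- real (CARD('n) - 1)) = inverse (r ^ (CARD('n) - 1))"
          unfolding powr_minus powr_realpow[OF r] ..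
        finally show ?thesis
          using r by (simp add: ennpowr_ennreal m_def divide_inverse)
      qed
      ultimately show ?thesis by (simp add: \<kappa>_def m_def r_def)
    qed
    show ?thesis
      using P.sum_jumps_bound[OF W_meas \<kappa>0, unfolded P.side_def, OF W_ge]
        N.sum_jumps_bound[OF W_meas \<kappa>0, unfolded N.side_def, OF W_ge]
      by (intro add_mono) simp_all
  qed
  also have "\<dots> = ennreal (4 * (CARD('n) * 4 ^ Suc CARD('n))) * (\<integral>\<^sup>+y. ennreal (norm (g y)) * W y * indicator (cube a l) y \<partial>lborel)"
  proof -
    have "ennreal (real (2 * k)) + ennreal (real (2 * k)) = ennreal (real (4 * k))" for k
      by (subst ennreal_plus[symmetric]) auto
    then show ?thesis by (simp only: distrib_right[symmetric])
  qed
  finally show ?thesis unfolding W_def .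
qed

section \<open>From Lebesgue measurable Sobolev functions to Borel representatives, and the
  theorem\<close>

lemma borel_measurable_if_locally_integrable:
  fixes f :: "real ^ 'n \<Rightarrow> 'b::euclidean_space"
  assumes "locally_integrable f"
  shows "f \<in> borel_measurable lebesgue"
proof (rule borel_measurable_LIMSEQ_metric)
  let ?B = "\<lambda>k::nat. cbox (- (real k *\<^sub>R One)) (real k *\<^sub>R One) :: (real ^ 'n) set"
  show "(\<lambda>x. indicator (?B k) x *\<^sub>R f x) \<in> borel_measurable lebesgue" for k
    using assms unfolding locally_integrable_def set_integrable_def
    by (intro borel_measurable_integrable) simp
  fix x :: "real ^ 'n"
  have "x \<in> (\<Union>k::nat. box (- (real k *\<^sub>R One)) (real k *\<^sub>R One))"
    by (subst UN_box_eq_UNIV) simp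
  then obtain k :: nat where k: "x \<in> box (- (real k *\<^sub>R One)) (real k *\<^sub>R One)" by blast
  have "indicator (?B j) x *\<^sub>R f x = f x" if "k \<le> j" for j
  proof -
    have "real k \<le> real j" using that by simp
    then have "x \<in> ?B j" using k unfolding mem_box by (auto dest!: bspec)
    then show ?thesis by simp
  qed
  then show "(\<lambda>k. indicator (?B k) x *\<^sub>R f x) \<longlonglongrightarrow> f x"
    by (intro tendsto_eventually) (auto simp: eventually_sequentially)
qed

lemma locally_integrable_borel_AE_eq:
  fixes f f' :: "real ^ 'n \<Rightarrow> real"
  assumes f: "locally_integrable f" and f' [measurable]: "f' \<in> borel_measurable borel"
    and eq: "AE x in lebesgue. f x = f' x"
  shows "locally_integrable_borel f'"
proof -
  have "integrable lborel (\<lambda>x. indicator (cbox a b) x * f' x)" for a b :: "real ^ 'n"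
  proof -
    have "integrable lebesgue (\<lambda>x. indicator (cbox a b) x *\<^sub>R f x)"
      using f by (simp add: locally_integrable_def set_integrable_def)
    then have "integrable lebesgue (\<lambda>x. indicator (cbox a b) x *\<^sub>R f' x)"
    proof (rule integrable_cong_AE_imp)
      show "(\<lambda>x. indicator (cbox a b) x *\<^sub>R f' x) \<in> borel_measurable lebesgue"
        by (rule measurable_completion) simp
      show "AE x in lebesgue. indicator (cbox a b) x *\<^sub>R f x = indicator (cbox a b) x *\<^sub>R f' x"
        using eq by eventually_elim simp
    qed
    then show ?thesis by (subst (asm) integrable_completion) auto
  qed
  then show ?thesis by (simp add: locally_integrable_borel_def)
qed

lemma locally_integrable_inner:
  fixes g :: "real ^ 'n \<Rightarrow> real ^ 'n"
  assumes "locally_integrable g"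
  shows "locally_integrable (\<lambda>x. g x \<bullet> h)"
  unfolding locally_integrable_def set_integrable_def
proof (intro allI impI)
  fix K :: "(real ^ 'n) set" assume "compact K"
  then have "integrable lebesgue (\<lambda>x. indicator K x *\<^sub>R g x)"
    using assms by (simp add: locally_integrable_def set_integrable_def)
  from integrable_inner_left[OF this, of h]
  show "integrable lebesgue (\<lambda>x. indicator K x *\<^sub>R (g x \<bullet> h))" by simp
qed

lemma ex_borel_version:
  fixes g :: "real ^ 'n \<Rightarrow> real ^ 'n"
  assumes g: "g \<in> borel_measurable lebesgue"
  obtains g' where "g' \<in> borel_measurable borel" "AE x in lebesgue. g x = g' x"
proof -
  have "(\<lambda>x. g x $ i) \<in> borel_measurable lebesgue" for i
    using borel_measurable_inner[OF g borel_measurable_const[of "axis i 1"]] by (simp add: inner_axis)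
  then have "\<forall>i. \<exists>u. u \<in> borel_measurable lborel \<and> (AE x in lborel. g x $ i = u x)"
    using completion_ex_borel_measurable_real by blast
  from choice[OF this] obtain u where u: "\<And>i. u i \<in> borel_measurable lborel"
    "\<And>i. AE x in lborel. g x $ i = u i x" by blast
  define g' where "g' x = (\<chi> i. u i x)" for x
  show ?thesis
  proof
    show "g' \<in> borel_measurable borel"
      by (subst borel_measurable_euclidean_space)
        (use u(1) in \<open>auto simp: g'_def Basis_vec_def inner_axis\<close>)
    have "AE x in lborel. \<forall>i. g x $ i = u i x"
      unfolding AE_all_countable using u(2) by simp
    then have "AE x in lborel. g x = g' x"
      by eventually_elim (simp add: g'_def vec_eq_iff)
    then show "AE x in lebesgue. g x = g' x" by (rule AE_completion)
  qed
qed

lemma integral_lebesgue_AE_eq: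
  fixes u v :: "real ^ 'n \<Rightarrow> real"
  assumes "u \<in> borel_measurable lebesgue" "v \<in> borel_measurable borel" "AE x in lebesgue. u x = v x"
  shows "(LINT x|lebesgue. u x) = (\<integral>x. v x \<partial>lborel)"
proof -
  have "(LINT x|lebesgue. u x) = (LINT x|lebesgue. v x)"
    by (rule integral_cong_AE[OF assms(1) _ assms(3)]) (rule measurable_completion, simp add: assms(2))
  also have "\<dots> = (\<integral>x. v x \<partial>lborel)"
    using assms by (intro integral_completion) simp
  finally show ?thesis .
qed

text \<open>The weak equation sees f and g through integrals only, so it passes to Borel functions
  equal almost everywhere, for which \<open>lebesgue\<close> and \<open>lborel\<close> give the same
  integrals.\<close>

lemma weak_deriv_if_weak_gradient:
  fixes f f' :: "real ^ 'n \<Rightarrow> real" and g g' :: "real ^ 'n \<Rightarrow> real ^ 'n"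
  assumes wg: "weak_gradient f g"
    and f' [measurable]: "f' \<in> borel_measurable borel" and f_eq: "AE x in lebesgue. f x = f' x"
    and g' [measurable]: "g' \<in> borel_measurable borel" and g_eq: "AE x in lebesgue. g x = g' x"
  shows "weak_deriv f' g'"
proof
  have lf: "locally_integrable f" and lg: "locally_integrable g"
    using wg by (simp_all add: weak_gradient_def)
  have mf: "f \<in> borel_measurable lebesgue" and mg: "g \<in> borel_measurable lebesgue"
    using lf lg by (auto intro: borel_measurable_if_locally_integrable)
  show "locally_integrable_borel f'"
    by (rule locally_integrable_borel_AE_eq[OF lf f' f_eq])
  show "g' \<in> borel_measurable borel" by fact
  show "locally_integrable_borel (\<lambda>x. g' x \<bullet> h)" for h
    by (rule locally_integrable_borel_AE_eq[OF locally_integrable_inner[OF lg, of h]])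
      (use g_eq in \<open>auto elim: AE_mp\<close>)
  fix c d :: "real ^ 'n" and e :: real and i :: 'n assume e: "0 < e"
  note [measurable] = borel_measurable_box_bump[OF e, of c d] borel_measurable_partial_box_bump[OF e, of i c d]
  have leb: "box_bump c d e \<in> borel_measurable lebesgue" "partial_deriv i (box_bump c d e) \<in> borel_measurable lebesgue"
    by (auto intro!: measurable_completion)
  have gi: "(\<lambda>x. g x $ i) \<in> borel_measurable lebesgue"
    using borel_measurable_inner[OF mg borel_measurable_const[of "axis i 1"]] by (simp add: inner_axis)
  have g'i [measurable]: "(\<lambda>x. g' x $ i) \<in> borel_measurable borel"
    using borel_measurable_inner[OF g' borel_measurable_const[of "axis i 1"]] by (simp add: inner_axis)
  have "(\<integral>x. f' x * partial_deriv i (box_bump c d e) x \<partial>lborel)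
      = (LINT x|lebesgue. f x * partial_deriv i (box_bump c d e) x)"
    using f_eq by (intro integral_lebesgue_AE_eq[symmetric] borel_measurable_times mf leb) (auto elim: AE_mp)
  also have "\<dots> = - (LINT x|lebesgue. g x $ i * box_bump c d e x)"
    using wg test_function_box_bump[OF e] unfolding weak_gradient_def by blast
  also have "(LINT x|lebesgue. g x $ i * box_bump c d e x) = (\<integral>x. g' x $ i * box_bump c d e x \<partial>lborel)"
    using g_eq by (intro integral_lebesgue_AE_eq borel_measurable_times gi leb) (auto elim: AE_mp)
  finally show "(\<integral>x. f' x * partial_deriv i (box_bump c d e) x \<partial>lborel) = - (\<integral>x. g' x $ i * box_bump c d e x \<partial>lborel)" .
qed

text \<open>For n = 1 the bound n / (n - 1) stands for infinity, whereas division by zero would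
  yield 0; hence the guard on the dimension. The left integral is taken over the completion of \<mu>
  because f may be merely Lebesgue measurable; for absolutely continuous \<mu> such an f is
  measurable there.\<close>

theorem corollary6p5:
  shows "\<exists>C>0. \<forall>(q::real) (\<alpha>::real) (\<mu>::(real ^ 'n) measure) f g Q.
    1 \<le> q \<longrightarrow>
    (1 < CARD('n) \<longrightarrow> q \<le> real CARD('n) / (real CARD('n) - 1)) \<longrightarrow>
    \<alpha> = real CARD('n) - q * (real CARD('n) - 1) \<longrightarrow>
    radon_measure \<mu> \<longrightarrow>
    (absolutely_continuous lborel \<mu> \<and> f \<in> W11_loc) \<or> (continuous_on UNIV f \<and> f \<in> W11) \<longrightarrow>
    weak_gradient f g \<longrightarrow>
    is_cube Q \<longrightarrow>
    ennpowr (\<integral>\<^sup>+x\<in>Q. ennreal (\<bar>f x - average Q f\<bar> powr q) \<partial>completion \<mu>) (1 / q)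
      \<le> ennreal C * (\<integral>\<^sup>+x\<in>Q. ennreal (norm (g x)) * ennpowr (dyadic_maximal \<alpha> Q \<mu> x) (1 / q) \<partial>lebesgue)"
proof (intro exI conjI allI impI)
  let ?C = "real (4 * (CARD('n) * 4 ^ Suc CARD('n)))"
  show "0 < ?C" by simp
  fix q \<alpha> :: real and \<mu> :: "(real ^ 'n) measure" and f :: "real ^ 'n \<Rightarrow> real"
    and g :: "real ^ 'n \<Rightarrow> real ^ 'n" and Q :: "(real ^ 'n) set"
  assume q: "1 \<le> q" and \<alpha>: "\<alpha> = real CARD('n) - q * (real CARD('n) - 1)"
    and radon: "radon_measure \<mu>"
    and reg: "(absolutely_continuous lborel \<mu> \<and> f \<in> W11_loc) \<or> (continuous_on UNIV f \<and> f \<in> W11)"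
    and wg: "weak_gradient f g" and Q: "is_cube Q"
  obtain a l where l: "0 < l" and Q_eq: "Q = cube a l" using Q by (auto simp: is_cube_def)
  have sets_\<mu>: "sets \<mu> = sets borel" and fin: "\<And>K. compact K \<Longrightarrow> emeasure \<mu> K < \<infinity>"
    using radon by (auto simp: radon_measure_def)
  have mf: "f \<in> borel_measurable lebesgue" and mg: "g \<in> borel_measurable lebesgue"
    using wg by (auto simp: weak_gradient_def intro: borel_measurable_if_locally_integrable)
  obtain g' where g': "g' \<in> borel_measurable borel" and g_eq: "AE x in lebesgue. g x = g' x"
    using ex_borel_version[OF mg] by blast
  \<comment> \<open>A continuous f is kept as it is, since changing it on a Lebesgue null set may
    matter to a singular \<mu>. Otherwise \<mu> is absolutely continuous, and a Borel version agrees
    with f also \<mu>-almost everywhere.\<close>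
  have "\<exists>f'. f' \<in> borel_measurable borel \<and> (AE x in lebesgue. f x = f' x) \<and> (AE x in \<mu>. f x = f' x) \<and>
      (absolutely_continuous lborel \<mu> \<or> continuous_on UNIV f')"
  proof (cases "continuous_on UNIV f")
    case True
    then show ?thesis by (auto intro!: exI[of _ f] borel_measurable_continuous_onI)
  next
    case False
    then have ac: "absolutely_continuous lborel \<mu>" using reg by blast
    obtain f' where f': "f' \<in> borel_measurable lborel" "AE x in lborel. f x = f' x"
      using completion_ex_borel_measurable_real[OF mf] by blast
    have "AE x in \<mu>. f x = f' x"
      by (rule absolutely_continuous_AE[OF _ ac f'(2)]) (simp add: sets_\<mu>)
    then show ?thesis using f' ac by (auto intro!: exI[of _ f'] AE_completion)
  qed
  then obtain f' where f': "f' \<in> borel_measurable borel" and f_eq: "AE x in lebesgue. f x = f' x"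
    and f_eq_\<mu>: "AE x in \<mu>. f x = f' x" and reg': "absolutely_continuous lborel \<mu> \<or> continuous_on UNIV f'"
    by blast
  interpret weak_deriv f' g'
    by (rule weak_deriv_if_weak_gradient[OF wg f' f_eq g' g_eq])
  have avg: "average Q f = (\<integral>y. f' y * indicator (cube a l) y \<partial>lborel) / l ^ CARD('n)"
  proof -
    have "cube a l \<in> sets lebesgue" by simp
    then have "(LINT x:Q|lebesgue. f x) = (\<integral>y. f' y * indicator (cube a l) y \<partial>lborel)"
      unfolding set_lebesgue_integral_def Q_eq using f_eq f'
      by (intro integral_lebesgue_AE_eq borel_measurable_scaleR borel_measurable_indicator mf)
        (auto elim: AE_mp)
    moreover have "measure lebesgue Q = l ^ CARD('n)"
      using l by (simp add: Q_eq measure_def emeasure_cube)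
    ultimately show ?thesis by (simp add: average_def)
  qed
  have "ennpowr (\<integral>\<^sup>+x\<in>Q. ennreal (\<bar>f x - average Q f\<bar> powr q) \<partial>completion \<mu>) (1 / q)
      = ennpowr (\<integral>\<^sup>+x\<in>cube a l. ennreal (\<bar>f x - average Q f\<bar> powr q) \<partial>\<mu>) (1 / q)"
    by (simp add: Q_eq nn_integral_completion)
  also have "\<dots> \<le> ennreal ?C *
      (\<integral>\<^sup>+y\<in>cube a l. ennreal (norm (g' y)) * ennpowr (dyadic_maximal \<alpha> (cube a l) \<mu> y) (1 / q) \<partial>lborel)"
    by (rule weighted_poincare[OF q _ l sets_\<mu> fin f_eq_\<mu> reg' avg]) (simp add: \<alpha> of_nat_diff)
  also have "(\<integral>\<^sup>+y\<in>cube a l. ennreal (norm (g' y)) * ennpowr (dyadic_maximal \<alpha> (cube a l) \<mu> y) (1 / q) \<partial>lborel)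
      = (\<integral>\<^sup>+x\<in>Q. ennreal (norm (g x)) * ennpowr (dyadic_maximal \<alpha> Q \<mu> x) (1 / q) \<partial>lebesgue)"
    unfolding nn_integral_completion Q_eq
    using g_eq by (intro nn_integral_cong_AE) (auto simp: AE_completion_iff elim: AE_mp)
  finally show "ennpowr (\<integral>\<^sup>+x\<in>Q. ennreal (\<bar>f x - average Q f\<bar> powr q) \<partial>completion \<mu>) (1 / q)
      \<le> ennreal ?C * (\<integral>\<^sup>+x\<in>Q. ennreal (norm (g x)) * ennpowr (dyadic_maximal \<alpha> Q \<mu> x) (1 / q) \<partial>lebesgue)" .
qed

end
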